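(* Let $\xi>0$ be real. For $k\in\mathbb{Z}_{\ge 0}$ let $$\omega_H(k;\xi)=\lim_{a\to\infty}\frac{M(H_{a,b}\setminus(\triangleright_k\cup\triangleleft_k))}{M(H_{a,b})},$$ where $b\sim\xi a$. Then, as $k\to\infty$, $$\omega_H(k;\xi)\sim\left(\frac{1}{2k\pi}\left(\frac{\xi+1}{2}\right)^{2k-2}\right)^2 .$$
   Context: Lattice: consider the triangular lattice of unit equilateral triangles in the plane, drawn so that one family of lattice lines is vertical (consecutive vertical lattice lines are $\sqrt3/2$ apart). For positive integers $a,b$, $H_{a,b}$ is the lattice hexagon with side lengths $a,b,a,a,b,a$ going clockwise from the southwest edge (so the two sides of length $b$ are vertical); $O$ is its centre, and its horizontal symmetry axis is the horizontal line through $O$. Holes: for an integer $k$ with $0\le k\le a$, $\triangleright_k$ is the right-pointing equilateral lattice triangle of side length two whose vertical side lies on the vertical lattice line at lattice distance $k$ (Euclidean distance $k\sqrt3/2$) to the left of $O$ and has its midpoint on the horizontal symmetry axis; $\triangleleft_k$ is its mirror image in the vertical line through $O$ (a left-pointing triangle). These are lattice triangles exactly when $a+b+k$ is even, which is always assumed. $H_{a,b}\setminus(\triangleright_k\cup\triangleleft_k)$ is the hexagon with both triangles removed. A unit rhombus is the union of two unit lattice triangles sharing an edge; a (rhombus) tiling of a region is a covering of it by non-overlapping unit rhombi contained in it; $M(R)$ is the number of rhombus tilings of $R$. Limit convention: $a\to\infty$ through the positive integers and $b=b(a)$ is a positive integer with $b/a\to\xi$ and $a+b\equiv k\pmod 2$.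 For functions of $k$, $f(k)\sim g(k)$ means $f(k)/g(k)\to1$ as $k\to\infty$. *)

theory Defs
  imports Complex_Main "HOL-Library.Disjoint_Sets" "HOL-Library.Landau_Symbols"
begin

text \<open>
  The pair \<open>(x, y)\<close> of integers stands for the point of the plane with Cartesian coordinates
  \<open>(sqrt 3 / 2 * x, y / 2)\<close>, with the centre \<open>O\<close> of the hexagon as origin.  The vertical
  diameter of the hexagon runs along a lattice line from \<open>(0, - a - b)\<close> to \<open>(0, a + b)\<close>, and
  lattice neighbours differ by \<open>(0, 2)\<close>, \<open>(1, 1)\<close> or \<open>(1, - 1)\<close> up to sign.  Hence \<open>O\<close> itself is a
  lattice point only if \<open>a + b\<close> is even, and the lattice depends on the parity of \<open>a + b\<close>.
\<close>

type_synonym point = "int \<times> int"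

definition lattice_points :: "nat \<Rightarrow> nat \<Rightarrow> point set" where
  "lattice_points a b = {(x, y). even (x + y + int a + int b)}"

text \<open>A unit triangle is represented by the set of its three vertices.\<close>

definition right_triangle :: "int \<Rightarrow> int \<Rightarrow> point set" where
  "right_triangle x y = {(x, y - 1), (x, y + 1), (x + 1, y)}"

definition left_triangle :: "int \<Rightarrow> int \<Rightarrow> point set" where
  "left_triangle x y = {(x, y - 1), (x, y + 1), (x - 1, y)}"

definition unit_triangles :: "nat \<Rightarrow> nat \<Rightarrow> point set set" where
  "unit_triangles a b =
     {t. (\<exists>x y. t = right_triangle x y \<or> t = left_triangle x y) \<and> t \<subseteq> lattice_points a b}"

text \<open>
  A region is represented by the set of the unit triangles it consists of.  The polygons used
  below are convex, so that a triangle lies in the polygon iff its vertices do.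
\<close>

type_synonym region = "point set set"

definition cells_in :: "nat \<Rightarrow> nat \<Rightarrow> point set \<Rightarrow> region" where
  "cells_in a b P = {t \<in> unit_triangles a b. t \<subseteq> P}"

text \<open>The hexagon with corners \<open>(0, \<plusminus>(a + b))\<close> and \<open>(\<plusminus>a, \<plusminus>b)\<close>.\<close>

definition hexagon :: "nat \<Rightarrow> nat \<Rightarrow> region" where
  "hexagon a b = cells_in a b {(x, y). \<bar>x\<bar> \<le> int a \<and> \<bar>x\<bar> + \<bar>y\<bar> \<le> int a + int b}"

text \<open>
  The triangle with corners \<open>(- k, \<plusminus>2)\<close> and \<open>(- k + 2, 0)\<close>; these are lattice points
  iff \<open>a + b + k\<close> is even.
\<close>

definition right_hole :: "nat \<Rightarrow> nat \<Rightarrow> nat \<Rightarrow> region" where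
  "right_hole a b k = cells_in a b {(x, y). - int k \<le> x \<and> (x + int k) + \<bar>y\<bar> \<le> 2}"

definition mirror :: "point \<Rightarrow> point" where
  "mirror = (\<lambda>(x, y). (- x, y))"

definition left_hole :: "nat \<Rightarrow> nat \<Rightarrow> nat \<Rightarrow> region" where
  "left_hole a b k = (\<lambda>t. mirror ` t) ` right_hole a b k"

definition holey_hexagon :: "nat \<Rightarrow> nat \<Rightarrow> nat \<Rightarrow> region" where
  "holey_hexagon a b k = hexagon a b - (right_hole a b k \<union> left_hole a b k)"

text \<open>
  Two unit triangles share an edge iff they have exactly two vertices in common.  A rhombus is
  again represented by the set of its unit triangles, so a tiling of a region is a partition of it
  into rhombi.
\<close>

definition is_rhombus :: "region \<Rightarrow> bool" where
  "is_rhombus r \<longleftrightarrow> (\<exists>a b. \<exists>s \<in> unit_triangles a b. \<exists>t \<in> unit_triangles a b.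
     card (s \<inter> t) = 2 \<and> r = {s, t})"

definition tilings :: "region \<Rightarrow> region set set" where
  "tilings R = {T. partition_on R T \<and> (\<forall>r \<in> T. is_rhombus r)}"

definition M :: "region \<Rightarrow> nat" where
  "M R = card (tilings R)"

text \<open>
  The limit along \<open>b \<sim> \<xi> a\<close> is required to be the same for every admissible choice of \<open>b = b(a)\<close>.
  The condition \<open>k \<le> a\<close> holds for all large \<open>a\<close>.
\<close>

definition admissible :: "real \<Rightarrow> nat \<Rightarrow> (nat \<Rightarrow> nat) \<Rightarrow> bool" where
  "admissible \<xi> k b \<longleftrightarrow> (\<forall>a>0. b a > 0 \<and> even (a + b a + k)) \<and>
     (\<lambda>a. real (b a) / real a) \<longlonglongrightarrow> \<xi>"

definition is_omega_H :: "nat \<Rightarrow> real \<Rightarrow> real \<Rightarrow> bool" where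
  "is_omega_H k \<xi> w \<longleftrightarrow> (\<forall>b. admissible \<xi> k b \<longrightarrow>
     (\<lambda>a. real (M (holey_hexagon a (b a) k)) / real (M (hexagon a (b a)))) \<longlonglongrightarrow> w)"

text \<open>Admissible \<open>b\<close> exist for every \<open>\<xi> > 0\<close>, so there is at most one such limit.\<close>

definition omega_H :: "nat \<Rightarrow> real \<Rightarrow> real" where
  "omega_H k \<xi> = (THE w. is_omega_H k \<xi> w)"

end

theory Submission
  imports Defs "HOL-Analysis.Analysis" "HOL-Real_Asymp.Real_Asymp" "Jordan_Normal_Form.Determinant"
begin

text \<open>
  Tilings are perfect matchings of the unit triangles, and all terms in the expansion of the
  determinant of the bipartite adjacency matrix have the same sign, so tilings are counted by its
  absolute value.  Removing a hole of side two amounts to removing two of its unit triangles of the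
  same orientation, since the other two are then forced to form a rhombus.  Hence the ratio of the
  counts is a 2 by 2 minor of the inverse matrix, which by reflection in the horizontal axis is the
  product of an even and an odd part.  The columns of the inverse are found by expanding a point mass
  on a vertical lattice line in discrete Chebyshev polynomials and continuing these to the other lines
  by iterated differences (Rodrigues' formula).  At the two points next to the axis these differences
  satisfy a hypergeometric recurrence and therefore have product form.  With \<open>\<tau> = 1 / (1 + \<xi>)\<close>, the
  resulting sums are Riemann sums for \<open>4 / \<pi>\<close> times the integrals over \<open>[\<tau>, 1]\<close> of
  \<open>sqrt (1 - \<sigma>\<^sup>2) (2 \<sigma>)\<^sup>-\<^sup>2\<^sup>k\<close> and \<open>\<sigma>\<^sup>2 (2 \<sigma>)\<^sup>-\<^sup>2\<^sup>k / sqrt (1 - \<sigma>\<^sup>2)\<close>, and as \<open>k \<rightarrow> \<infinity>\<close>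
  only a neighbourhood of \<open>\<sigma> = \<tau>\<close> contributes.
\<close>

section \<open>Determinants and matchings\<close>

text \<open>For the signs, pairs of cells are compared in lexicographic order. A horizontal rhombus
  contributes one sign for each rhombus crossing it in this order, and modulo 2 these are as many as
  the non-horizontal rhombi that start in its column. The region forces the counts per column from
  left to right, so the sign cannot depend on the matching. For the inverse, \<open>cdiff\<close>
  carries a solution from a vertical line to the next one on the left. A mode
  \<open>cdiffs (n - x) (rodr N n)\<close> vanishes beyond the slanted sides of the right half by
  itself, and the slanted sides of the left half impose nothing, since there the neighbours of a
  right cell stay in the hexagon. The remaining condition is that nothing survives on the line x =
  -a, which carries no left cells. Modes exist on all lines only for n \<ge> a. They suffice: after
  n + a differences a mode with n < a is a difference of order above 2n of a polynomial of degree
  2n, hence zero on that line. So completeness on the central line expresses the point mass, pushed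
  to x = -a, by the admissible modes alone.\<close>

definition inversion_sign :: "nat \<Rightarrow> (nat \<Rightarrow> nat) \<Rightarrow> int" where
  "inversion_sign n p = (\<Prod>(j, i) \<in> {(j, i). j < i \<and> i < n}. sgn (int (p i) - int (p j)) * sgn (int i - int j))"

lemma finite_less_pairs: "finite {(j, i). j < i \<and> i < (n::nat)}"
  by (rule finite_subset[of _ "{..<n} \<times> {..<n}"]) auto

text \<open>Increasing pairs represent unordered pairs, on which a permutation acts through
  \<open>min\<close> and \<open>max\<close>. The factor \<open>sgn (int i - int j)\<close> makes
  each factor of \<open>inversion_sign\<close> symmetric in its two indices; this is what allows a
  reindexing along this action.\<close>

lemma bij_betw_less_pairs:
  fixes n :: nat
  assumes "q permutes {..<n}"
  shows "bij_betw (\<lambda>(j, i). (min (q j) (q i), max (q j) (q i))) {(j, i). j < i \<and> i < n} {(j, i). j < i \<and> i < n}"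
proof -
  have *: "(min (p j) (p i), max (p j) (p i)) \<in> {(j, i). j < i \<and> i < n}"
    if "p permutes {..<n}" "j < i" "i < n" for p i j
  proof -
    have "p j \<noteq> p i" using inj_eq[OF permutes_inj[OF that(1)], of j i] that(2) by simp
    moreover have "p i < n" "p j < n"
      using permutes_in_image[OF that(1), of i] permutes_in_image[OF that(1), of j] that(2,3) by simp_all
    ultimately have "p j \<noteq> p i" "p i < n" "p j < n" .
    then show ?thesis by (auto simp: min_def max_def)
  qed
  note q = permutes_inverses[OF assms]
  show ?thesis
    by (rule bij_betwI[where g = "\<lambda>(j, i). (min (Hilbert_Choice.inv q j) (Hilbert_Choice.inv q i),
          max (Hilbert_Choice.inv q j) (Hilbert_Choice.inv q i))"])
       (use *[OF assms] *[OF permutes_inv[OF assms]] q in \<open>auto simp: min_def max_def split: if_splits\<close>)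
qed

text \<open>Reindexing the first product along q puts \<open>sgn (int (q i) - int (q j))\<close>
  into both products. Its square is 1, and what is left are the factors of the composite.\<close>

lemma inversion_sign_comp:
  assumes p: "p permutes {..<n}" and q: "q permutes {..<n}"
  shows "inversion_sign n (p \<circ> q) = inversion_sign n p * inversion_sign n q"
proof -
  let ?Q = "{(j, i). j < i \<and> i < n}"
  let ?s = "\<lambda>(j, i). sgn (int (p i) - int (p j)) * sgn (int i - int j)"
  have inj: "q i = q j \<longleftrightarrow> i = j" for i j using permutes_inj[OF q] by (auto dest: injD)
  have "inversion_sign n p = (\<Prod>x\<in>?Q. ?s ((\<lambda>(j, i). (min (q j) (q i), max (q j) (q i))) x))"
    unfolding inversion_sign_def by (rule prod.reindex_bij_betw[OF bij_betw_less_pairs[OF q], symmetric])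
  also have "\<dots> = (\<Prod>(j, i)\<in>?Q. sgn (int (p (q i)) - int (p (q j))) * sgn (int (q i) - int (q j)))"
    by (rule prod.cong) (auto simp: min_def max_def sgn_if)
  finally have "inversion_sign n p * inversion_sign n q =
     (\<Prod>(j, i)\<in>?Q. (sgn (int (p (q i)) - int (p (q j))) * sgn (int (q i) - int (q j))) *
        (sgn (int (q i) - int (q j)) * sgn (int i - int j)))"
    unfolding inversion_sign_def by (simp add: prod.distrib case_prod_beta)
  also have "\<dots> = inversion_sign n (p \<circ> q)"
    unfolding inversion_sign_def
  proof (rule prod.cong, goal_cases)
    case (2 x)
    obtain j i where x: "x = (j, i)" "j < i" using 2 by auto
    have "sgn (int (q i) - int (q j)) * sgn (int (q i) - int (q j)) = 1"
      using inj[of i j] x by (auto simp: sgn_if)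
    then show ?case using x by (simp add: algebra_simps)
  qed simp
  finally show ?thesis by simp
qed

lemma inversion_sign_id: "inversion_sign n id = 1"
  unfolding inversion_sign_def by (rule prod.neutral) (auto simp: sgn_if)

lemma inversion_sign_transpose_01:
  assumes "1 < n" shows "inversion_sign n (Transposition.transpose 0 1) = -1"
proof -
  let ?Q = "{(j, i). j < i \<and> i < n}"
  have "inversion_sign n (Transposition.transpose 0 1) = (\<Prod>x\<in>?Q. if x = (0, 1) then -1 else 1)"
    unfolding inversion_sign_def
  proof (rule prod.cong, goal_cases)
    case (2 x)
    obtain j i where x: "x = (j, i)" by force
    consider "j = 0" "i = 1" | "j = 0" "i > 1" | "j = 1" "i > 1" | "j > 1" "i > 1"
      using 2 x by fastforce
    then show ?case using 2 x by cases (auto simp: Transposition.transpose_def sgn_if)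
  qed simp
  also have "\<dots> = -1" using assms by (subst prod.delta[OF finite_less_pairs]) auto
  finally show ?thesis .
qed

text \<open>By multiplicativity the value is unchanged under conjugation, which reduces the claim to
  the swap of 0 and 1, where a single pair is inverted.\<close>

lemma inversion_sign_transpose:
  assumes "a < n" "b < n" "a \<noteq> b"
  shows "inversion_sign n (Transposition.transpose a b) = -1"
proof -
  have n: "1 < n" using assms by auto
  \<comment> \<open>With c the preimage of b under the swap of 0 and a, the permutation q below
    sends 0 to a and 1 to b, whatever coincidences there are among 0, 1, a and b.\<close>
  define c where "c = Transposition.transpose 0 a b"
  define q where "q = Transposition.transpose 0 a \<circ> Transposition.transpose 1 c"
  have c: "c < n" "c \<noteq> 0" using assms by (auto simp: c_def Transposition.transpose_def)
  have q: "q permutes {..<n}" unfolding q_def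
    by (rule permutes_compose; rule permutes_swap_id) (use n c assms in auto)
  have q01: "q 0 = a" "q 1 = b" using c assms by (auto simp: q_def c_def Transposition.transpose_def)
  have t01: "Transposition.transpose 0 1 permutes {..<n}" by (rule permutes_swap_id) (use n in auto)
  have "Hilbert_Choice.inv q a = 0" "Hilbert_Choice.inv q b = 1"
    using q01 permutes_inverses(2)[OF q] by metis+
  then have "Transposition.transpose a b \<circ> q = q \<circ> Transposition.transpose 0 1"
    using transpose_comp_eq[OF permutes_bij[OF q], of a b] by simp
  moreover have "Transposition.transpose a b permutes {..<n}" by (rule permutes_swap_id) (use assms in auto)
  ultimately have "inversion_sign n (Transposition.transpose a b) * inversion_sign n q = inversion_sign n q * (-1)"
    using inversion_sign_comp[OF _ q] inversion_sign_comp[OF q t01] inversion_sign_transpose_01[OF n] by metis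
  moreover have "inversion_sign n q * inversion_sign n (Hilbert_Choice.inv q) = 1"
    using inversion_sign_comp[OF q permutes_inv[OF q]] permutes_inv_o(1)[OF q] inversion_sign_id by simp
  then have "inversion_sign n q \<noteq> 0" by auto
  ultimately have "inversion_sign n q * (inversion_sign n (Transposition.transpose a b) + 1) = 0" "inversion_sign n q \<noteq> 0"
    by (simp_all add: algebra_simps)
  then show ?thesis by simp
qed

text \<open>\<open>sign\<close> counts transpositions, whereas the inversion product only compares
  orders and can therefore be evaluated on a matching directly.\<close>

lemma sign_eq_inversion_sign:
  assumes "p permutes {..<n}"
  shows "sign p = inversion_sign n p"
  using assms finite_lessThan
proof (induction rule: permutes_induct)
  case id
  then show ?case by (simp only: inversion_sign_id sign_id)
next
  case (swap a b p)
  have t: "Transposition.transpose a b permutes {..<n}" by (rule permutes_swap_id) (use swap in auto)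
  have p: "p permutes {..<n}" "a \<noteq> b" by fact+
  then have "permutation p" by (auto simp: permutation_permutes)
  then have "sign (Transposition.transpose a b \<circ> p) = - sign p"
    using p by (simp add: sign_compose permutation_swap_id sign_swap_id)
  moreover have "inversion_sign n (Transposition.transpose a b \<circ> p) = - inversion_sign n p"
    using inversion_sign_comp[OF t p(1)] inversion_sign_transpose[of a n b] swap by simp
  ultimately show ?case using swap by metis
qed

section \<open>Matchings as the nonzero terms of the Leibniz expansion\<close>

definition matchings :: "'a set \<Rightarrow> 'b set \<Rightarrow> ('a \<Rightarrow> 'b \<Rightarrow> bool) \<Rightarrow> ('a \<Rightarrow> 'b) set" where
  "matchings R L A = {f \<in> extensional R. bij_betw f R L \<and> (\<forall>r\<in>R. A r (f r))}"

text \<open>This is the sign of the permutation that a matching becomes once both sides are listed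
  by increasing key, written without choosing the enumerations.\<close>

definition matching_sign :: "('a \<Rightarrow> int) \<Rightarrow> ('b \<Rightarrow> int) \<Rightarrow> 'a set \<Rightarrow> ('a \<Rightarrow> 'b) \<Rightarrow> int" where
  "matching_sign kr kl R f =
     (\<Prod>(r, r') \<in> {(r, r'). r \<in> R \<and> r' \<in> R \<and> kr r < kr r'}. sgn (kl (f r') - kl (f r)))"

lemma ex_key_enumeration:
  fixes key :: "'a \<Rightarrow> int"
  assumes "finite R" "inj_on key R"
  obtains u where "bij_betw u {..<card R} R" "\<And>i j. i < card R \<Longrightarrow> j < card R \<Longrightarrow> key (u i) < key (u j) \<longleftrightarrow> i < j"
proof -
  define l where "l = sorted_list_of_set (key ` R)"
  have l: "set l = key ` R" "distinct l" "length l = card R" "sorted_wrt (<) l"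
    using assms card_image[OF assms(2)] by (auto simp: l_def strict_sorted_list_of_set)
  define u where "u = (\<lambda>i. inv_into R key (l ! i))"
  have "bij_betw (nth l) {..<card R} (key ` R)"
    using bij_betw_nth[OF l(2)] l by (metis)
  moreover have "bij_betw (inv_into R key) (key ` R) R"
    by (rule bij_betw_inv_into) (use assms in \<open>auto simp: bij_betw_def\<close>)
  ultimately have b: "bij_betw u {..<card R} R"
    using bij_betw_trans unfolding u_def comp_def by (fastforce simp: comp_def)
  have k: "key (u i) = l ! i" if "i < card R" for i
    unfolding u_def using l(1,3) that by (metis f_inv_into_f nth_mem)
  have m: "l ! i < l ! j" if "i < j" "j < card R" for i j
    using sorted_wrt_nth_less[OF l(4)] that l(3) by auto
  show ?thesis
    by (rule that[OF b]) (metis k m linorder_neqE_nat order_less_asym order_less_irrefl)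
qed

lemma inversion_sign_eq_matching_sign:
  assumes u: "bij_betw u {..<n} R" "\<And>i j. i < n \<Longrightarrow> j < n \<Longrightarrow> kr (u i) < kr (u j) \<longleftrightarrow> i < j"
    and v: "\<And>i j. i < n \<Longrightarrow> j < n \<Longrightarrow> kl (v i) < kl (v j) \<longleftrightarrow> i < j"
    and p: "p permutes {..<n}" and f: "\<And>i. i < n \<Longrightarrow> f (u i) = v (p i)"
  shows "inversion_sign n p = matching_sign kr kl R f"
proof -
  have uR: "i < n \<Longrightarrow> u i \<in> R" for i using u(1) by (auto simp: bij_betw_def)
  have pn: "i < n \<Longrightarrow> p i < n" for i using permutes_in_image[OF p] by simp
  have *: "bij_betw (map_prod u u) {(j, i). j < i \<and> i < n} {(r, r'). r \<in> R \<and> r' \<in> R \<and> kr r < kr r'}"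
    unfolding bij_betw_def
  proof
    show "inj_on (map_prod u u) {(j, i). j < i \<and> i < n}"
      using u(1) unfolding bij_betw_def inj_on_def by auto
    show "map_prod u u ` {(j, i). j < i \<and> i < n} = {(r, r'). r \<in> R \<and> r' \<in> R \<and> kr r < kr r'}"
    proof (safe, goal_cases)
      case (4 r r')
      then obtain i j where "r = u j" "r' = u i" "i < n" "j < n" using u(1) by (auto simp: bij_betw_def)
      then show ?case using 4 u(2) by (auto intro!: image_eqI[of _ _ "(j, i)"])
    qed (use u uR in auto)
  qed
  have "matching_sign kr kl R f =
      (\<Prod>x\<in>{(j, i). j < i \<and> i < n}. (\<lambda>(r, r'). sgn (kl (f r') - kl (f r))) (map_prod u u x))"
    unfolding matching_sign_def by (rule prod.reindex_bij_betw[OF *, symmetric])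
  also have "\<dots> = inversion_sign n p"
    unfolding inversion_sign_def
  proof (rule prod.cong, goal_cases)
    case (2 x)
    then obtain j i where x: "x = (j, i)" "j < i" "i < n" by auto
    have "p i < p j \<or> p j < p i" using permutes_inj[OF p] x by (metis injD less_irrefl linorder_neqE_nat)
    then show ?case using x f v[of "p i" "p j"] v[of "p j" "p i"] pn by (auto simp: sgn_if)
  qed simp
  finally show ?thesis by simp
qed

lemma bij_betw_permutes_matchings:
  assumes u: "bij_betw u {..<n} R" and v: "bij_betw v {..<n} L"
  shows "bij_betw (\<lambda>p. restrict (\<lambda>r. v (p (the_inv_into {..<n} u r))) R)
      {p. p permutes {..<n} \<and> (\<forall>i<n. A (u i) (v (p i)))} (matchings R L A)"
proof -
  define ui where "ui = the_inv_into {..<n} u"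
  define vi where "vi = the_inv_into {..<n} v"
  have ui: "bij_betw ui R {..<n}" "\<And>i. i < n \<Longrightarrow> ui (u i) = i" "\<And>r. r \<in> R \<Longrightarrow> u (ui r) = r"
    using u bij_betw_the_inv_into[OF u] unfolding ui_def by (auto simp: bij_betw_def the_inv_into_f_f f_the_inv_into_f)
  have vi: "bij_betw vi L {..<n}" "\<And>i. i < n \<Longrightarrow> vi (v i) = i" "\<And>r. r \<in> L \<Longrightarrow> v (vi r) = r"
    using v bij_betw_the_inv_into[OF v] unfolding vi_def by (auto simp: bij_betw_def the_inv_into_f_f f_the_inv_into_f)
  have un: "i < n \<Longrightarrow> u i \<in> R" "r \<in> R \<Longrightarrow> ui r < n" for i r using u ui by (auto simp: bij_betw_def)
  show ?thesis unfolding ui_def[symmetric]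
  \<comment> \<open>\<open>permutes\<close> demands the identity outside \<open>{..<n}\<close>, just
    as \<open>extensional\<close> demands \<open>undefined\<close> outside R; hence the two default
    branches.\<close>
  proof (rule bij_betwI[where g = "\<lambda>f i. if i < n then vi (f (u i)) else i"], goal_cases)
    case 1
    show ?case
    proof
      fix p assume p: "p \<in> {p. p permutes {..<n} \<and> (\<forall>i<n. A (u i) (v (p i)))}"
      have "bij_betw (v \<circ> (p \<circ> ui)) R L"
        by (intro bij_betw_trans[OF bij_betw_trans[OF ui(1)] v] permutes_imp_bij) (use p in auto)
      then have "bij_betw (restrict (\<lambda>r. v (p (ui r))) R) R L"
        by (subst bij_betw_cong[where g = "v \<circ> (p \<circ> ui)"]) auto
      moreover have "A r (v (p (ui r)))" if "r \<in> R" for r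
        using p that ui(3) un(2) by force
      ultimately show "restrict (\<lambda>r. v (p (ui r))) R \<in> matchings R L A"
        unfolding matchings_def by auto
    qed
  next
    case 2
    show ?case
    proof
      fix f assume f: "f \<in> matchings R L A"
      have fR: "bij_betw f R L" "\<And>r. r \<in> R \<Longrightarrow> A r (f r)" "\<And>r. r \<in> R \<Longrightarrow> f r \<in> L"
        using f by (auto simp: matchings_def bij_betw_def)
      have "bij_betw (vi \<circ> (f \<circ> u)) {..<n} {..<n}"
        by (intro bij_betw_trans[OF bij_betw_trans[OF u fR(1)] vi(1)])
      then have "bij_betw (\<lambda>i. if i < n then vi (f (u i)) else i) {..<n} {..<n}"
        by (subst bij_betw_cong[where g = "vi \<circ> (f \<circ> u)"]) auto
      then have "(\<lambda>i. if i < n then vi (f (u i)) else i) permutes {..<n}"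
        by (rule bij_imp_permutes) auto
      then show "(\<lambda>i. if i < n then vi (f (u i)) else i) \<in> {p. p permutes {..<n} \<and> (\<forall>i<n. A (u i) (v (p i)))}"
        using fR un vi(3) by auto
    qed
  next
    case (3 p)
    then have "p permutes {..<n}" by simp
    then show ?case using ui vi un permutes_in_image[of p "{..<n}"] permutes_not_in[of p "{..<n}"] by (force simp: fun_eq_iff)
  next
    case (4 f)
    then have "f \<in> extensional R" "\<And>r. r \<in> R \<Longrightarrow> f r \<in> L" by (auto simp: matchings_def bij_betw_def)
    then show ?case using ui vi un by (auto simp: fun_eq_iff restrict_def extensional_def)
  qed
qed

text \<open>The Leibniz terms of a 0-1 matrix are the signs of its matchings. When these agree, no
  cancellation occurs and the determinant counts up to sign.\<close>

lemma abs_det_eq_card_matchings: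
  fixes A :: "'a \<Rightarrow> 'b \<Rightarrow> bool"
  assumes u: "bij_betw u {..<n} R" "\<And>i j. i < n \<Longrightarrow> j < n \<Longrightarrow> kr (u i) < kr (u j) \<longleftrightarrow> i < j"
    and v: "bij_betw v {..<n} L" "\<And>i j. i < n \<Longrightarrow> j < n \<Longrightarrow> kl (v i) < kl (v j) \<longleftrightarrow> i < j"
    and s: "\<bar>s\<bar> = 1" "\<And>f. f \<in> matchings R L A \<Longrightarrow> matching_sign kr kl R f = s"
  shows "\<bar>Determinant.det (Matrix.mat n n (\<lambda>(i, j). if A (u i) (v j) then 1 else 0 :: real))\<bar> = card (matchings R L A)"
proof -
  let ?K = "Matrix.mat n n (\<lambda>(i, j). if A (u i) (v j) then 1 else 0 :: real)"
  let ?P = "{p. p permutes {..<n} \<and> (\<forall>i<n. A (u i) (v (p i)))}"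
  let ?F = "\<lambda>p. restrict (\<lambda>r. v (p (the_inv_into {..<n} u r))) R"
  note bij = bij_betw_permutes_matchings[OF u(1) v(1), of A]
  have sg: "sign p = s" if "p \<in> ?P" for p
  proof -
    have p: "p permutes {..<n}" using that by simp
    have "?F p (u i) = v (p i)" if "i < n" for i
      using u(1) that by (auto simp: bij_betw_def the_inv_into_f_f)
    then have "inversion_sign n p = matching_sign kr kl R (?F p)"
      by (intro inversion_sign_eq_matching_sign[where u = u and v = v]) (use u v(2) p in auto)
    moreover have "?F p \<in> matchings R L A" using bij that by (auto simp: bij_betw_def)
    ultimately show ?thesis using s(2) sign_eq_inversion_sign[OF p] by simp
  qed
  have "Determinant.det ?K = (\<Sum>p | p permutes {..<n}. of_int (sign p) * (\<Prod>i<n. ?K $$ (i, p i)))"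
    by (subst det_def'[of _ n]) (auto simp: atLeast0LessThan)
  also have "\<dots> = (\<Sum>p | p permutes {..<n}. if \<forall>i<n. A (u i) (v (p i)) then of_int s else 0)"
  proof (rule sum.cong, goal_cases)
    case (2 p)
    have pn: "i < n \<Longrightarrow> p i < n" for i using permutes_in_image[of p "{..<n}"] 2 by simp
    have "(\<Prod>i<n. ?K $$ (i, p i)) = (\<Prod>i<n. if A (u i) (v (p i)) then 1 else 0)"
      by (rule prod.cong) (use pn in auto)
    also have "\<dots> = (if \<forall>i<n. A (u i) (v (p i)) then 1 else 0)" by (auto intro!: prod.neutral prod_zero)
    finally show ?case using sg[of p] 2 by auto
  qed simp
  also have "\<dots> = (\<Sum>p\<in>?P. of_int s)"
    by (subst sum.inter_filter[symmetric]) (auto simp: finite_permutations)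
  also have "\<dots> = real (card ?P) * of_int s" by simp
  finally show ?thesis using bij_betw_same_card[OF bij] s(1) by (auto simp: abs_mult)
qed

text \<open>Cramer's rule for two columns at once: the changed matrix is K times the identity matrix
  with columns c1, c2 replaced by g1, g2, and the determinant of the latter factor is a 2 by 2
  minor. Nothing is assumed about the invertibility of K.\<close>

lemma det_replace_two_columns:
  fixes K :: "real mat"
  assumes K: "K \<in> carrier_mat n n" and c: "c1 < n" "c2 < n" "c1 \<noteq> c2"
    and g1: "\<And>i. i < n \<Longrightarrow> (\<Sum>j<n. K $$ (i, j) * g1 j) = b1 i"
    and g2: "\<And>i. i < n \<Longrightarrow> (\<Sum>j<n. K $$ (i, j) * g2 j) = b2 i"
  shows "Determinant.det (Matrix.mat n n (\<lambda>(i, j). if j = c1 then b1 i else if j = c2 then b2 i else K $$ (i, j))) =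
    Determinant.det K * (g1 c1 * g2 c2 - g1 c2 * g2 c1)" (is "Determinant.det ?K' = _")
proof -
  define C where "C = Matrix.mat n n (\<lambda>(i, j). if j = c1 then g1 i else if j = c2 then g2 i else if i = j then 1 else 0)"
  have C: "C \<in> carrier_mat n n" by (simp add: C_def)
  have "?K' = K * C"
  proof (rule eq_matI, goal_cases)
    case (1 i j)
    then have ij: "i < n" "j < n" using K C by auto
    have "(K * C) $$ (i, j) = (\<Sum>l<n. K $$ (i, l) * C $$ (l, j))"
      using ij K C by (auto simp: scalar_prod_def atLeast0LessThan)
    also have "\<dots> = (if j = c1 then b1 i else if j = c2 then b2 i else K $$ (i, j))"
    proof (cases "j = c1 \<or> j = c2")
      case True
      then have "(\<Sum>l<n. K $$ (i, l) * C $$ (l, j)) = (\<Sum>l<n. K $$ (i, l) * (if j = c1 then g1 l else g2 l))"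
        using ij by (intro sum.cong) (auto simp: C_def)
      then show ?thesis using True g1[OF ij(1)] g2[OF ij(1)] by (cases "j = c1") auto
    next
      case False
      then have "(\<Sum>l<n. K $$ (i, l) * C $$ (l, j)) = (\<Sum>l<n. if l = j then K $$ (i, j) else 0)"
        using ij by (intro sum.cong) (auto simp: C_def)
      then show ?thesis using ij False by simp
    qed
    finally show ?case using ij by simp
  qed (use K C in auto)
  moreover have "Determinant.det C = g1 c1 * g2 c2 - g1 c2 * g2 c1"
  proof -
    let ?f = "\<lambda>p. of_int (sign p) * (\<Prod>j<n. C $$ (p j, j))"
    let ?t = "Transposition.transpose c1 c2"
    have t: "?t permutes {..<n}" by (rule permutes_swap_id) (use c in auto)
    have n: "{..<n} = insert c1 (insert c2 ({..<n} - {c1, c2}))" using c by auto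
    have pr: "(\<Prod>j<n. C $$ (p j, j)) = C $$ (p c1, c1) * C $$ (p c2, c2) * (\<Prod>j\<in>{..<n} - {c1, c2}. C $$ (p j, j))" for p
      using c by (subst n, subst prod.insert) (auto simp: mult.assoc)
    have "Determinant.det C = (\<Sum>p | p permutes {..<n}. ?f p)"
      using det_col[OF C] by (simp add: atLeast0LessThan)
    \<comment> \<open>In a column of C other than c1 and c2 only the diagonal entry is nonzero, so a
      permutation with nonzero product fixes all other indices.\<close>
    also have "\<dots> = (\<Sum>p \<in> {id, ?t}. ?f p)"
    proof (rule sum.mono_neutral_right)
      show "\<forall>p\<in>{p. p permutes {..<n}} - {id, ?t}. ?f p = 0"
      proof
        fix p assume p: "p \<in> {p. p permutes {..<n}} - {id, ?t}"
        show "?f p = 0"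
        proof (rule ccontr)
          assume nz: "?f p \<noteq> 0"
          have pn: "j < n \<Longrightarrow> p j < n" for j using p permutes_in_image[of p "{..<n}"] by simp
          have fx: "p j = j" if "j \<noteq> c1" "j \<noteq> c2" for j
          proof (cases "j < n")
            case True
            then have "C $$ (p j, j) \<noteq> 0" using nz by auto
            then show ?thesis using that pn True by (auto simp: C_def split: if_splits)
          next
            case False
            then show ?thesis using p permutes_not_in[of p "{..<n}" j] by auto
          qed
          have inj: "inj p" using p permutes_inj by auto
          have *: "p c1 \<in> {c1, c2}" "p c2 \<in> {c1, c2}" "p c1 \<noteq> p c2"
            using fx injD[OF inj] c by (metis insertCI)+
          then have "p x = id x" if "p c1 = c1" for x using fx[of x] that by (cases "x = c1"; cases "x = c2") auto
          moreover from * have "p x = ?t x" if "p c1 \<noteq> c1" for x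
            using fx[of x] that by (cases "x = c1"; cases "x = c2") (auto simp: Transposition.transpose_def)
          ultimately have "p = id \<or> p = ?t" by blast
          then show False using p by auto
        qed
      qed
    qed (use t in \<open>auto simp: finite_permutations permutes_id\<close>)
    also have "\<dots> = ?f id + ?f ?t"
      using c by (subst sum.insert) (auto simp: fun_eq_iff Transposition.transpose_def)
    also have "?f id = g1 c1 * g2 c2" unfolding pr using c by (auto simp: C_def)
    also have "(\<Prod>j\<in>{..<n} - {c1, c2}. C $$ (?t j, j)) = 1"
      by (rule prod.neutral) (auto simp: C_def)
    then have "?f ?t = - (g1 c2 * g2 c1)" unfolding pr using c by (auto simp: C_def sign_swap_id)
    finally show ?thesis by simp
  qed
  ultimately show ?thesis using det_mult[OF K C] by simp
qed

section \<open>Tilings as matchings\<close>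

text \<open>Triangles of both orientations are indexed by the midpoint of their vertical edge. Equal
  indices thus mean a shared vertical edge, and the two other cases are the shared slanted
  edges.\<close>

definition rhombic :: "point \<Rightarrow> point \<Rightarrow> bool" where
  "rhombic r l \<longleftrightarrow> l = r \<or> l = (fst r + 1, snd r + 1) \<or> l = (fst r + 1, snd r - 1)"

definition cells :: "point set \<Rightarrow> point set \<Rightarrow> region" where
  "cells R L = case_prod right_triangle ` R \<union> case_prod left_triangle ` L"

lemma card_Int_triple:
  assumes "p \<noteq> q" "q \<noteq> r" "p \<noteq> r"
  shows "card ({p, q, r} \<inter> B) = of_bool (p \<in> B) + of_bool (q \<in> B) + of_bool (r \<in> B)"
  using assms by (cases "p \<in> B"; cases "q \<in> B"; cases "r \<in> B") (auto simp: Int_insert_left)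

lemma card_right_Int_left: "card (right_triangle x y \<inter> left_triangle x' y') = 2 \<longleftrightarrow> rhombic (x, y) (x', y')"
  unfolding right_triangle_def by (subst card_Int_triple) (auto simp: left_triangle_def rhombic_def)

lemma card_right_Int_right: "card (right_triangle x y \<inter> right_triangle x' y') \<noteq> 2"
  by (subst (1) right_triangle_def, subst card_Int_triple) (auto simp: right_triangle_def)

lemma card_left_Int_left: "card (left_triangle x y \<inter> left_triangle x' y') \<noteq> 2"
  by (subst (1) left_triangle_def, subst card_Int_triple) (auto simp: left_triangle_def)

lemma right_neq_left: "right_triangle x y \<noteq> left_triangle x' y'"
proof
  assume *: "right_triangle x y = left_triangle x' y'"
  have "(x, y - 1) \<in> left_triangle x' y'" "(x, y + 1) \<in> left_triangle x' y'" "(x + 1, y) \<in> left_triangle x' y'"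
    unfolding *[symmetric] by (auto simp: right_triangle_def)
  then show False by (auto simp: left_triangle_def)
qed

lemma right_triangle_inject: "right_triangle x y = right_triangle x' y' \<longleftrightarrow> x = x' \<and> y = y'"
proof
  assume *: "right_triangle x y = right_triangle x' y'"
  have "(x, y - 1) \<in> right_triangle x' y'" "(x, y + 1) \<in> right_triangle x' y'" "(x + 1, y) \<in> right_triangle x' y'"
    unfolding *[symmetric] by (auto simp: right_triangle_def)
  then show "x = x' \<and> y = y'" by (auto simp: right_triangle_def)
qed auto

lemma left_triangle_inject: "left_triangle x y = left_triangle x' y' \<longleftrightarrow> x = x' \<and> y = y'"
proof
  assume *: "left_triangle x y = left_triangle x' y'"
  have "(x, y - 1) \<in> left_triangle x' y'" "(x, y + 1) \<in> left_triangle x' y'" "(x - 1, y) \<in> left_triangle x' y'"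
    unfolding *[symmetric] by (auto simp: left_triangle_def)
  then show "x = x' \<and> y = y'" by (auto simp: left_triangle_def)
qed auto

definition rhombus :: "point \<Rightarrow> point \<Rightarrow> region" where
  "rhombus r l = {case_prod right_triangle r, case_prod left_triangle l}"

lemma rhombus_inject: "rhombus r l = rhombus r' l' \<longleftrightarrow> r = r' \<and> l = l'"
  by (cases r; cases l; cases r'; cases l')
     (auto simp: rhombus_def doubleton_eq_iff right_neq_left right_neq_left[symmetric] right_triangle_inject left_triangle_inject)

lemma right_mem_rhombus: "case_prod right_triangle r \<in> rhombus r' l' \<longleftrightarrow> r = r'"
  by (cases r; cases r'; cases l') (auto simp: rhombus_def right_neq_left right_triangle_inject)

lemma left_mem_rhombus: "case_prod left_triangle l \<in> rhombus r' l' \<longleftrightarrow> l = l'"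
  by (cases l; cases r'; cases l') (auto simp: rhombus_def right_neq_left[symmetric] left_triangle_inject)

lemma right_triangle_mem_unit: "right_triangle x y \<in> unit_triangles a b \<longleftrightarrow> odd (x + y + int a + int b)"
proof -
  have "right_triangle x y \<subseteq> lattice_points a b \<longleftrightarrow> odd (x + y + int a + int b)"
    unfolding right_triangle_def lattice_points_def by auto
  then show ?thesis unfolding unit_triangles_def by blast
qed

lemma left_triangle_mem_unit: "left_triangle x y \<in> unit_triangles a b \<longleftrightarrow> odd (x + y + int a + int b)"
proof -
  have "left_triangle x y \<subseteq> lattice_points a b \<longleftrightarrow> odd (x + y + int a + int b)"
    unfolding left_triangle_def lattice_points_def by auto
  then show ?thesis unfolding unit_triangles_def by blast
qed

lemma is_rhombus_iff: "is_rhombus t \<longleftrightarrow> (\<exists>r l. rhombic r l \<and> t = rhombus r l)"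
proof
  assume "is_rhombus t"
  then obtain a b s s' where *: "s \<in> unit_triangles a b" "s' \<in> unit_triangles a b" "card (s \<inter> s') = 2" "t = {s, s'}"
    unfolding is_rhombus_def by blast
  then consider x y x' y' where "s = right_triangle x y" "s' = left_triangle x' y'"
    | x y x' y' where "s' = right_triangle x y" "s = left_triangle x' y'"
    unfolding unit_triangles_def using card_right_Int_right card_left_Int_left by auto
  then show "\<exists>r l. rhombic r l \<and> t = rhombus r l"
  proof cases
    case 1
    then show ?thesis using * card_right_Int_left[of x y x' y']
      by (intro exI[of _ "(x, y)"] exI[of _ "(x', y')"]) (auto simp: rhombus_def)
  next
    case 2
    then show ?thesis using * card_right_Int_left[of x y x' y']
      by (intro exI[of _ "(x, y)"] exI[of _ "(x', y')"]) (auto simp: rhombus_def Int_commute)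
  qed
next
  assume "\<exists>r l. rhombic r l \<and> t = rhombus r l"
  then obtain x y x' y' where *: "rhombic (x, y) (x', y')" "t = rhombus (x, y) (x', y')" by auto
  \<comment> \<open>Any lattice of the right parity contains the two triangles; this a, together
    with b = 0, provides one.\<close>
  define a :: nat where "a = (if even (x + y) then 1 else (0 :: nat))"
  have "odd (x + y + int a)" by (simp add: a_def)
  moreover from this have "odd (x' + y' + int a)" using *(1) by (auto simp: rhombic_def)
  ultimately have "right_triangle x y \<in> unit_triangles a 0" "left_triangle x' y' \<in> unit_triangles a 0"
    by (simp_all add: right_triangle_mem_unit left_triangle_mem_unit)
  then show "is_rhombus t" unfolding is_rhombus_def
    using * card_right_Int_left[of x y x' y'] by (auto simp: rhombus_def)
qed

lemma cells_mem: "case_prod right_triangle r \<in> cells R L \<longleftrightarrow> r \<in> R" "case_prod left_triangle l \<in> cells R L \<longleftrightarrow> l \<in> L"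
  by (cases r; cases l; auto simp: cells_def right_neq_left right_neq_left[symmetric] right_triangle_inject left_triangle_inject image_iff)+

lemma mem_cells_iff:
  "t \<in> cells R L \<longleftrightarrow> (\<exists>x y. (x, y) \<in> R \<and> t = right_triangle x y) \<or> (\<exists>x y. (x, y) \<in> L \<and> t = left_triangle x y)"
  unfolding cells_def by (auto simp: image_iff)

lemma rhombus_subset_cells: "rhombus r l \<subseteq> cells R L \<longleftrightarrow> r \<in> R \<and> l \<in> L"
  unfolding rhombus_def using cells_mem by auto

text \<open>Every rhombus joins one right to one left cell, so a tiling is the graph of a function
  that sends each right cell to its partner; the partition property makes this function well
  defined, injective and onto.\<close>

lemma M_cells: "M (cells R L) = card (matchings R L rhombic)"
proof -
  let ?F = "\<lambda>f. (\<lambda>r. rhombus r (f r)) ` R"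
  have "bij_betw ?F (matchings R L rhombic) (tilings (cells R L))"
    unfolding bij_betw_def
  proof
    show "inj_on ?F (matchings R L rhombic)"
    proof
      fix f g assume fg: "f \<in> matchings R L rhombic" "g \<in> matchings R L rhombic" "?F f = ?F g"
      have "f r = g r" if "r \<in> R" for r
      proof -
        have "rhombus r (f r) \<in> ?F g" using fg(3) that by blast
        then show ?thesis by (auto simp: rhombus_inject)
      qed
      then show "f = g" using fg by (auto simp: matchings_def intro: extensionalityI)
    qed
    show "?F ` matchings R L rhombic = tilings (cells R L)"
    proof (intro equalityI subsetI)
      fix T assume "T \<in> ?F ` matchings R L rhombic"
      then obtain f where f: "f \<in> matchings R L rhombic" "T = ?F f" by auto
      have b: "bij_betw f R L" and rh: "\<And>r. r \<in> R \<Longrightarrow> rhombic r (f r)" using f(1) by (auto simp: matchings_def)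
      have "\<Union>T = cells R L"
        using b unfolding f(2) cells_def rhombus_def bij_betw_def by auto
      moreover have "disjoint T"
      proof (rule disjointI)
        fix s t assume st: "s \<in> T" "t \<in> T" "s \<noteq> t"
        then obtain r r' where r: "r \<in> R" "r' \<in> R" "s = rhombus r (f r)" "t = rhombus r' (f r')" using f(2) by auto
        then have "r \<noteq> r'" using st(3) by metis
        then have "f r \<noteq> f r'" using inj_on_eq_iff[OF bij_betw_imp_inj_on[OF b] r(1,2)] by blast
        show "s \<inter> t = {}" 
        proof (rule ccontr)
          assume "s \<inter> t \<noteq> {}"
          then have "case_prod right_triangle r \<in> t \<or> case_prod left_triangle (f r) \<in> t"
            using r(3) unfolding rhombus_def by blast
          then show False unfolding r(4) right_mem_rhombus left_mem_rhombus
            using \<open>r \<noteq> r'\<close> \<open>f r \<noteq> f r'\<close> by blast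
        qed
      qed
      moreover have "{} \<notin> T" unfolding f(2) rhombus_def by auto
      ultimately have "partition_on (cells R L) T" unfolding partition_on_def by auto
      then show "T \<in> tilings (cells R L)" unfolding tilings_def is_rhombus_iff using f(2) rh by blast
    next
      fix T assume T: "T \<in> tilings (cells R L)"
      have part: "\<Union>T = cells R L" and disj: "disjoint T" and rh: "\<And>t. t \<in> T \<Longrightarrow> is_rhombus t"
        using T by (auto simp: tilings_def partition_on_def)
      have block: "\<exists>r l. rhombic r l \<and> t = rhombus r l \<and> r \<in> R \<and> l \<in> L" if t: "t \<in> T" for t
      proof -
        obtain r l where rl: "rhombic r l" "t = rhombus r l" using rh[OF t] unfolding is_rhombus_iff by blast
        have "t \<subseteq> cells R L" using part t by blast
        then show ?thesis using rl rhombus_subset_cells by blast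
      qed
      have uniq: "s = t" if "s \<in> T" "t \<in> T" "c \<in> s" "c \<in> t" for s t c
        using disjointD[OF disj] that by blast
      have "\<exists>l. rhombic r l \<and> rhombus r l \<in> T \<and> l \<in> L" if "r \<in> R" for r
      proof -
        have "case_prod right_triangle r \<in> \<Union>T" unfolding part cells_mem by (rule that)
        then obtain t where t: "t \<in> T" "case_prod right_triangle r \<in> t" by auto
        obtain r' l where "rhombic r' l" "t = rhombus r' l" "l \<in> L" using block[OF t(1)] by auto
        then show ?thesis using t right_mem_rhombus by metis
      qed
      then obtain f where f: "\<And>r. r \<in> R \<Longrightarrow> rhombic r (f r) \<and> rhombus r (f r) \<in> T \<and> f r \<in> L" by metis
      define g where "g = restrict f R"
      have g: "rhombic r (g r)" "rhombus r (g r) \<in> T" "g r \<in> L" if "r \<in> R" for r using f[OF that] that by (auto simp: g_def)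
      have "inj_on g R"
      proof
        fix r r' assume r: "r \<in> R" "r' \<in> R" "g r = g r'"
        have "rhombus r (g r) = rhombus r' (g r')"
          by (rule uniq[OF g(2) g(2), of _ _ "case_prod left_triangle (g r)"]) (simp_all add: r left_mem_rhombus)
        then show "r = r'" by (simp add: rhombus_inject)
      qed
      moreover have "g ` R = L"
      proof (intro equalityI subsetI)
        fix l assume "l \<in> L"
        then have "case_prod left_triangle l \<in> \<Union>T" unfolding part cells_mem .
        then obtain t where t: "t \<in> T" "case_prod left_triangle l \<in> t" by auto
        obtain r where "t = rhombus r l" "r \<in> R" using block[OF t(1)] t left_mem_rhombus by metis
        moreover have "rhombus r (g r) = t"
          by (rule uniq[OF g(2) t(1), of _ "case_prod right_triangle r"]) (simp_all add: calculation right_mem_rhombus)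
        ultimately show "l \<in> g ` R" by (auto simp: rhombus_inject)
      qed (use g in auto)
      ultimately have gm: "g \<in> matchings R L rhombic" using g by (auto simp: matchings_def bij_betw_def g_def)
      have "T = ?F g"
      proof (intro equalityI subsetI)
        fix t assume t: "t \<in> T"
        then obtain r l where rl: "t = rhombus r l" "r \<in> R" using block by metis
        have "rhombus r (g r) = t"
          by (rule uniq[OF g(2) t, of _ "case_prod right_triangle r"]) (simp_all add: rl right_mem_rhombus)
        then show "t \<in> ?F g" using rl by auto
      qed (use g in auto)
      then show "T \<in> ?F ` matchings R L rhombic" using gm by auto
    qed
  qed
  then show ?thesis unfolding M_def using bij_betw_same_card by metis
qed

section \<open>The hexagon and the holes as sets of cells\<close>

definition right_cells :: "nat \<Rightarrow> nat \<Rightarrow> point set" where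
  "right_cells a b = {(x, y). - int a \<le> x \<and> x < int a \<and> \<bar>x\<bar> + \<bar>y\<bar> < int a + int b \<and> odd (x + y + int a + int b)}"

definition left_cells :: "nat \<Rightarrow> nat \<Rightarrow> point set" where
  "left_cells a b = {(x, y). - int a < x \<and> x \<le> int a \<and> \<bar>x\<bar> + \<bar>y\<bar> < int a + int b \<and> odd (x + y + int a + int b)}"

lemma finite_right_cells: "finite (right_cells a b)"
  by (rule finite_subset[of _ "{- int a..int a} \<times> {- int a - int b..int a + int b}"]) (auto simp: right_cells_def)

lemma finite_left_cells: "finite (left_cells a b)"
  by (rule finite_subset[of _ "{- int a..int a} \<times> {- int a - int b..int a + int b}"]) (auto simp: left_cells_def)

lemma cells_in_eq_cells:
  "cells_in a b P = cells {(x, y). right_triangle x y \<subseteq> P \<and> odd (x + y + int a + int b)}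
     {(x, y). left_triangle x y \<subseteq> P \<and> odd (x + y + int a + int b)}"
proof -
  have *: "t \<in> cells_in a b P \<longleftrightarrow> (\<exists>x y. t = right_triangle x y \<and> t \<subseteq> P \<and> odd (x + y + int a + int b)) \<or>
     (\<exists>x y. t = left_triangle x y \<and> t \<subseteq> P \<and> odd (x + y + int a + int b))" for t
    unfolding cells_in_def using right_triangle_mem_unit left_triangle_mem_unit unfolding unit_triangles_def by blast
  show ?thesis
  proof (rule Set.set_eqI)
    fix t
    show "t \<in> cells_in a b P \<longleftrightarrow> t \<in> cells {(x, y). right_triangle x y \<subseteq> P \<and> odd (x + y + int a + int b)}
       {(x, y). left_triangle x y \<subseteq> P \<and> odd (x + y + int a + int b)}"
      unfolding * mem_cells_iff mem_Collect_eq prod.case by blast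
  qed
qed

lemma abs_shift_le_iff:
  fixes u y C :: int
  shows "u + \<bar>y - 1\<bar> \<le> C \<and> u + \<bar>y + 1\<bar> \<le> C \<longleftrightarrow> u + \<bar>y\<bar> < C"
  by (cases "0 \<le> y") auto

lemma right_triangle_subset_hexagon:
  "right_triangle x y \<subseteq> {(x, y). \<bar>x\<bar> \<le> A \<and> \<bar>x\<bar> + \<bar>y\<bar> \<le> A + B} \<longleftrightarrow> - A \<le> x \<and> x < A \<and> \<bar>x\<bar> + \<bar>y\<bar> < A + B"
proof -
  have *: "u \<le> v + 1 \<Longrightarrow> v + w < C \<Longrightarrow> u + w \<le> C" for u v w C :: int by simp
  have "- A \<le> x \<and> x < A \<longleftrightarrow> \<bar>x\<bar> \<le> A \<and> \<bar>x + 1\<bar> \<le> A" unfolding abs_le_iff by auto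
  moreover have "\<bar>x + 1\<bar> \<le> \<bar>x\<bar> + 1" using abs_triangle_ineq[of x 1] by simp
  then have "\<bar>x\<bar> + \<bar>y\<bar> < A + B \<Longrightarrow> \<bar>x + 1\<bar> + \<bar>y\<bar> \<le> A + B" by (rule *)
  ultimately show ?thesis
    using abs_shift_le_iff[of "\<bar>x\<bar>" y "A + B"] unfolding right_triangle_def insert_subset mem_Collect_eq prod.case by blast
qed

lemma left_triangle_subset_hexagon:
  "left_triangle x y \<subseteq> {(x, y). \<bar>x\<bar> \<le> A \<and> \<bar>x\<bar> + \<bar>y\<bar> \<le> A + B} \<longleftrightarrow> - A < x \<and> x \<le> A \<and> \<bar>x\<bar> + \<bar>y\<bar> < A + B"
proof -
  have *: "u \<le> v + 1 \<Longrightarrow> v + w < C \<Longrightarrow> u + w \<le> C" for u v w C :: int by simp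
  have "- A < x \<and> x \<le> A \<longleftrightarrow> \<bar>x\<bar> \<le> A \<and> \<bar>x - 1\<bar> \<le> A" unfolding abs_le_iff by auto
  moreover have "\<bar>x - 1\<bar> \<le> \<bar>x\<bar> + 1" using abs_triangle_ineq4[of x 1] by simp
  then have "\<bar>x\<bar> + \<bar>y\<bar> < A + B \<Longrightarrow> \<bar>x - 1\<bar> + \<bar>y\<bar> \<le> A + B" by (rule *)
  ultimately show ?thesis
    using abs_shift_le_iff[of "\<bar>x\<bar>" y "A + B"] unfolding left_triangle_def insert_subset mem_Collect_eq prod.case by blast
qed

lemma hexagon_eq_cells: "hexagon a b = cells (right_cells a b) (left_cells a b)"
  unfolding hexagon_def cells_in_eq_cells right_triangle_subset_hexagon left_triangle_subset_hexagon
    right_cells_def left_cells_def by (simp only: conj_assoc)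

lemma right_triangle_subset_hole:
  "right_triangle x y \<subseteq> {(x, y). - K \<le> x \<and> (x + K) + \<bar>y\<bar> \<le> 2} \<longleftrightarrow> - K \<le> x \<and> x + K + \<bar>y\<bar> \<le> 1"
  using abs_shift_le_iff[of "x + K" y 2] unfolding right_triangle_def insert_subset mem_Collect_eq prod.case by auto

lemma left_triangle_subset_hole:
  "left_triangle x y \<subseteq> {(x, y). - K \<le> x \<and> (x + K) + \<bar>y\<bar> \<le> 2} \<longleftrightarrow> 1 - K \<le> x \<and> x + K + \<bar>y\<bar> \<le> 1"
  using abs_shift_le_iff[of "x + K" y 2] unfolding left_triangle_def insert_subset mem_Collect_eq prod.case by auto

lemma cells_Un: "cells R L \<union> cells R' L' = cells (R \<union> R') (L \<union> L')"
  unfolding cells_def by blast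

lemma cells_Diff: "cells R L - cells R' L' = cells (R - R') (L - L')"
proof (rule Set.set_eqI)
  fix t
  show "t \<in> cells R L - cells R' L' \<longleftrightarrow> t \<in> cells (R - R') (L - L')"
    unfolding Diff_iff mem_cells_iff
    using right_neq_left right_triangle_inject left_triangle_inject by (metis Diff_iff)
qed

text \<open>A triangle of side two consists of four unit triangles. Parity excludes the point in the
  middle of its vertical side, which the inequalities alone would admit.\<close>

lemma right_hole_eq_cells:
  assumes "even (a + b + k)"
  shows "right_hole a b k = cells {(- int k, 1), (- int k, -1), (1 - int k, 0)} {(1 - int k, 0)}"
proof -
  have p: "even (int a + int b + int k)" using assms by (metis even_of_nat of_nat_add)
  have "right_hole a b k = cells {(x, y). - int k \<le> x \<and> x + int k + \<bar>y\<bar> \<le> 1 \<and> odd (x + y + int a + int b)}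
     {(x, y). 1 - int k \<le> x \<and> x + int k + \<bar>y\<bar> \<le> 1 \<and> odd (x + y + int a + int b)}"
    unfolding right_hole_def cells_in_eq_cells right_triangle_subset_hole left_triangle_subset_hole
    by (simp only: conj_assoc)
  also have "{(x, y). - int k \<le> x \<and> x + int k + \<bar>y\<bar> \<le> 1 \<and> odd (x + y + int a + int b)} =
      {(- int k, 1), (- int k, -1), (1 - int k, 0)}"
  proof (rule Set.set_eqI, unfold split_paired_all)
    fix x y :: int
    show "(x, y) \<in> {(x, y). - int k \<le> x \<and> x + int k + \<bar>y\<bar> \<le> 1 \<and> odd (x + y + int a + int b)} \<longleftrightarrow>
      (x, y) \<in> {(- int k, 1), (- int k, -1), (1 - int k, 0)}" (is "?l \<longleftrightarrow> ?r")
    proof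
      assume l: ?l
      then have "x = - int k \<and> (y = 1 \<or> y = -1 \<or> y = 0) \<or> x = 1 - int k \<and> y = 0" by auto
      moreover have "\<not> (x = - int k \<and> y = 0)" using l p by auto
      ultimately show ?r by auto
    qed (use p in auto)
  qed
  also have "{(x, y). 1 - int k \<le> x \<and> x + int k + \<bar>y\<bar> \<le> 1 \<and> odd (x + y + int a + int b)} = {(1 - int k, 0)}"
    using p by auto
  finally show ?thesis .
qed

lemma mirror_right_triangle: "mirror ` right_triangle x y = left_triangle (- x) y"
  and mirror_left_triangle: "mirror ` left_triangle x y = right_triangle (- x) y"
  by (auto simp: mirror_def right_triangle_def left_triangle_def)

lemma left_hole_eq_cells:
  assumes "even (a + b + k)"
  shows "left_hole a b k = cells {(int k - 1, 0)} {(int k, 1), (int k, -1), (int k - 1, 0)}"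
  unfolding left_hole_def right_hole_eq_cells[OF assms]
  by (auto simp: cells_def mirror_right_triangle mirror_left_triangle)

text \<open>For k = 1 the two holes overlap in the rhombus at the centre; then
  \<open>(1 - int k, 0)\<close> and \<open>(int k - 1, 0)\<close> are the same point, and the set
  notation covers this case as well.\<close>

lemma holey_hexagon_eq_cells:
  assumes "even (a + b + k)"
  shows "holey_hexagon a b k = cells
     (right_cells a b - {(- int k, 1), (- int k, -1), (1 - int k, 0), (int k - 1, 0)})
     (left_cells a b - {(int k, 1), (int k, -1), (1 - int k, 0), (int k - 1, 0)})"
  unfolding holey_hexagon_def right_hole_eq_cells[OF assms] left_hole_eq_cells[OF assms] hexagon_eq_cells
    cells_Un cells_Diff
  by (rule arg_cong2[where f = cells]) auto

section \<open>Signs of the matchings\<close>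

text \<open>Lexicographic order by column and height, packed into one integer because
  \<open>matching_sign\<close> compares integer keys; B has to exceed all heights.\<close>

definition cell_key :: "int \<Rightarrow> point \<Rightarrow> int" where
  "cell_key B = (\<lambda>(x, y). x * (2 * B) + y)"

lemma cell_key_less:
  assumes "\<bar>y\<bar> < B" "\<bar>y'\<bar> < B"
  shows "cell_key B (x, y) < cell_key B (x', y') \<longleftrightarrow> x < x' \<or> x = x' \<and> y < y'"
proof -
  have *: "u * (2 * B) + v < u' * (2 * B) + v'" if "u < u'" "\<bar>v\<bar> < B" "\<bar>v'\<bar> < B" for u u' v v'
  proof -
    have "(u + 1) * (2 * B) \<le> u' * (2 * B)" using that by (intro mult_right_mono) auto
    then have "u * (2 * B) + 2 * B \<le> u' * (2 * B)" by (simp only: distrib_right mult_1)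
    then show ?thesis using that(2,3) by linarith
  qed
  show ?thesis
    using *[of x x' y y'] *[of x' x y' y] assms unfolding cell_key_def prod.case
    by (cases x x' rule: linorder_cases) auto
qed

lemma cell_bounds:
  "r \<in> right_cells a b \<Longrightarrow> \<bar>snd r\<bar> < int (a + b)" "l \<in> left_cells a b \<Longrightarrow> \<bar>snd l\<bar> < int (a + b)"
  by (auto simp: right_cells_def left_cells_def)

abbreviation lex_less :: "point \<Rightarrow> point \<Rightarrow> bool" where
  "lex_less r r' \<equiv> fst r < fst r' \<or> fst r = fst r' \<and> snd r < snd r'"

lemma cell_key_less_cells:
  assumes "r \<in> right_cells a b \<union> left_cells a b" "r' \<in> right_cells a b \<union> left_cells a b"
  shows "cell_key (int (a + b)) r < cell_key (int (a + b)) r' \<longleftrightarrow> lex_less r r'"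
  using cell_key_less[of "snd r" "int (a + b)" "snd r'" "fst r" "fst r'"] cell_bounds assms by (metis UnE prod.collapse)

text \<open>A matching that follows the edges outside a set \<open>S\<close>, where \<open>S\<close> is either empty or consists of
  the two right-pointing cells of the left hole whose partners are their mirror images in the right hole.\<close>

definition matching_off :: "nat \<Rightarrow> nat \<Rightarrow> point set \<Rightarrow> (point \<Rightarrow> point) \<Rightarrow> bool" where
  "matching_off a b S f \<longleftrightarrow> bij_betw f (right_cells a b) (left_cells a b) \<and>
     (\<forall>r \<in> right_cells a b - S. rhombic r (f r)) \<and> (\<forall>r \<in> S. f r = mirror r)"

text \<open>A fixed point of f is a rhombus glued along a vertical edge, symmetric about a
  horizontal line. All other rhombi lead from column x to column x + 1 and are counted by
  \<open>steps\<close>.\<close>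

definition horizontals :: "nat \<Rightarrow> nat \<Rightarrow> point set \<Rightarrow> (point \<Rightarrow> point) \<Rightarrow> int \<Rightarrow> point set" where
  "horizontals a b S f x = {r \<in> right_cells a b - S. fst r = x \<and> f r = r}"

definition steps :: "nat \<Rightarrow> nat \<Rightarrow> point set \<Rightarrow> (point \<Rightarrow> point) \<Rightarrow> int \<Rightarrow> point set" where
  "steps a b S f x = {r \<in> right_cells a b - S. fst r = x \<and> f r \<noteq> r}"

lemma finite_horizontals: "finite (horizontals a b S f x)" and finite_steps: "finite (steps a b S f x)"
  unfolding horizontals_def steps_def by (auto intro: finite_subset[OF _ finite_right_cells])

text \<open>A left cell of column x is reached by a horizontal rhombus of this column, by a step
  from the column before, or as the mirror image of a cell of S. Together with the decomposition of
  the right cells this yields the two balance equations for the column.\<close>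

lemma steps_image:
  assumes f: "matching_off a b S f" and S: "S \<subseteq> right_cells a b"
  shows "f ` steps a b S f (x - 1) = {l \<in> left_cells a b. fst l = x} - mirror ` S - horizontals a b S f x"
proof (rule Set.set_eqI)
  fix l
  have b: "bij_betw f (right_cells a b) (left_cells a b)" and rh: "\<And>r. r \<in> right_cells a b \<Longrightarrow> r \<notin> S \<Longrightarrow> rhombic r (f r)"
    and fS: "\<And>r. r \<in> S \<Longrightarrow> f r = mirror r" using f by (auto simp: matching_off_def)
  note inj = inj_on_eq_iff[OF bij_betw_imp_inj_on[OF b]]
  have im: "f ` right_cells a b = left_cells a b" using b by (rule bij_betw_imp_surj_on)
  show "l \<in> f ` steps a b S f (x - 1) \<longleftrightarrow> l \<in> {l \<in> left_cells a b. fst l = x} - mirror ` S - horizontals a b S f x"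
  proof
    assume "l \<in> f ` steps a b S f (x - 1)"
    then obtain r where r: "r \<in> right_cells a b" "r \<notin> S" "fst r = x - 1" "f r \<noteq> r" "l = f r" unfolding steps_def by blast
    have "fst l = x" using rh[OF r(1,2)] r unfolding rhombic_def by auto
    moreover have "l \<in> left_cells a b" using im r by blast
    moreover have "l \<notin> mirror ` S" 
    proof
      assume "l \<in> mirror ` S"
      then obtain s where "s \<in> S" "f s = l" using fS by force
      then show False using inj[of s r] r S by blast
    qed
    moreover have "l \<notin> horizontals a b S f x"
    proof
      assume "l \<in> horizontals a b S f x"
      then have "l \<in> right_cells a b" "f l = l" unfolding horizontals_def by auto
      then show False using inj[of l r] r by metis
    qed
    ultimately show "l \<in> {l \<in> left_cells a b. fst l = x} - mirror ` S - horizontals a b S f x" by blast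
  next
    assume l: "l \<in> {l \<in> left_cells a b. fst l = x} - mirror ` S - horizontals a b S f x"
    then have "l \<in> f ` right_cells a b" unfolding im by simp
    then obtain r where r: "r \<in> right_cells a b" "f r = l" by blast
    have "r \<notin> S"
    proof
      assume "r \<in> S"
      then have "l = mirror r" using fS r by simp
      then show False using l \<open>r \<in> S\<close> by blast
    qed
    moreover from this have "f r \<noteq> r" using l r unfolding horizontals_def by auto
    moreover from calculation have "fst r = x - 1" using rh[OF r(1)] r(2) l unfolding rhombic_def by auto
    ultimately show "l \<in> f ` steps a b S f (x - 1)" unfolding steps_def using r by blast
  qed
qed

lemma card_steps_image:
  assumes "matching_off a b S f"
  shows "card (f ` steps a b S f x) = card (steps a b S f x)"
proof (rule card_image)
  have "inj_on f (right_cells a b)" using assms unfolding matching_off_def by (auto dest: bij_betw_imp_inj_on)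
  then show "inj_on f (steps a b S f x)" by (rule inj_on_subset) (auto simp: steps_def)
qed

lemma card_horizontals_steps:
  assumes f: "matching_off a b S f" and S: "S \<subseteq> right_cells a b" "mirror ` S \<subseteq> left_cells a b" "finite S" and m: "- int a < x" "x < int a"
  shows "card (horizontals a b S f x) + card (steps a b S f x) = card {r \<in> right_cells a b - S. fst r = x}"
    and "card (horizontals a b S f x) + card (steps a b S f (x - 1)) = card ({l \<in> left_cells a b. fst l = x} - mirror ` S)"
proof -
  have "horizontals a b S f x \<union> steps a b S f x = {r \<in> right_cells a b - S. fst r = x}"
    "horizontals a b S f x \<inter> steps a b S f x = {}"
    unfolding horizontals_def steps_def by auto
  then show "card (horizontals a b S f x) + card (steps a b S f x) = card {r \<in> right_cells a b - S. fst r = x}"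
    using card_Un_disjoint[OF finite_horizontals finite_steps] by metis
  have sub: "horizontals a b S f x \<subseteq> {l \<in> left_cells a b. fst l = x} - mirror ` S"
  proof
    fix h assume h: "h \<in> horizontals a b S f x"
    then have "h \<in> left_cells a b" "fst h = x" using m unfolding horizontals_def right_cells_def left_cells_def by auto
    moreover have "h \<notin> mirror ` S"
    proof
      assume "h \<in> mirror ` S"
      then obtain s where s: "s \<in> S" "f s = h" using f unfolding matching_off_def by force
      moreover have "inj_on f (right_cells a b)" "f h = h" "h \<in> right_cells a b"
        using f h unfolding matching_off_def horizontals_def by (auto dest: bij_betw_imp_inj_on)
      ultimately have "s = h" using S by (metis inj_onD subsetD)
      then show False using s h unfolding horizontals_def by auto
    qed
    ultimately show "h \<in> {l \<in> left_cells a b. fst l = x} - mirror ` S" by simp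
  qed
  have "finite ({l \<in> left_cells a b. fst l = x} - mirror ` S)" using finite_left_cells by simp
  then have "card (f ` steps a b S f (x - 1)) = card ({l \<in> left_cells a b. fst l = x} - mirror ` S) - card (horizontals a b S f x)"
    unfolding steps_image[OF f S(1)] by (intro card_Diff_subset finite_horizontals sub)
  moreover have "card (horizontals a b S f x) \<le> card ({l \<in> left_cells a b. fst l = x} - mirror ` S)"
    by (rule card_mono) (use sub finite_left_cells in auto)
  ultimately show "card (horizontals a b S f x) + card (steps a b S f (x - 1)) = card ({l \<in> left_cells a b. fst l = x} - mirror ` S)"
    using card_steps_image[OF f] by simp
qed

text \<open>The leftmost column carries no left cells, so all its right cells outside S step. From
  there the two balance equations determine, column by column, the number of horizontals and then of
  steps, without reference to the matching.\<close>

lemma card_steps_eq: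
  assumes f: "matching_off a b S f" and g: "matching_off a b S g"
    and S: "S \<subseteq> right_cells a b" "mirror ` S \<subseteq> left_cells a b" "finite S"
  shows "- int a + int j < int a \<Longrightarrow> card (steps a b S f (- int a + int j)) = card (steps a b S g (- int a + int j)) \<and>
     (0 < j \<longrightarrow> card (horizontals a b S f (- int a + int j)) = card (horizontals a b S g (- int a + int j)))"
proof (induction j)
  case 0
  have "steps a b S h (- int a) = {r \<in> right_cells a b - S. fst r = - int a}" if h: "matching_off a b S h" for h
  proof -
    have "h r \<noteq> r" if "r \<in> right_cells a b" "fst r = - int a" for r
    proof -
      have "h r \<in> left_cells a b" using h that(1) unfolding matching_off_def by (blast dest: bij_betwE)
      then have "- int a < fst (h r)" unfolding left_cells_def by (cases "h r") simp
      then show ?thesis using that(2) by (metis order_less_irrefl)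
    qed
    then show ?thesis unfolding steps_def by blast
  qed
  then show ?case using f g by simp
next
  case (Suc j)
  have eq: "- int a + int (Suc j) - 1 = - int a + int j" by simp
  have m: "- int a < - int a + int (Suc j)" "- int a + int (Suc j) < int a" using Suc.prems by simp_all
  have "card (steps a b S f (- int a + int j)) = card (steps a b S g (- int a + int j))"
    using Suc by simp
  then show ?case
    using card_horizontals_steps[OF f S m] card_horizontals_steps[OF g S m] unfolding eq by linarith
qed

lemma cell_parity:
  "r \<in> right_cells a b \<union> left_cells a b \<Longrightarrow> odd (fst r + snd r + int a + int b)"
  unfolding right_cells_def left_cells_def by auto

lemma lex_less_total: "c \<noteq> c' \<Longrightarrow> lex_less c c' \<or> lex_less c' c"
  by (cases c; cases c') auto

lemma lex_less_asym: "lex_less c c' \<Longrightarrow> \<not> lex_less c' c"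
  by auto

lemma same_column_parity:
  assumes "odd (fst r + snd r + int a + int b)" "odd (fst r' + snd r' + int a + int b)" "fst r = fst r'"
  shows "even (snd r - snd r')"
  using assms by presburger

text \<open>Parity leaves no cell between heights -1 and 1 in this column, so the two cells are
  neighbours in the order and compare alike with every other cell. This is why the hole cells will
  not disturb the signs.\<close>

lemma lex_less_pair:
  assumes "odd (fst r + snd r + int a + int b)" "odd (x + 1 + int a + int b)" "r \<noteq> (x, -1)" "r \<noteq> (x, 1)"
  shows "lex_less r (x, -1) \<longleftrightarrow> lex_less r (x, 1)" "lex_less (x, -1) r \<longleftrightarrow> lex_less (x, 1) r"
proof -
  have "snd r < -1 \<or> snd r > 1" if "fst r = x"
  proof -
    have "even (snd r - 1)" using same_column_parity[of r a b "(x, 1)"] assms that by simp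
    moreover have "snd r \<noteq> -1" "snd r \<noteq> 1" using assms that by (metis prod.collapse)+
    ultimately show ?thesis by presburger
  qed
  then show "lex_less r (x, -1) \<longleftrightarrow> lex_less r (x, 1)" "lex_less (x, -1) r \<longleftrightarrow> lex_less (x, 1) r" by auto
qed

lemma even_card_pair_above:
  assumes "odd (fst h + snd h + int a + int b)" "odd (x + 1 + int a + int b)" "h \<notin> {(x, -1), (x, 1)}"
  shows "even (card {c \<in> {(x, -1), (x, 1 :: int)}. fst c = fst h \<and> snd h < snd c})"
proof -
  have "lex_less h (x, -1) \<longleftrightarrow> lex_less h (x, 1)" using lex_less_pair[OF assms(1,2)] assms(3) by auto
  then have "{c \<in> {(x, -1), (x, 1)}. fst c = fst h \<and> snd h < snd c} = {(x, -1), (x, 1)} \<or>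
      {c \<in> {(x, -1), (x, 1)}. fst c = fst h \<and> snd h < snd c} = {}" by auto
  then show ?thesis
  proof (elim disjE)
    assume eq: "{c \<in> {(x, -1), (x, 1)}. fst c = fst h \<and> snd h < snd c} = {(x, -1), (x, 1)}"
    show ?thesis unfolding eq by simp
  next
    assume eq: "{c \<in> {(x, -1), (x, 1)}. fst c = fst h \<and> snd h < snd c} = {}"
    show ?thesis unfolding eq by simp
  qed
qed

text \<open>The defect cells come as two consecutive cells of one column, and so do their mirror
  images; signs involving them therefore occur twice.\<close>

definition sign_defect :: "point set \<Rightarrow> bool" where
  "sign_defect S \<longleftrightarrow> S = {} \<or> (\<exists>k::nat. S = {(- int k, -1), (- int k, 1)})"

definition key :: "nat \<Rightarrow> nat \<Rightarrow> point \<Rightarrow> int" where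
  "key a b = cell_key (int (a + b))"

context
  fixes a b :: nat and S :: "point set" and f :: "point \<Rightarrow> point"
  assumes f: "matching_off a b S f" and S: "S \<subseteq> right_cells a b" "mirror ` S \<subseteq> left_cells a b" "sign_defect S"
begin

lemma matching_off_bij: "bij_betw f (right_cells a b) (left_cells a b)"
  and matching_off_rhombic: "\<And>r. r \<in> right_cells a b \<Longrightarrow> r \<notin> S \<Longrightarrow> rhombic r (f r)"
  and matching_off_mirror: "\<And>r. r \<in> S \<Longrightarrow> f r = mirror r"
  using f by (auto simp: matching_off_def)

lemma matching_off_inj: "r \<in> right_cells a b \<Longrightarrow> r' \<in> right_cells a b \<Longrightarrow> f r = f r' \<longleftrightarrow> r = r'"
  using inj_on_eq_iff[OF bij_betw_imp_inj_on[OF matching_off_bij]] .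

lemma matching_off_mem: "r \<in> right_cells a b \<Longrightarrow> f r \<in> left_cells a b"
  using matching_off_bij by (blast dest: bij_betwE)

lemma matching_off_notin_mirror: 
  assumes "r \<in> right_cells a b" "r \<notin> S" shows "f r \<notin> mirror ` S"
proof
  assume "f r \<in> mirror ` S"
  then obtain s where "s \<in> S" "f s = f r" using matching_off_mirror by force
  then show False using matching_off_inj[of s r] assms S by blast
qed

lemma finite_defect: "finite S" using S(3) by (auto simp: sign_defect_def)

lemma crossing_parity:
  assumes h: "h \<in> right_cells a b" "h \<notin> S" "f h = h"
  shows "even (card {r \<in> right_cells a b - S. lex_less r h \<and> lex_less h (f r)} + card (steps a b S f (fst h)))"
proof -
  define x where "x = fst h"
  have hL: "h \<in> left_cells a b" using matching_off_mem[OF h(1)] h(3) by simp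
  have x: "- int a < x" "x < int a" using h(1) hL by (auto simp: x_def right_cells_def left_cells_def)
  let ?col = "{r \<in> right_cells a b. fst r = x}"
  have col: "?col = {l \<in> left_cells a b. fst l = x}" using x by (auto simp: right_cells_def left_cells_def)
  let ?H = "horizontals a b S f x"
  let ?up = "\<lambda>A. {c \<in> A. fst c = x \<and> snd h < snd c}"
  have st: "steps a b S f x = ?col - S - ?H" unfolding steps_def horizontals_def by auto
  have im: "f ` steps a b S f (x - 1) = ?col - mirror ` S - ?H" unfolding steps_image[OF f S(1)] col ..
  have par: "odd (fst h + snd h + int a + int b)" using cell_parity h(1) by blast
  have e1: "even (card (?up S))"
  proof (cases "S = {}")
    case False
    then obtain k where k: "S = {(- int k, -1), (- int k, 1)}" using S(3) unfolding sign_defect_def by auto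
    have "odd (- int k + 1 + int a + int b)" using cell_parity[of "(- int k, 1)" a b] S(1) k by auto
    then show ?thesis using even_card_pair_above[OF par, of "- int k"] h(2) unfolding k x_def by simp
  qed simp
  have hm: "h \<notin> mirror ` S" using matching_off_notin_mirror[OF h(1,2)] h(3) by simp
  have e2: "even (card (?up (mirror ` S)))"
  proof (cases "S = {}")
    case False
    then obtain k where k: "S = {(- int k, -1), (- int k, 1)}" using S(3) unfolding sign_defect_def by auto
    have m: "mirror ` S = {(int k, -1), (int k, 1)}" unfolding k by (auto simp: mirror_def)
    have "odd (int k + 1 + int a + int b)" using cell_parity[of "(int k, 1)" a b] S(2) m by auto
    then show ?thesis using even_card_pair_above[OF par, of "int k"] hm unfolding m x_def by simp
  qed simp
  have fin: "finite ?col" using finite_right_cells by simp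
  have finS: "finite S" by (rule finite_defect)
  have HS: "?H \<inter> S = {}" unfolding horizontals_def by auto
  have Hm: "?H \<inter> mirror ` S = {}"
  proof (rule Int_emptyI)
    fix c assume "c \<in> ?H" "c \<in> mirror ` S"
    then have "c \<in> right_cells a b" "c \<notin> S" "f c \<in> mirror ` S" unfolding horizontals_def by auto
    then show False using matching_off_notin_mirror by blast
  qed
  have "?up (?col - ?H) = ?up (steps a b S f x) \<union> ?up S" 
    unfolding st using HS S(1) by auto
  moreover have "?up (steps a b S f x) \<inter> ?up S = {}" unfolding st by auto
  ultimately have c1: "card (?up (?col - ?H)) = card (?up (steps a b S f x)) + card (?up S)"
    using card_Un_disjoint[of "?up (steps a b S f x)" "?up S"] finS finite_steps by simp
  have "?up (?col - ?H) = ?up (f ` steps a b S f (x - 1)) \<union> ?up (mirror ` S)"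
    unfolding im using Hm S(2) col by auto
  moreover have "?up (f ` steps a b S f (x - 1)) \<inter> ?up (mirror ` S) = {}" unfolding im by auto
  ultimately have c2: "card (?up (?col - ?H)) = card (?up (f ` steps a b S f (x - 1))) + card (?up (mirror ` S))"
    using card_Un_disjoint[of "?up (f ` steps a b S f (x - 1))" "?up (mirror ` S)"] finS finite_steps by simp
  let ?lo = "{r \<in> steps a b S f x. snd r < snd h}"
  let ?left = "{r \<in> steps a b S f (x - 1). snd h < snd (f r)}"
  \<comment> \<open>Crossing h means leaving its column from below h or arriving in it above
    h.\<close>
  have "{r \<in> right_cells a b - S. lex_less r h \<and> lex_less h (f r)} = ?lo \<union> ?left"
  proof (rule Set.set_eqI)
    fix r
    show "r \<in> {r \<in> right_cells a b - S. lex_less r h \<and> lex_less h (f r)} \<longleftrightarrow> r \<in> ?lo \<union> ?left"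
    proof (cases "r \<in> right_cells a b \<and> r \<notin> S")
      case True
      then have "rhombic r (f r)" using matching_off_rhombic by blast
      then consider "f r = r" | "f r \<noteq> r" "fst (f r) = fst r + 1" unfolding rhombic_def by fastforce
      then show ?thesis
      proof cases
        case 2
        then show ?thesis using True unfolding steps_def x_def by auto
      qed (auto simp: steps_def)
    qed (auto simp: steps_def)
  qed
  moreover have "?lo \<inter> ?left = {}" unfolding steps_def by auto
  ultimately have "card {r \<in> right_cells a b - S. lex_less r h \<and> lex_less h (f r)} = card ?lo + card ?left"
    using card_Un_disjoint[of ?lo ?left] finite_steps by simp
  moreover have "card ?left = card (?up (f ` steps a b S f (x - 1)))"
  proof -
    have "fst (f r) = x" if "r \<in> steps a b S f (x - 1)" for r
    proof -
      have "f r \<in> ?col - mirror ` S - ?H" using that im by blast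
      then show ?thesis by simp
    qed
    then have "?up (f ` steps a b S f (x - 1)) = f ` ?left" by blast
    moreover have "inj_on f ?left"
      by (rule inj_on_subset[OF bij_betw_imp_inj_on[OF matching_off_bij]]) (auto simp: steps_def)
    ultimately show ?thesis by (simp only: card_image)
  qed
  moreover have "card (steps a b S f x) = card ?lo + card (?up (steps a b S f x))"
  proof -
    have "snd r \<noteq> snd h" if "r \<in> steps a b S f x" for r
    proof
      assume "snd r = snd h"
      moreover have "fst r = fst h" "f r \<noteq> r" using that unfolding steps_def x_def by auto
      ultimately show False using h(3) prod_eqI by metis
    qed
    moreover have "fst r = x" if "r \<in> steps a b S f x" for r using that unfolding steps_def by blast
    ultimately have "steps a b S f x = ?lo \<union> ?up (steps a b S f x)" using linorder_neqE_linordered_idom by blast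
    moreover have "?lo \<inter> ?up (steps a b S f x) = {}" by auto
    ultimately show ?thesis using card_Un_disjoint[of ?lo "?up (steps a b S f x)"] finite_steps by simp
  qed
  \<comment> \<open>Here n counts crossings, t the steps of the column, l and u those below and
    above h, p the arrivals above h, c the non-horizontal cells above h, s and m the hole cells
    above h on the two sides of the matching.\<close>
  moreover have arith: "even (n + t)" if "n = l + q" "q = p" "t = l + u" "c = u + s" "c = p + m" "even s" "even m"
    for n t l q p u c s m :: nat
    using that by presburger
  ultimately show ?thesis unfolding x_def[symmetric] using c1 c2 e1 e2 by (intro arith)
qed

text \<open>Within a column cells are at least 2 apart in height and a step changes the height by 1,
  so two steps can meet but not overtake each other, and injectivity excludes meeting. If r is
  horizontal, its image stays in an earlier column than that of r'.\<close>

lemma step_sign: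
  assumes r: "r \<in> right_cells a b" "r \<notin> S" and r': "r' \<in> right_cells a b" "r' \<notin> S" "f r' \<noteq> r'"
    and less: "lex_less r r'"
  shows "lex_less (f r) (f r')"
proof -
  have rh: "rhombic r (f r)" "rhombic r' (f r')" using matching_off_rhombic r r' by blast+
  have r'2: "fst (f r') = fst r' + 1" "snd (f r') = snd r' + 1 \<or> snd (f r') = snd r' - 1"
    using rh(2) r'(3) unfolding rhombic_def by auto
  consider "f r = r" | "fst (f r) = fst r + 1" "snd (f r) = snd r + 1 \<or> snd (f r) = snd r - 1"
    using rh(1) unfolding rhombic_def by auto
  then show ?thesis
  proof cases
    case 2
    show ?thesis
    proof (cases "fst r < fst r'")
      case False
      then have eq: "fst r = fst r'" "snd r < snd r'" using less by auto
      have "even (snd r - snd r')" by (rule same_column_parity[OF _ _ eq(1)]) (use cell_parity r r' in blast)+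
      then have "snd r + 2 \<le> snd r'" using eq(2) by presburger
      moreover have "f r \<noteq> f r'" using matching_off_inj r r' less by auto
      then have "snd (f r) \<noteq> snd (f r')" using 2 r'2 eq by (metis prod_eqI)
      ultimately have "snd (f r) < snd (f r')" using 2(2) r'2(2) by auto
      then show ?thesis using 2 r'2 eq by simp
    qed (use 2 r'2 in auto)
  qed (use less r'2 in auto)
qed

lemma sgn_key_diff:
  assumes "c \<in> left_cells a b" "c' \<in> left_cells a b" "c \<noteq> c'"
  shows "sgn (key a b c' - key a b c) = (if lex_less c c' then 1 else -1)"
proof -
  have k: "key a b c < key a b c' \<longleftrightarrow> lex_less c c'" "key a b c' < key a b c \<longleftrightarrow> lex_less c' c"
    unfolding key_def using cell_key_less_cells assms by blast+
  show ?thesis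
  proof (cases "lex_less c c'")
    case True
    then have "0 < key a b c' - key a b c" using k(1) by simp
    then show ?thesis using True by (simp only: sgn_pos if_True)
  next
    case False
    then have "lex_less c' c" using lex_less_total[OF assms(3)] by blast
    then have "key a b c' - key a b c < 0" using k(2) by simp
    then show ?thesis using False by (simp only: sgn_neg if_False)
  qed
qed

text \<open>Any other cell meets both defect cells with the same sign, which gives squares. The pair
  of defect cells itself keeps its order because \<open>mirror\<close> preserves heights.\<close>

lemma prod_defect_pairs:
  "(\<Prod>(r, r') \<in> {(r, r'). r \<in> right_cells a b \<and> r' \<in> right_cells a b \<and> lex_less r r' \<and> (r \<in> S \<or> r' \<in> S)}.
      sgn (key a b (f r') - key a b (f r))) = 1"
proof (cases "S = {}")
  case True
  then show ?thesis by (intro prod.neutral) auto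
next
  case False
  then obtain k where k: "S = {(- int k, -1), (- int k, 1)}" using S(3) unfolding sign_defect_def by auto
  define s1 s2 m1 m2 where sm: "s1 = (- int k, -1 :: int)" "s2 = (- int k, 1 :: int)" "m1 = (int k, -1 :: int)" "m2 = (int k, 1 :: int)"
  have fs: "f s1 = m1" "f s2 = m2" using matching_off_mirror k by (auto simp: sm mirror_def)
  have sR: "s1 \<in> right_cells a b" "s2 \<in> right_cells a b" "s1 \<noteq> s2" using S(1) k by (auto simp: sm)
  have mL: "m1 \<in> left_cells a b" "m2 \<in> left_cells a b" using matching_off_mem sR fs by metis+
  have ps: "odd (- int k + 1 + int a + int b)" "odd (int k + 1 + int a + int b)"
    using cell_parity[of s2 a b] cell_parity[of m2 a b] sR mL by (auto simp: sm)
  let ?T = "right_cells a b - S"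
  define A B where "A = {r \<in> ?T. lex_less r s1}" and "B = {r \<in> ?T. lex_less s1 r}"
  let ?g = "\<lambda>(r, r'). sgn (key a b (f r') - key a b (f r))"
  have S12: "S = {s1, s2}" using k sm by simp
  have T: "lex_less r s1 \<longleftrightarrow> lex_less r s2" "lex_less s1 r \<longleftrightarrow> lex_less s2 r"
      "sgn (key a b m1 - key a b (f r)) * sgn (key a b m2 - key a b (f r)) = 1" "sgn (key a b (f r) - key a b m1) * sgn (key a b (f r) - key a b m2) = 1"
    if "r \<in> ?T" for r
  proof -
    have r: "r \<in> right_cells a b" "r \<noteq> s1" "r \<noteq> s2" using that S12 by auto
    have fr: "f r \<in> left_cells a b" "f r \<noteq> m1" "f r \<noteq> m2" using matching_off_mem matching_off_inj r sR fs by metis+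
    show "lex_less r s1 \<longleftrightarrow> lex_less r s2" "lex_less s1 r \<longleftrightarrow> lex_less s2 r"
      using lex_less_pair[OF cell_parity ps(1)] r unfolding sm by blast+
    have "lex_less (f r) m1 \<longleftrightarrow> lex_less (f r) m2" "lex_less m1 (f r) \<longleftrightarrow> lex_less m2 (f r)"
      using lex_less_pair[OF cell_parity ps(2)] fr unfolding sm by blast+
    then show "sgn (key a b m1 - key a b (f r)) * sgn (key a b m2 - key a b (f r)) = 1" "sgn (key a b (f r) - key a b m1) * sgn (key a b (f r) - key a b m2) = 1"
      using sgn_key_diff fr mL by simp_all
  qed
  have eq: "{(r, r'). r \<in> right_cells a b \<and> r' \<in> right_cells a b \<and> lex_less r r' \<and> (r \<in> S \<or> r' \<in> S)} =
      insert (s1, s2) (A \<times> S \<union> S \<times> B)"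
  proof -
    define lx where "lx = (\<lambda>r r'. lex_less r r')"
    have l: "lx s1 s2" "\<not> lx s2 s1" "\<And>s. \<not> lx s s" unfolding sm lx_def by auto
    have A: "r \<in> A \<longleftrightarrow> r \<in> ?T \<and> lx r s1" "r \<in> A \<longleftrightarrow> r \<in> ?T \<and> lx r s2" for r
      unfolding A_def lx_def using T(1) by blast+
    have B: "r \<in> B \<longleftrightarrow> r \<in> ?T \<and> lx s1 r" "r \<in> B \<longleftrightarrow> r \<in> ?T \<and> lx s2 r" for r
      unfolding B_def lx_def using T(2) by blast+
    have "r \<in> right_cells a b \<and> r' \<in> right_cells a b \<and> lx r r' \<and> (r \<in> S \<or> r' \<in> S) \<longleftrightarrow>
      r = s1 \<and> r' = s2 \<or> r \<in> A \<and> r' \<in> S \<or> r \<in> S \<and> r' \<in> B" (is "?l \<longleftrightarrow> ?r") for r r'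
    proof
      assume L: ?l
      show ?r
      proof (cases "r \<in> S"; cases "r' \<in> S")
        assume "r \<in> S" "r' \<in> S"
        then show ?r using L l S12 by (metis insert_iff singletonD)
      next
        assume "r \<in> S" "r' \<notin> S"
        moreover from this have "r' \<in> B" using L B S12 by (metis Diff_iff insert_iff singletonD)
        ultimately show ?r by simp
      next
        assume "r \<notin> S" "r' \<in> S"
        moreover from this have "r \<in> A" using L A S12 by (metis Diff_iff insert_iff singletonD)
        ultimately show ?r by simp
      qed (use L in simp)
    next
      assume ?r
      then show ?l
      proof (elim disjE conjE)
        assume "r \<in> A" "r' \<in> S"
        then show ?l using A[of r] S12 sR by (metis Diff_iff insert_iff singletonD)
      next
        assume "r \<in> S" "r' \<in> B"
        then show ?l using B[of r'] S12 sR by (metis Diff_iff insert_iff singletonD)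
      qed (use l sR S12 in simp)
    qed
    then show ?thesis unfolding lx_def by auto
  qed
  have fin: "finite A" "finite B" "finite S" unfolding A_def B_def using finite_right_cells S12 by auto
  have "(\<Prod>x\<in>A \<times> S. ?g x) = (\<Prod>r\<in>A. \<Prod>s\<in>S. ?g (r, s))" by (subst prod.cartesian_product) (simp add: case_prod_beta)
  also have "\<dots> = 1" 
    by (rule prod.neutral) (use T(3) S12 sR fs in \<open>auto simp: A_def\<close>)
  finally have 1: "(\<Prod>x\<in>A \<times> S. ?g x) = 1" .
  have "(\<Prod>x\<in>S \<times> B. ?g x) = (\<Prod>s\<in>S. \<Prod>r\<in>B. ?g (s, r))" by (subst prod.cartesian_product) (simp add: case_prod_beta)
  also have "\<dots> = (\<Prod>r\<in>B. \<Prod>s\<in>S. ?g (s, r))" by (rule prod.swap)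
  also have "\<dots> = 1" 
    by (rule prod.neutral) (use T(4) S12 sR fs in \<open>auto simp: B_def\<close>)
  finally have 2: "(\<Prod>x\<in>S \<times> B. ?g x) = 1" .
  have "(s1, s2) \<notin> A \<times> S \<union> S \<times> B" unfolding A_def B_def S12 by auto
  moreover have "A \<times> S \<inter> S \<times> B = {}" unfolding A_def by auto
  moreover have "?g (s1, s2) = 1" using sgn_key_diff[OF mL] fs by (auto simp: sm)
  ultimately show ?thesis unfolding eq using fin 1 2 by (simp add: prod.union_disjoint)
qed

text \<open>Grouped by the larger cell of each pair, only horizontal cells can contribute a sign, by
  \<open>step_sign\<close>; their contribution is the parity of the crossings, by
  \<open>crossing_parity\<close>. The result depends on column counts alone.\<close>

lemma matching_sign_formula:
  "matching_sign (key a b) (key a b) (right_cells a b) f =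
     (\<Prod>x\<in>{- int a<..<int a}. (-1) ^ (card (steps a b S f x) * card (horizontals a b S f x)))"
proof -
  let ?R = "right_cells a b" and ?g = "\<lambda>(r, r'). sgn (key a b (f r') - key a b (f r))"
  let ?T = "right_cells a b - S"
  have fin: "finite {(r, r'). r \<in> ?R \<and> r' \<in> ?R \<and> P r r'}" for P
    by (rule finite_subset[of _ "?R \<times> ?R"]) (auto simp: finite_right_cells)
  have "matching_sign (key a b) (key a b) ?R f = (\<Prod>x\<in>{(r, r'). r \<in> ?R \<and> r' \<in> ?R \<and> lex_less r r'}. ?g x)"
    unfolding matching_sign_def by (rule prod.cong) (use cell_key_less_cells in \<open>auto simp: key_def\<close>)
  also have "{(r, r'). r \<in> ?R \<and> r' \<in> ?R \<and> lex_less r r'} =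
      {(r, r'). r \<in> ?T \<and> r' \<in> ?T \<and> lex_less r r'} \<union> {(r, r'). r \<in> ?R \<and> r' \<in> ?R \<and> lex_less r r' \<and> (r \<in> S \<or> r' \<in> S)}"
    using S(1) by blast
  also have "(\<Prod>x\<in>\<dots>. ?g x) = (\<Prod>x\<in>{(r, r'). r \<in> ?T \<and> r' \<in> ?T \<and> lex_less r r'}. ?g x) *
      (\<Prod>x\<in>{(r, r'). r \<in> ?R \<and> r' \<in> ?R \<and> lex_less r r' \<and> (r \<in> S \<or> r' \<in> S)}. ?g x)"
    by (rule prod.union_disjoint) (use fin finite_subset[OF _ fin] in \<open>auto intro: finite_subset[OF _ fin[of "\<lambda>_ _. True"]]\<close>)
  also have "\<dots> = (\<Prod>x\<in>{(r, r'). r \<in> ?T \<and> r' \<in> ?T \<and> lex_less r r'}. ?g x)"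
    unfolding prod_defect_pairs by simp
  \<comment> \<open>The pairs are regrouped by their larger member r'.\<close>
  also have "\<dots> = (\<Prod>(r', r)\<in>(SIGMA r':?T. {r \<in> ?T. lex_less r r'}). sgn (key a b (f r') - key a b (f r)))"
    by (rule prod.reindex_bij_witness[of _ "\<lambda>(x, y). (y, x)" "\<lambda>(x, y). (y, x)"]) auto
  also have "\<dots> = (\<Prod>r'\<in>?T. \<Prod>r\<in>{r \<in> ?T. lex_less r r'}. sgn (key a b (f r') - key a b (f r)))"
    by (rule prod.Sigma[symmetric]) (auto simp: finite_right_cells)
  also have "\<dots> = (\<Prod>r'\<in>?T. if f r' = r' then (-1) ^ card (steps a b S f (fst r')) else 1)"
  proof (rule prod.cong, simp)
    fix r' assume r': "r' \<in> ?T"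
    have sg: "sgn (key a b (f r') - key a b (f r)) = (if lex_less (f r) (f r') then 1 else -1)" if "r \<in> ?T" "lex_less r r'" for r
    proof -
      have "f r \<noteq> f r'" using matching_off_inj[of r r'] that r' by auto
      then show ?thesis using sgn_key_diff matching_off_mem that r' by blast
    qed
    show "(\<Prod>r\<in>{r \<in> ?T. lex_less r r'}. sgn (key a b (f r') - key a b (f r))) =
       (if f r' = r' then (-1) ^ card (steps a b S f (fst r')) else 1)"
    proof (cases "f r' = r'")
      case False
      have "sgn (key a b (f r') - key a b (f r)) = 1" if "r \<in> {r \<in> ?T. lex_less r r'}" for r
        using sg[of r] step_sign[of r r'] r' False that by simp
      then have "(\<Prod>r\<in>{r \<in> ?T. lex_less r r'}. sgn (key a b (f r') - key a b (f r))) = 1" by (intro prod.neutral) blast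
      then show ?thesis using False by (simp only: if_False)
    next
      case True
      have "(\<Prod>r\<in>{r \<in> ?T. lex_less r r'}. sgn (key a b (f r') - key a b (f r))) =
         (\<Prod>r\<in>{r \<in> ?T. lex_less r r'}. if lex_less r' (f r) then -1 else 1)"
      proof (rule prod.cong, simp)
        fix r assume r: "r \<in> {r \<in> ?T. lex_less r r'}"
        then have "f r \<noteq> f r'" using matching_off_inj[of r r'] r' by auto
        then have "lex_less r' (f r) \<longleftrightarrow> \<not> lex_less (f r) (f r')"
          unfolding True using lex_less_total lex_less_asym by blast
        then show "sgn (key a b (f r') - key a b (f r)) = (if lex_less r' (f r) then -1 else 1)" using sg r by auto
      qed
      also have "\<dots> = (\<Prod>r\<in>{r \<in> {r \<in> ?T. lex_less r r'}. lex_less r' (f r)}. -1)"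
        by (rule prod.inter_filter[symmetric]) (simp add: finite_right_cells)
      also have "\<dots> = (-1) ^ card {r \<in> ?T. lex_less r r' \<and> lex_less r' (f r)}"
        by (simp add: conj_assoc)
      also have "\<dots> = (-1) ^ card (steps a b S f (fst r'))"
        using crossing_parity[of r'] r' True by (auto simp: minus_one_power_iff)
      finally show ?thesis using True by simp
    qed
  qed
  also have "\<dots> = (\<Prod>r'\<in>{r' \<in> ?T. f r' = r'}. (-1) ^ card (steps a b S f (fst r')))"
    by (rule prod.inter_filter[symmetric]) (simp add: finite_right_cells)
  also have "{r' \<in> ?T. f r' = r'} = (\<Union>x\<in>{- int a<..<int a}. horizontals a b S f x)"
  proof (rule Set.set_eqI)
    fix r
    have "- int a < fst r \<and> fst r < int a" if "r \<in> right_cells a b" "f r = r"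
    proof -
      have "r \<in> left_cells a b" using matching_off_mem[OF that(1)] that(2) by simp
      then show ?thesis using that(1) unfolding right_cells_def left_cells_def by auto
    qed
    then show "r \<in> {r' \<in> ?T. f r' = r'} \<longleftrightarrow> r \<in> (\<Union>x\<in>{- int a<..<int a}. horizontals a b S f x)"
      unfolding horizontals_def by auto
  qed
  also have "(\<Prod>r'\<in>\<dots>. (-1 :: int) ^ card (steps a b S f (fst r'))) =
      (\<Prod>x\<in>{- int a<..<int a}. \<Prod>r'\<in>horizontals a b S f x. (-1) ^ card (steps a b S f (fst r')))"
    by (rule prod.UNION_disjoint) (auto simp: finite_horizontals, auto simp: horizontals_def)
  also have "\<dots> = (\<Prod>x\<in>{- int a<..<int a}. (-1) ^ (card (steps a b S f x) * card (horizontals a b S f x)))"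
  proof (rule prod.cong, simp)
    fix x
    have "(\<Prod>r'\<in>horizontals a b S f x. (-1 :: int) ^ card (steps a b S f (fst r'))) = (\<Prod>r'\<in>horizontals a b S f x. (-1) ^ card (steps a b S f x))"
      by (rule prod.cong) (auto simp: horizontals_def)
    then show "(\<Prod>r'\<in>horizontals a b S f x. (-1 :: int) ^ card (steps a b S f (fst r'))) = (-1) ^ (card (steps a b S f x) * card (horizontals a b S f x))"
      by (simp add: power_mult)
  qed
  finally show ?thesis .
qed

end

lemma matching_sign_eq:
  assumes "matching_off a b S f" "matching_off a b S g"
    and S: "S \<subseteq> right_cells a b" "mirror ` S \<subseteq> left_cells a b" "sign_defect S"
  shows "matching_sign (key a b) (key a b) (right_cells a b) f = matching_sign (key a b) (key a b) (right_cells a b) g"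
  unfolding matching_sign_formula[OF assms(1) S] matching_sign_formula[OF assms(2) S]
proof (rule prod.cong, simp)
  fix x assume x: "x \<in> {- int a<..<int a}"
  have fin: "finite S" using S(3) by (auto simp: sign_defect_def)
  have "card (steps a b S f x) = card (steps a b S g x) \<and> card (horizontals a b S f x) = card (horizontals a b S g x)"
    using card_steps_eq[OF assms(1,2) S(1,2) fin, of "nat (x + int a)"] x by simp
  then show "(-1 :: int) ^ (card (steps a b S f x) * card (horizontals a b S f x)) =
      (-1) ^ (card (steps a b S g x) * card (horizontals a b S g x))" by simp
qed

lemma bij_betw_mirror_cells: "bij_betw mirror (right_cells a b) (left_cells a b)"
  by (rule bij_betwI[where g = mirror]) (auto simp: mirror_def right_cells_def left_cells_def)

lemma inj_on_key: "inj_on (key a b) (right_cells a b \<union> left_cells a b)"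
proof (rule inj_onI, rule ccontr)
  fix r r' assume r: "r \<in> right_cells a b \<union> left_cells a b" "r' \<in> right_cells a b \<union> left_cells a b"
    and eq: "key a b r = key a b r'" and "r \<noteq> r'"
  then have "key a b r < key a b r' \<or> key a b r' < key a b r"
    unfolding key_def cell_key_less_cells[OF r] cell_key_less_cells[OF r(2,1)] by (intro lex_less_total)
  then show False using eq by simp
qed

lemma abs_matching_sign:
  assumes "matching_off a b S f" "S \<subseteq> right_cells a b" "mirror ` S \<subseteq> left_cells a b" "sign_defect S"
  shows "\<bar>matching_sign (key a b) (key a b) (right_cells a b) f\<bar> = 1"
  unfolding matching_sign_formula[OF assms] by (simp add: abs_prod power_abs)

text \<open>The column of each sink is replaced by a unit vector at the corresponding source. This
  deletes the four cells without changing the size of the matrix, so that it differs from the matrix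
  of the hexagon in two columns only.\<close>

definition holey_adj :: "point \<Rightarrow> point \<Rightarrow> point \<Rightarrow> point \<Rightarrow> point \<Rightarrow> point \<Rightarrow> bool" where
  "holey_adj src_lo src_hi snk_lo snk_hi r l \<longleftrightarrow> (if l = snk_lo then r = src_lo else if l = snk_hi then r = src_hi else rhombic r l)"

lemma card_matchings_eq_abs_det:
  assumes u: "bij_betw u {..<n} (right_cells a b)" "\<And>i j. i < n \<Longrightarrow> j < n \<Longrightarrow> key a b (u i) < key a b (u j) \<longleftrightarrow> i < j"
    and v: "bij_betw v {..<n} (left_cells a b)" "\<And>i j. i < n \<Longrightarrow> j < n \<Longrightarrow> key a b (v i) < key a b (v j) \<longleftrightarrow> i < j"
    and S: "S \<subseteq> right_cells a b" "mirror ` S \<subseteq> left_cells a b" "sign_defect S"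
    and A: "\<And>f. f \<in> matchings (right_cells a b) (left_cells a b) A \<Longrightarrow> matching_off a b S f"
  shows "real (card (matchings (right_cells a b) (left_cells a b) A)) =
     \<bar>Determinant.det (Matrix.mat n n (\<lambda>(i, j). if A (u i) (v j) then 1 else 0 :: real))\<bar>"
proof -
  let ?M = "matchings (right_cells a b) (left_cells a b) A"
  obtain s where "\<bar>s\<bar> = 1" "\<And>f. f \<in> ?M \<Longrightarrow> matching_sign (key a b) (key a b) (right_cells a b) f = s"
  proof (cases "?M = {}")
    case False
    then obtain g where "g \<in> ?M" by blast
    then show ?thesis
      using that abs_matching_sign[OF A S] matching_sign_eq[OF A A S] by blast
  \<comment> \<open>If there is no matching at all, every sign serves.\<close>
  qed (use that[of 1] in auto)
  then show ?thesis
    using abs_det_eq_card_matchings[where u = u and v = v and n = n and kr = "key a b" and kl = "key a b" and s = s, OF u(1) _ v(1)]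
      u(2) v(2) by simp
qed

section \<open>The two holes and Cramer's rule\<close>

context
  fixes a b k :: nat
  assumes ak: "2 \<le> a" "k \<le> a" "k + 2 \<le> a + b" "even (a + b + k)"
begin

abbreviation "src_lo \<equiv> (- int k, -1 :: int)"
abbreviation "src_hi \<equiv> (- int k, 1 :: int)"
abbreviation "snk_lo \<equiv> (int k, -1 :: int)"
abbreviation "snk_hi \<equiv> (int k, 1 :: int)"
abbreviation "forced_l \<equiv> (1 - int k, 0 :: int)"
abbreviation "forced_r \<equiv> (int k - 1, 0 :: int)"
abbreviation "hole_rights \<equiv> {src_hi, src_lo, forced_l, forced_r}"
abbreviation "hole_lefts \<equiv> {snk_hi, snk_lo, forced_l, forced_r}"

lemma parity_abk: "odd (int k + 1 + int a + int b)" "odd (- int k + 1 + int a + int b)"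
     "odd (int k - 1 + int a + int b)" "odd (- int k - 1 + int a + int b)" "odd (1 - int k + int a + int b)"
proof -
  have "even (int k + int a + int b)" using ak(4) by (metis add.commute add.left_commute even_of_nat of_nat_add)
  then show "odd (int k + 1 + int a + int b)" "odd (- int k + 1 + int a + int b)"
     "odd (int k - 1 + int a + int b)" "odd (- int k - 1 + int a + int b)" "odd (1 - int k + int a + int b)" by presburger+
qed

lemma holes_mem: "src_lo \<in> right_cells a b" "src_hi \<in> right_cells a b" "snk_lo \<in> left_cells a b" "snk_hi \<in> left_cells a b"
  "forced_l \<in> right_cells a b" "forced_r \<in> right_cells a b" "forced_l \<in> left_cells a b" "forced_r \<in> left_cells a b"
  using ak parity_abk unfolding right_cells_def left_cells_def by auto

text \<open>The left cell \<open>forced_l\<close> has only itself and the two sources as right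
  neighbours, and the right cell \<open>forced_r\<close> only itself and the two sinks as left
  neighbours. With sources and sinks taken, both are matched to themselves.\<close>

lemma holey_adj_matching:
  assumes "f \<in> matchings (right_cells a b) (left_cells a b) (holey_adj src_lo src_hi snk_lo snk_hi)"
  shows "f src_lo = snk_lo" "f src_hi = snk_hi" "f forced_l = forced_l" "f forced_r = forced_r"
    "\<And>r. r \<in> right_cells a b \<Longrightarrow> r \<noteq> src_lo \<Longrightarrow> r \<noteq> src_hi \<Longrightarrow> f r \<noteq> snk_lo \<and> f r \<noteq> snk_hi \<and> rhombic r (f r)"
proof -
  have b: "bij_betw f (right_cells a b) (left_cells a b)" and
    A: "\<And>r. r \<in> right_cells a b \<Longrightarrow> holey_adj src_lo src_hi snk_lo snk_hi r (f r)" using assms by (auto simp: matchings_def)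
  have ex: "\<exists>r\<in>right_cells a b. f r = l" if "l \<in> left_cells a b" for l
  proof -
    have "l \<in> f ` right_cells a b" using that bij_betw_imp_surj_on[OF b] by simp
    then show ?thesis by blast
  qed
  note inj = inj_on_eq_iff[OF bij_betw_imp_inj_on[OF b]]
  show 1: "f src_lo = snk_lo" using ex[OF holes_mem(3)] A unfolding holey_adj_def by fastforce
  show 2: "f src_hi = snk_hi" using ex[OF holes_mem(4)] A unfolding holey_adj_def by fastforce
  show 3: "f r \<noteq> snk_lo \<and> f r \<noteq> snk_hi \<and> rhombic r (f r)" if "r \<in> right_cells a b" "r \<noteq> src_lo" "r \<noteq> src_hi" for r
  proof -
    have "f r \<noteq> snk_lo" "f r \<noteq> snk_hi" using inj[OF that(1) holes_mem(1)] inj[OF that(1) holes_mem(2)] that 1 2 by auto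
    then show ?thesis using A[OF that(1)] unfolding holey_adj_def by simp
  qed
  obtain r where r: "r \<in> right_cells a b" "f r = forced_l" using ex[OF holes_mem(7)] by blast
  have "r \<noteq> src_lo" "r \<noteq> src_hi" using r 1 2 by auto
  moreover from this have "rhombic r forced_l" using 3[OF r(1)] r(2) by simp
  ultimately have "r = forced_l" unfolding rhombic_def by (cases r) auto
  then show "f forced_l = forced_l" using r by simp
  have "rhombic forced_r (f forced_r)" "f forced_r \<noteq> snk_lo" "f forced_r \<noteq> snk_hi" using 3[OF holes_mem(6)] by auto
  then show "f forced_r = forced_r" unfolding rhombic_def by auto
qed

text \<open>On the cells of the holes every matching is the fixed map \<open>\<sigma>\<close>, so
  restriction to the remaining cells is reversible.\<close>

lemma card_holey_matchings:
  "card (matchings (right_cells a b) (left_cells a b) (holey_adj src_lo src_hi snk_lo snk_hi)) =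
   card (matchings (right_cells a b - hole_rights) (left_cells a b - hole_lefts) rhombic)"
proof -
  let ?R = "right_cells a b" and ?L = "left_cells a b"
  define \<sigma> where "\<sigma> = (\<lambda>r::point. if r = src_lo then snk_lo else if r = src_hi then snk_hi else r)"
  have \<sigma>: "\<sigma> src_lo = snk_lo" "\<sigma> src_hi = snk_hi" "\<sigma> forced_l = forced_l" "\<sigma> forced_r = forced_r" unfolding \<sigma>_def by auto
  have \<sigma>b: "bij_betw \<sigma> hole_rights hole_lefts"
    unfolding bij_betw_def
  proof
    show "inj_on \<sigma> hole_rights" unfolding inj_on_def using \<sigma> by auto
    show "\<sigma> ` hole_rights = hole_lefts" unfolding image_insert image_empty \<sigma> ..
  qed
  have hole_rights: "hole_rights \<subseteq> ?R" "hole_lefts \<subseteq> ?L" using holes_mem by auto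
  have "bij_betw (\<lambda>f. restrict f (?R - hole_rights)) (matchings ?R ?L (holey_adj src_lo src_hi snk_lo snk_hi)) (matchings (?R - hole_rights) (?L - hole_lefts) rhombic)"
  proof (rule bij_betwI[where g = "\<lambda>h r. if r \<in> hole_rights then \<sigma> r else h r"])
    show "(\<lambda>f. restrict f (?R - hole_rights)) \<in> matchings ?R ?L (holey_adj src_lo src_hi snk_lo snk_hi) \<rightarrow> matchings (?R - hole_rights) (?L - hole_lefts) rhombic"
    proof
      fix f assume f: "f \<in> matchings ?R ?L (holey_adj src_lo src_hi snk_lo snk_hi)"
      note H = holey_adj_matching[OF f]
      have b: "bij_betw f ?R ?L" using f by (auto simp: matchings_def)
      have fRH: "f ` hole_rights = hole_lefts" unfolding image_insert image_empty H(1-4) ..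
      have fb: "bij_betw f (?R - hole_rights) (?L - hole_lefts)"
      proof -
        note i = bij_betw_imp_inj_on[OF b]
        have "f ` (?R - hole_rights) = f ` ?R - f ` hole_rights" by (rule inj_on_image_set_diff[OF i _ hole_rights(1)]) blast
        then have "f ` (?R - hole_rights) = ?L - hole_lefts" using fRH bij_betw_imp_surj_on[OF b] by simp
        moreover have "inj_on f (?R - hole_rights)" using i by (rule inj_on_subset) blast
        ultimately show ?thesis by (simp only: bij_betw_def)
      qed
      have "bij_betw (restrict f (?R - hole_rights)) (?R - hole_rights) (?L - hole_lefts)"
        by (subst bij_betw_cong[where g = f]) (simp, rule fb)
      then show "restrict f (?R - hole_rights) \<in> matchings (?R - hole_rights) (?L - hole_lefts) rhombic"
        unfolding matchings_def using H(5) by simp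
    qed
    show "(\<lambda>h r. if r \<in> hole_rights then \<sigma> r else h r) \<in> matchings (?R - hole_rights) (?L - hole_lefts) rhombic \<rightarrow> matchings ?R ?L (holey_adj src_lo src_hi snk_lo snk_hi)"
    proof
      fix h assume h: "h \<in> matchings (?R - hole_rights) (?L - hole_lefts) rhombic"
      let ?g = "\<lambda>r. if r \<in> hole_rights then \<sigma> r else h r"
      have hb: "bij_betw h (?R - hole_rights) (?L - hole_lefts)" "\<And>r. r \<in> ?R - hole_rights \<Longrightarrow> rhombic r (h r)" "h \<in> extensional (?R - hole_rights)"
        using h by (auto simp: matchings_def)
      have "bij_betw ?g hole_rights hole_lefts" by (subst bij_betw_cong[where g = \<sigma>]) (simp, rule \<sigma>b)
      moreover have "bij_betw ?g (?R - hole_rights) (?L - hole_lefts)" by (subst bij_betw_cong[where g = h]) (simp, rule hb(1))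
      ultimately have "bij_betw ?g (hole_rights \<union> (?R - hole_rights)) (hole_lefts \<union> (?L - hole_lefts))" by (rule bij_betw_combine) blast
      moreover have "hole_rights \<union> (?R - hole_rights) = ?R" "hole_lefts \<union> (?L - hole_lefts) = ?L" using hole_rights by blast+
      ultimately have "bij_betw ?g ?R ?L" by simp
      moreover have "?g \<in> extensional ?R"
      proof -
        have "?g x = undefined" if "x \<notin> ?R" for x
        proof -
          have "x \<notin> hole_rights" using that hole_rights(1) by blast
          moreover have "h x = undefined" using extensional_arb[OF hb(3), of x] that by blast
          ultimately show ?thesis by (simp only: if_False)
        qed
        then show ?thesis unfolding extensional_def by blast
      qed
      moreover have "holey_adj src_lo src_hi snk_lo snk_hi r (?g r)" if "r \<in> ?R" for r
      proof (cases "r \<in> hole_rights")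
        case True
        then consider "r = src_lo" | "r = src_hi" | "r = forced_l" | "r = forced_r" by blast
        then show ?thesis by cases (simp_all add: \<sigma> holey_adj_def rhombic_def)
      next
        case False
        then have "r \<in> ?R - hole_rights" using that by blast
        then have "h r \<in> ?L - hole_lefts" "rhombic r (h r)" using hb by (blast dest: bij_betwE)+
        then have "h r \<noteq> snk_lo" "h r \<noteq> snk_hi" "rhombic r (h r)" by blast+
        then show ?thesis using False unfolding holey_adj_def by simp
      qed
      ultimately show "?g \<in> matchings ?R ?L (holey_adj src_lo src_hi snk_lo snk_hi)" unfolding matchings_def by blast
    qed
    fix f assume f: "f \<in> matchings ?R ?L (holey_adj src_lo src_hi snk_lo snk_hi)"
    note H = holey_adj_matching[OF f]
    have fe: "f \<in> extensional ?R" using f by (auto simp: matchings_def)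
    show "(\<lambda>r. if r \<in> hole_rights then \<sigma> r else restrict f (?R - hole_rights) r) = f"
    proof
      fix r
      consider "r = src_lo" | "r = src_hi" | "r = forced_l" | "r = forced_r" | "r \<notin> hole_rights" "r \<in> ?R" | "r \<notin> hole_rights" "r \<notin> ?R" by blast
      then show "(if r \<in> hole_rights then \<sigma> r else restrict f (?R - hole_rights) r) = f r"
        using extensional_arb[OF fe, of r] H(1-4) \<sigma> by cases simp_all
    qed
  next
    fix h assume h: "h \<in> matchings (?R - hole_rights) (?L - hole_lefts) rhombic"
    then have "h \<in> extensional (?R - hole_rights)" by (auto simp: matchings_def)
    then show "restrict (\<lambda>r. if r \<in> hole_rights then \<sigma> r else h r) (?R - hole_rights) = h"
      unfolding extensional_def restrict_def by fastforce
  qed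
  then show ?thesis by (rule bij_betw_same_card)
qed

text \<open>The functions g1 and g2 play the part of the columns of the inverse matrix belonging to
  the two sources, and the bracket is their minor at the two sinks. Both counts are absolute
  determinants, once with an empty and once with a two-element defect set.\<close>

lemma M_holey_hexagon_eq:
  fixes g1 g2 :: "point \<Rightarrow> real"
  assumes g1: "\<And>r. r \<in> right_cells a b \<Longrightarrow> (\<Sum>l\<in>{l \<in> left_cells a b. rhombic r l}. g1 l) = (if r = src_lo then 1 else 0)"
    and g2: "\<And>r. r \<in> right_cells a b \<Longrightarrow> (\<Sum>l\<in>{l \<in> left_cells a b. rhombic r l}. g2 l) = (if r = src_hi then 1 else 0)"
  shows "real (M (holey_hexagon a b k)) = real (M (hexagon a b)) * \<bar>g1 snk_lo * g2 snk_hi - g1 snk_hi * g2 snk_lo\<bar>"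
proof -
  let ?R = "right_cells a b" and ?L = "left_cells a b"
  define n where "n = card ?R"
  have n': "card ?L = n" using bij_betw_same_card[OF bij_betw_mirror_cells] n_def by metis
  have inj: "inj_on (key a b) ?R" "inj_on (key a b) ?L"
    by (rule inj_on_subset[OF inj_on_key]; blast)+
  obtain u where u: "bij_betw u {..<n} ?R" "\<And>i j. i < n \<Longrightarrow> j < n \<Longrightarrow> key a b (u i) < key a b (u j) \<longleftrightarrow> i < j"
    using ex_key_enumeration[OF finite_right_cells inj(1)] unfolding n_def by metis
  obtain v where v: "bij_betw v {..<n} ?L" "\<And>i j. i < n \<Longrightarrow> j < n \<Longrightarrow> key a b (v i) < key a b (v j) \<longleftrightarrow> i < j"
    using ex_key_enumeration[OF finite_left_cells inj(2)] unfolding n' by metis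
  define K where "K = Matrix.mat n n (\<lambda>(i, j). if rhombic (u i) (v j) then 1 else 0 :: real)"
  have hex: "real (M (hexagon a b)) = \<bar>Determinant.det K\<bar>"
    unfolding hexagon_eq_cells M_cells K_def
    by (rule card_matchings_eq_abs_det[where S = "{}", OF u v])
      (auto simp: sign_defect_def matching_off_def matchings_def)
  have mir: "mirror src_lo = snk_lo" "mirror src_hi = snk_hi" by (simp_all add: mirror_def)
  obtain j1 where j1: "j1 < n" "v j1 = snk_lo" using v(1) holes_mem(3) unfolding bij_betw_def by (metis imageE lessThan_iff)
  obtain j2 where j2: "j2 < n" "v j2 = snk_hi" using v(1) holes_mem(4) unfolding bij_betw_def by (metis imageE lessThan_iff)
  have vinj: "v j = v j' \<longleftrightarrow> j = j'" if "j < n" "j' < n" for j j'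
    using v(1) that unfolding bij_betw_def by (auto dest: inj_onD)
  have holey: "real (M (holey_hexagon a b k)) =
    \<bar>Determinant.det (Matrix.mat n n (\<lambda>(i, j). if holey_adj src_lo src_hi snk_lo snk_hi (u i) (v j) then 1 else 0 :: real))\<bar>"
    unfolding holey_hexagon_eq_cells[OF ak(4)] M_cells card_holey_matchings[symmetric]
  proof (rule card_matchings_eq_abs_det[where S = "{src_lo, src_hi}", OF u v])
    show "{src_lo, src_hi} \<subseteq> ?R" "mirror ` {src_lo, src_hi} \<subseteq> ?L" unfolding image_insert mir using holes_mem by auto
    show "sign_defect {src_lo, src_hi}" unfolding sign_defect_def by blast
    fix f assume f: "f \<in> matchings ?R ?L (holey_adj src_lo src_hi snk_lo snk_hi)"
    note H = holey_adj_matching[OF f]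
    have "bij_betw f ?R ?L" using f by (auto simp: matchings_def)
    then show "matching_off a b {src_lo, src_hi} f"
      unfolding matching_off_def using H(1,2,5) mir by simp
  qed
  have sum: "(\<Sum>j<n. K $$ (i, j) * g (v j)) = (\<Sum>l\<in>{l \<in> ?L. rhombic (u i) l}. g l)" if "i < n" for i and g :: "point \<Rightarrow> real"
  proof -
    have "(\<Sum>j<n. K $$ (i, j) * g (v j)) = (\<Sum>j<n. (\<lambda>l. if rhombic (u i) l then g l else 0) (v j))"
      using that by (intro sum.cong) (auto simp: K_def)
    also have "\<dots> = (\<Sum>l\<in>?L. if rhombic (u i) l then g l else 0)" by (rule sum.reindex_bij_betw[OF v(1)])
    also have "\<dots> = (\<Sum>l\<in>{l \<in> ?L. rhombic (u i) l}. g l)" by (rule sum.inter_filter[symmetric, OF finite_left_cells])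
    finally show ?thesis .
  qed
  have uR: "u i \<in> ?R" if "i < n" for i using u(1) that unfolding bij_betw_def by blast
  have "Determinant.det (Matrix.mat n n (\<lambda>(i, j). if j = j1 then (if u i = src_lo then 1 else 0)
      else if j = j2 then (if u i = src_hi then 1 else 0) else K $$ (i, j))) =
    Determinant.det K * (g1 (v j1) * g2 (v j2) - g1 (v j2) * g2 (v j1))"
    by (rule det_replace_two_columns)
       (use j1 j2 sum uR g1 g2 in \<open>auto simp: K_def\<close>)
  moreover have "Matrix.mat n n (\<lambda>(i, j). if j = j1 then (if u i = src_lo then 1 else 0)
      else if j = j2 then (if u i = src_hi then 1 else 0) else K $$ (i, j)) =
    Matrix.mat n n (\<lambda>(i, j). if holey_adj src_lo src_hi snk_lo snk_hi (u i) (v j) then 1 else 0 :: real)"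
  proof (rule Matrix.eq_matI, goal_cases)
    case (1 i j)
    then have ij: "i < n" "j < n" by simp_all
    have "v j = snk_lo \<longleftrightarrow> j = j1" "v j = snk_hi \<longleftrightarrow> j = j2" using vinj[OF ij(2) j1(1)] vinj[OF ij(2) j2(1)] j1 j2 by simp_all
    then show ?case using ij by (simp add: holey_adj_def K_def)
  qed simp_all
  ultimately show ?thesis unfolding holey hex j1 j2 by (simp add: abs_mult)
qed

end

section \<open>Discrete Chebyshev polynomials\<close>

text \<open>Neighbouring vertical lattice lines are offset by half an edge, that is by 1 in y. The
  difference of two neighbours on one line thus lives on the other line.\<close>

definition cdiff :: "(int \<Rightarrow> real) \<Rightarrow> int \<Rightarrow> real" where
  "cdiff f y = f (y + 1) - f (y - 1)"

abbreviation cdiffs :: "nat \<Rightarrow> (int \<Rightarrow> real) \<Rightarrow> int \<Rightarrow> real" where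
  "cdiffs m f \<equiv> (cdiff ^^ m) f"

lemma cdiffs_cdiffs: "n \<le> m \<Longrightarrow> cdiffs (m - n) (cdiffs n f) = cdiffs m f"
  using funpow_add[of "m - n" n cdiff] by simp

lemma cdiffs_Suc: "cdiffs (Suc m) f y = cdiffs m f (y + 1) - cdiffs m f (y - 1)"
  by (simp add: cdiff_def)

lemma cdiffs_add: "cdiffs m (\<lambda>y. f y + g y) = (\<lambda>y. cdiffs m f y + cdiffs m g y)"
  by (induction m) (simp_all add: cdiff_def fun_eq_iff)

lemma cdiffs_cmult: "cdiffs m (\<lambda>y. c * f y) = (\<lambda>y. c * cdiffs m f y)"
  by (induction m) (simp_all add: cdiff_def fun_eq_iff algebra_simps)

lemma cdiffs_diff: "cdiffs m (\<lambda>y. f y - g y) = (\<lambda>y. cdiffs m f y - cdiffs m g y)"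
  by (induction m) (simp_all add: cdiff_def fun_eq_iff)

lemma cdiffs_zero: "cdiffs m (\<lambda>y. 0) = (\<lambda>y. 0)"
  by (induction m) (simp_all add: cdiff_def fun_eq_iff)

lemma cdiffs_sum: "cdiffs m (\<lambda>y. \<Sum>i\<in>I. c i * f i y) = (\<lambda>y. \<Sum>i\<in>I. c i * cdiffs m (f i) y)"
  by (induction I rule: infinite_finite_induct) (simp_all add: cdiffs_zero cdiffs_add cdiffs_cmult)

lemma cdiffs_const: "0 < m \<Longrightarrow> cdiffs m (\<lambda>y. c) = (\<lambda>y. 0)"
proof (cases m)
  case (Suc n)
  have "cdiff (\<lambda>y. c) = (\<lambda>y. 0)" by (simp add: cdiff_def fun_eq_iff)
  then show ?thesis unfolding Suc funpow_Suc_right comp_def by (simp add: cdiffs_zero)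
qed simp

text \<open>Domain of dependence: the m-th difference at y reads only the points from y - m to y + m
  in steps of 2, which all have one parity.\<close>

lemma cdiffs_cong_interval:
  assumes "\<And>y. \<bar>y\<bar> \<le> B \<Longrightarrow> odd (y + p) \<Longrightarrow> f y = g y"
    and "\<bar>y\<bar> + int m \<le> B" "odd (y + p + int m)"
  shows "cdiffs m f y = cdiffs m g y"
  using assms(2,3)
proof (induction m arbitrary: y)
  case 0
  then show ?case using assms(1) by simp
next
  case (Suc m)
  have "cdiffs m f (y + 1) = cdiffs m g (y + 1)" "cdiffs m f (y - 1) = cdiffs m g (y - 1)"
    by (rule Suc.IH; use Suc.prems in auto)+
  then show ?case by (simp only: cdiffs_Suc)
qed

lemma cdiffs_eq_0_outside:
  assumes "\<And>y. B \<le> \<bar>y\<bar> \<Longrightarrow> f y = 0" "B + int m \<le> \<bar>y\<bar>"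
  shows "cdiffs m f y = 0"
  using assms(2)
proof (induction m arbitrary: y)
  case (Suc m)
  have "cdiffs m f (y + 1) = 0" "cdiffs m f (y - 1) = 0"
    by (rule Suc.IH; use Suc.prems in auto)+
  then show ?case by (simp only: cdiffs_Suc)
qed (use assms in auto)

lemma cdiffs_eq_0_parity:
  assumes "\<And>y. even (y + p) \<Longrightarrow> f y = 0" "even (y + p + int m)"
  shows "cdiffs m f y = 0"
  using assms(2)
proof (induction m arbitrary: y)
  case (Suc m)
  have "cdiffs m f (y + 1) = 0" "cdiffs m f (y - 1) = 0"
    by (rule Suc.IH; use Suc.prems in auto)+
  then show ?case by (simp only: cdiffs_Suc)
qed (use assms in auto)

lemma cdiffs_minus:
  assumes "\<And>y. f (- y) = f y"
  shows "cdiffs m f (- y) = (-1) ^ m * cdiffs m f y"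
proof (induction m arbitrary: y)
  case (Suc m)
  have eq: "- y + 1 = - (y - 1)" "- y - 1 = - (y + 1)" by simp_all
  show ?case by (simp only: cdiffs_Suc eq Suc.IH) (simp add: algebra_simps)
qed (use assms in auto)

text \<open>A function with vanishing \<open>cdiff\<close> is invariant under shifts by 2, and
  bounded support then makes it zero.\<close>

lemma cdiffs_eq_0D:
  assumes "\<And>y. B \<le> \<bar>y\<bar> \<Longrightarrow> f y = 0" "\<And>y. cdiffs m f y = 0"
  shows "f y = 0"
  using assms
proof (induction m arbitrary: f y B)
  case (Suc m)
  have "cdiff f z = 0" for z
  proof (rule Suc.IH[of "B + 1"])
    show "cdiff f y = 0" if "B + 1 \<le> \<bar>y\<bar>" for y
    proof -
      have "B \<le> \<bar>y + 1\<bar>" "B \<le> \<bar>y - 1\<bar>" using that by linarith+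
      then show ?thesis using Suc.prems(1) by (simp add: cdiff_def)
    qed
    show "cdiffs m (cdiff f) y = 0" for y
      using Suc.prems(2)[of y] unfolding funpow_Suc_right comp_def .
  qed
  then have step: "f z = f (z + 2)" for z
    using \<open>\<And>z. cdiff f z = 0\<close>[of "z + 1"] unfolding cdiff_def by (simp add: add.assoc)
  have "f y = f (y + 2 * int j)" for j
  proof (induction j)
    case (Suc j)
    then show ?case using step[of "y + 2 * int j"] by (simp add: algebra_simps)
  qed simp
  \<comment> \<open>This number of shifts carries y beyond the bound B.\<close>
  from this[of "nat (\<bar>B\<bar> + \<bar>y\<bar>)"] have "f y = f (y + 2 * (\<bar>B\<bar> + \<bar>y\<bar>))" by simp
  moreover have "B \<le> \<bar>y + 2 * (\<bar>B\<bar> + \<bar>y\<bar>)\<bar>"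
    using abs_ge_self[of B] abs_ge_minus_self[of y] abs_ge_zero[of B]
      abs_ge_self[of "y + 2 * (\<bar>B\<bar> + \<bar>y\<bar>)"] by (simp only: distrib_left) (rule order.trans, assumption, simp)
  ultimately show ?case using Suc.prems(1) by simp
qed simp

text \<open>Leibniz rule for the factor y: only the first difference of y, a constant, survives, and
  the central form averages the other factor over two neighbours.\<close>

lemma cdiffs_mult_id:
  "cdiffs (Suc m) (\<lambda>y. of_int y * g y) y =
    of_int y * cdiffs (Suc m) g y + real (Suc m) * (cdiffs m g (y + 1) + cdiffs m g (y - 1))"
proof (induction m arbitrary: y)
  case 0
  then show ?case by (simp add: cdiff_def algebra_simps)
next
  case (Suc m)
  show ?case
    by (simp only: cdiffs_Suc[of "Suc m"] Suc cdiffs_Suc[of m g "y + 1"] cdiffs_Suc[of m g "y - 1"])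
      (simp add: algebra_simps)
qed

text \<open>Multiplication by y raises the degree by one and multiplies the top difference by twice
  the new degree. Two such multiplications and the sign of the square give the constant.\<close>

lemma cdiffs_mult_quadratic:
  assumes G: "cdiffs (2 * n) G = (\<lambda>_. C)"
  shows "cdiffs (2 * Suc n) (\<lambda>y. (c - (of_int y)\<^sup>2) * G y) = (\<lambda>_. - 4 * (2 * real n + 2) * (2 * real n + 1) * C)"
proof
  fix y
  have G0: "cdiffs m G y = 0" if "2 * n < m" for m y
  proof -
    have "cdiffs m G = cdiffs (m - 2 * n) (cdiffs (2 * n) G)"
      using that by (simp only: cdiffs_cdiffs less_imp_le)
    then show ?thesis unfolding G using that cdiffs_const by simp
  qed
  let ?u = "\<lambda>y. of_int y * G y"
  have u1: "cdiffs (Suc (2 * n)) ?u y = (2 * real n + 1) * (2 * C)" for y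
    by (subst cdiffs_mult_id) (simp add: G0 G del: funpow.simps)
  then have u2: "cdiffs (Suc (Suc (2 * n))) ?u y = 0" for y
    by (subst cdiffs_Suc) (simp only: u1)
  have "cdiffs (Suc (Suc (2 * n))) (\<lambda>y. of_int y * ?u y) y = (2 * real n + 2) * (2 * ((2 * real n + 1) * (2 * C)))"
    by (subst cdiffs_mult_id) (simp only: u1 u2, simp)
  moreover have "(\<lambda>y. (c - (of_int y)\<^sup>2) * G y) = (\<lambda>y. c * G y - of_int y * ?u y)"
    by (auto simp: fun_eq_iff power2_eq_square algebra_simps)
  ultimately show "cdiffs (2 * Suc n) (\<lambda>y. (c - (of_int y)\<^sup>2) * G y) y = - 4 * (2 * real n + 2) * (2 * real n + 1) * C"
    using G0[of "Suc (Suc (2 * n))"] by (simp only: cdiffs_diff cdiffs_cmult mult_Suc_right add_2_eq_Suc)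
qed

text \<open>Differences with step 2 act on leading terms like twice the derivative, and the leading
  coefficient is \<open>(-1) ^ n\<close>.\<close>

lemma cdiffs_prod_quadratic:
  "cdiffs (2 * n) (\<lambda>y. \<Prod>i<n. c i - (of_int y)\<^sup>2) = (\<lambda>_. (-4) ^ n * fact (2 * n))"
proof (induction n)
  case (Suc n)
  have "(\<lambda>y. \<Prod>i<Suc n. c i - (of_int y)\<^sup>2) = (\<lambda>y. (c n - (of_int y)\<^sup>2) * (\<Prod>i<n. c i - (of_int y)\<^sup>2))"
    by (simp add: mult.commute)
  then show ?case
    by (simp only: cdiffs_mult_quadratic[OF Suc, of "c n"]) (simp add: fun_eq_iff algebra_simps)
qed simp

lemma sum_cdiff_by_parts:
  assumes "\<And>y. C \<le> \<bar>y\<bar> \<Longrightarrow> f y = 0" "0 \<le> C"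
  shows "(\<Sum>y\<in>{-C..C}. cdiff f y * g y) = - (\<Sum>y\<in>{-C..C}. f y * cdiff g y)"
proof -
  have "(\<Sum>y\<in>{-C..C}. f (y + 1) * g y) = (\<Sum>y\<in>{-C+1..C+1}. f y * g (y - 1))"
    by (rule sum.reindex_bij_witness[of _ "\<lambda>y. y - 1" "\<lambda>y. y + 1"]) auto
  also have "\<dots> = (\<Sum>y\<in>{-C..C+1}. f y * g (y - 1))"
    by (rule sum.mono_neutral_left) (use assms in auto)
  also have "\<dots> = (\<Sum>y\<in>{-C..C}. f y * g (y - 1))"
    by (rule sum.mono_neutral_right) (use assms in auto)
  finally have 1: "(\<Sum>y\<in>{-C..C}. f (y + 1) * g y) = (\<Sum>y\<in>{-C..C}. f y * g (y - 1))" .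
  have "(\<Sum>y\<in>{-C..C}. f (y - 1) * g y) = (\<Sum>y\<in>{-C-1..C-1}. f y * g (y + 1))"
    by (rule sum.reindex_bij_witness[of _ "\<lambda>y. y + 1" "\<lambda>y. y - 1"]) auto
  also have "\<dots> = (\<Sum>y\<in>{-C-1..C}. f y * g (y + 1))"
    by (rule sum.mono_neutral_left) (use assms in auto)
  also have "\<dots> = (\<Sum>y\<in>{-C..C}. f y * g (y + 1))"
    by (rule sum.mono_neutral_right) (use assms in auto)
  finally have 2: "(\<Sum>y\<in>{-C..C}. f (y - 1) * g y) = (\<Sum>y\<in>{-C..C}. f y * g (y + 1))" .
  show ?thesis using 1 2 by (simp add: cdiff_def algebra_simps sum.distrib sum_subtractf)
qed

lemma sum_cdiffs_by_parts:
  assumes "\<And>y i. i < m \<Longrightarrow> C \<le> \<bar>y\<bar> \<Longrightarrow> cdiffs i f y = 0" "0 \<le> C"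
  shows "(\<Sum>y\<in>{-C..C}. cdiffs m f y * g y) = (-1) ^ m * (\<Sum>y\<in>{-C..C}. f y * cdiffs m g y)"
  using assms(1)
proof (induction m arbitrary: g)
  case (Suc m)
  have "(\<Sum>y\<in>{-C..C}. cdiffs (Suc m) f y * g y) = - (\<Sum>y\<in>{-C..C}. cdiffs m f y * cdiff g y)"
    using sum_cdiff_by_parts[of C "cdiffs m f" g] Suc.prems assms(2) by simp
  also have "(\<Sum>y\<in>{-C..C}. cdiffs m f y * cdiff g y) = (-1) ^ m * (\<Sum>y\<in>{-C..C}. f y * cdiffs m (cdiff g) y)"
    by (rule Suc.IH) (use Suc.prems in auto)
  finally show ?case by (simp add: funpow_Suc_right del: funpow.simps)
qed simp

text \<open>The weight in Rodrigues' formula. Its zeros are the lattice points with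
  \<open>N - n < \<bar>y\<bar> < N + n\<close> on the line of abscissa n, so cutting it off outside
  \<open>\<bar>y\<bar> < N - n\<close> changes nothing up to
  \<open>\<bar>y\<bar> = N + n - 1\<close>.\<close>

definition rodr_poly :: "nat \<Rightarrow> nat \<Rightarrow> int \<Rightarrow> real" where
  "rodr_poly N n y = (\<Prod>i<n. (real N - real n + 1 + 2 * real i)\<^sup>2 - (of_int y)\<^sup>2)"

text \<open>\<open>rodr N n\<close> lives on the vertical line of abscissa \<open>n\<close>, its \<open>m\<close>-th difference on the line of abscissa \<open>n - m\<close>;
  the parity condition selects the lattice points.\<close>

definition rodr :: "nat \<Rightarrow> nat \<Rightarrow> int \<Rightarrow> real" where
  "rodr N n y = (if \<bar>y\<bar> + int n < int N \<and> odd (y + int N + int n) then rodr_poly N n y else 0)"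

lemma rodr_eq_rodr_poly:
  assumes "n < N" "\<bar>y\<bar> \<le> int N + int n - 1" "odd (y + (int N + int n))"
  shows "rodr N n y = rodr_poly N n y"
proof (cases "\<bar>y\<bar> + int n < int N")
  case True
  then show ?thesis using assms by (simp add: rodr_def add.assoc)
next
  case False
  obtain j where j: "\<bar>y\<bar> + int N + int n = 2 * j + 1"
  proof -
    have "odd (\<bar>y\<bar> + int N + int n)" using assms(3) by (auto simp: abs_if)
    then show ?thesis using that by (elim oddE) auto
  qed
  define i where "i = nat (j - int N)"
  have i: "\<bar>y\<bar> = int N - int n + 1 + 2 * int i" "i < n"
    using j False assms(1,2) by (auto simp: i_def)
  have "(real N - real n + 1 + 2 * real i)\<^sup>2 - (of_int y)\<^sup>2 = 0"
  proof -
    have "real N - real n + 1 + 2 * real i = of_int \<bar>y\<bar>" using i(1) by simp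
    then show ?thesis by (simp only: of_int_abs power2_abs)
  qed
  then have "rodr_poly N n y = 0" unfolding rodr_poly_def using i(2) by (intro prod_zero) auto
  then show ?thesis using False by (simp add: rodr_def)
qed

text \<open>As long as the domain of dependence stays below N + n, the cut-off is invisible.
  Polynomial arguments, such as vanishing beyond the degree, thus apply to the truncated function in
  this range.\<close>

lemma cdiffs_rodr_eq_poly:
  assumes "n < N" "\<bar>y\<bar> + int m < int N + int n" "odd (y + int N + int n + int m)"
  shows "cdiffs m (rodr N n) y = cdiffs m (rodr_poly N n) y"
  by (rule cdiffs_cong_interval[where B = "int N + int n - 1" and p = "int N + int n"])
     (use assms rodr_eq_rodr_poly in \<open>auto simp: add.assoc\<close>)

lemma cdiffs_rodr_outside:
  assumes "int N + int m \<le> \<bar>y\<bar> + int n"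
  shows "cdiffs m (rodr N n) y = 0"
  by (rule cdiffs_eq_0_outside[of "int N - int n"]) (use assms in \<open>auto simp: rodr_def\<close>)

lemma cdiffs_rodr_parity:
  assumes "even (y + int N + int n + int m)"
  shows "cdiffs m (rodr N n) y = 0"
  by (rule cdiffs_eq_0_parity[of "int N + int n"]) (use assms in \<open>auto simp: rodr_def add.assoc\<close>)

lemma cdiffs_rodr_minus: "cdiffs m (rodr N n) (- y) = (-1) ^ m * cdiffs m (rodr N n) y"
  by (rule cdiffs_minus) (auto simp: rodr_def rodr_poly_def)

lemma cdiffs_rodr_poly_top: "cdiffs (2 * n) (rodr_poly N n) = (\<lambda>_. (-4) ^ n * fact (2 * n))"
  unfolding rodr_poly_def[abs_def] by (rule cdiffs_prod_quadratic)

lemma cdiffs_rodr_poly_above: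
  assumes "2 * n < m" shows "cdiffs m (rodr_poly N n) y = 0"
proof -
  have "cdiffs m (rodr_poly N n) = cdiffs (m - 2 * n) (cdiffs (2 * n) (rodr_poly N n))"
    using assms by (simp only: cdiffs_cdiffs less_imp_le)
  then show ?thesis unfolding cdiffs_rodr_poly_top using assms cdiffs_const by simp
qed

section \<open>Orthogonality and norms on the central line\<close>

abbreviation cheb :: "nat \<Rightarrow> nat \<Rightarrow> int \<Rightarrow> real" where
  "cheb N n \<equiv> cdiffs n (rodr N n)"

text \<open>The n differences move from the first factor to the second by summation by parts; the
  compact support of \<open>rodr N n\<close> leaves no boundary terms, and on that support the
  second factor may be taken as a polynomial.\<close>

lemma sum_cheb_mult:
  assumes "n < N" "m < N"
  shows "(\<Sum>y\<in>{-int N..int N}. cheb N n y * cheb N m y) =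
     (-1) ^ n * (\<Sum>y\<in>{-int N..int N}. rodr N n y * cdiffs (n + m) (rodr_poly N m) y)"
proof -
  have "(\<Sum>y\<in>{-int N..int N}. cheb N n y * cheb N m y) =
      (\<Sum>y\<in>{-int N..int N}. cheb N n y * cdiffs m (rodr_poly N m) y)"
  proof (rule sum.cong, goal_cases)
    case (2 y)
    show ?case
    proof (cases "\<bar>y\<bar> < int N \<and> odd (y + int N)")
      case True
      then show ?thesis using cdiffs_rodr_eq_poly[OF assms(2), of y m] by (simp add: add.assoc)
    next
      case False
      then have "cheb N n y = 0"
        using cdiffs_rodr_outside[of N n y n] cdiffs_rodr_parity[of y N n n] by (auto simp: add.assoc)
      then show ?thesis by simp
    qed
  qed simp
  also have "\<dots> = (-1) ^ n * (\<Sum>y\<in>{-int N..int N}. rodr N n y * cdiffs n (cdiffs m (rodr_poly N m)) y)"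
    by (rule sum_cdiffs_by_parts) (auto intro: cdiffs_rodr_outside)
  also have "cdiffs n (cdiffs m (rodr_poly N m)) = cdiffs (n + m) (rodr_poly N m)"
    by (simp add: funpow_add)
  finally show ?thesis .
qed

text \<open>For m < n the differences of order n + m exceed the degree 2m of the polynomial.\<close>

lemma cheb_orthogonal:
  assumes "n < N" "m < N" "n \<noteq> m"
  shows "(\<Sum>y\<in>{-int N..int N}. cheb N n y * cheb N m y) = 0"
proof -
  have *: "(\<Sum>y\<in>{-int N..int N}. cheb N n y * cheb N m y) = 0" if "m < n" "n < N" for n m
    using that by (subst sum_cheb_mult) (auto simp: cdiffs_rodr_poly_above)
  show ?thesis
    using *[of m n] *[of n m] assms by (cases "m < n") (auto simp: mult.commute)
qed

text \<open>Both sides count the choices of n + l + 1 among the numbers 0 to m, sorted on the left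
  by the (n + 1)-st smallest element i. The induction uses Pascal's rule.\<close>

lemma sum_choose_mult_choose:
  "(\<Sum>i\<le>m. (i choose n) * ((m - i) choose l)) = (Suc m) choose (Suc (n + l))"
proof (induction m arbitrary: l)
  case 0
  then show ?case by (cases n; cases l) auto
next
  case (Suc m)
  show ?case
  proof (cases l)
    case 0
    have "(\<Sum>i\<le>Suc m. i choose n) = Suc (Suc m) choose Suc n"
      by (rule sum_choose_upper)
    then show ?thesis using 0 by (simp del: binomial_Suc_Suc sum.atMost_Suc)
  next
    case [simp]: (Suc l')
    have "(\<Sum>i\<le>Suc m. (i choose n) * ((Suc m - i) choose l)) = (\<Sum>i\<le>m. (i choose n) * (Suc (m - i) choose Suc l'))"
      by (simp add: Suc_diff_le)
    also have "\<dots> = (\<Sum>i\<le>m. (i choose n) * ((m - i) choose l')) + (\<Sum>i\<le>m. (i choose n) * ((m - i) choose l))"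
      by (simp add: algebra_simps sum.distrib)
    also have "\<dots> = (Suc m choose Suc (n + l')) + (Suc m choose Suc (n + l))" by (simp only: Suc.IH)
    finally show ?thesis by (simp add: algebra_simps)
  qed
qed

lemma prod_shift_eq_choose: "(\<Prod>l<n. real i + 1 + real l) = fact n * real ((i + n) choose n)"
proof (induction n)
  case (Suc n)
  have "real (Suc (i + n)) * real ((i + n) choose n) = real (Suc (i + n) choose Suc n) * real (Suc n)"
    using Suc_times_binomial_eq[of "i + n" n] by (metis of_nat_mult)
  then show ?case using Suc by (simp add: algebra_simps del: binomial_Suc_Suc)
qed simp

lemma rodr_eq_choose:
  assumes "i + n < N"
  shows "rodr N n (int N - int n - 1 - 2 * int i) = 4 ^ n * (fact n)\<^sup>2 * real ((i + n) choose n) * real ((N - 1 - i) choose n)"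
proof -
  let ?y = "int N - int n - 1 - 2 * int i"
  obtain j where j: "N = i + n + 1 + j" using assms by (metis Suc_eq_plus1 add.commute add_Suc_right less_iff_Suc_add)
  have "rodr N n ?y = rodr_poly N n ?y" unfolding rodr_def using j by auto
  also have "\<dots> = (\<Prod>l<n. 4 * ((real i + 1 + real l) * (real j + 1 + real l)))"
    unfolding rodr_poly_def by (rule prod.cong) (simp_all add: j power2_eq_square algebra_simps)
  also have "\<dots> = 4 ^ n * ((fact n * real ((i + n) choose n)) * (fact n * real ((j + n) choose n)))"
    by (simp only: prod.distrib prod_shift_eq_choose prod_constant card_lessThan)
  also have "j + n = N - 1 - i" using j by simp
  finally show ?thesis by (simp add: power2_eq_square)
qed

text \<open>At the lattice points the weight is a product of two binomial coefficients, so its sum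
  is a Vandermonde-type convolution. It enters the squared norm because the top difference of the
  polynomial is constant.\<close>

lemma sum_rodr:
  assumes "n < N"
  shows "(\<Sum>y\<in>{-int N..int N}. rodr N n y) = 4 ^ n * (fact n)\<^sup>2 * real ((N + n) choose (2 * n + 1))"
proof -
  have "(\<Sum>y\<in>{-int N..int N}. rodr N n y) = (\<Sum>y\<in>{y. \<bar>y\<bar> + int n < int N \<and> odd (y + int N + int n)}. rodr N n y)"
    by (rule sum.mono_neutral_right) (auto simp: rodr_def)
  also have "\<dots> = (\<Sum>i<N - n. rodr N n (int N - int n - 1 - 2 * int i))"
  proof -
    have inv: "int N - int n - 1 - 2 * int (nat ((int N - int n - 1 - y) div 2)) = y"
      if "\<bar>y\<bar> + int n < int N" "odd (y + int N + int n)" for y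
    proof -
      have "even (int N - int n - 1 - y)" "0 \<le> int N - int n - 1 - y" using that by auto
      then show ?thesis by auto
    qed
    show ?thesis
    proof (rule sum.reindex_bij_witness[of _ "\<lambda>i. int N - int n - 1 - 2 * int i" "\<lambda>y. nat ((int N - int n - 1 - y) div 2)"], goal_cases)
      case (1 y)
      then show ?case using inv by simp
    next
      case (2 y)
      then have "0 \<le> int N - int n - 1 - y" "int N - int n - 1 - y < 2 * (int N - int n)" by auto
      then show ?case using assms by auto
    next
      case (5 y)
      then show ?case using inv[of y] by simp
    qed (use assms in auto)
  qed
  also have "\<dots> = (\<Sum>i<N - n. 4 ^ n * (fact n)\<^sup>2 * real (((i + n) choose n) * ((N - 1 - i) choose n)))"
    by (rule sum.cong) (auto simp: rodr_eq_choose)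
  also have "\<dots> = 4 ^ n * (fact n)\<^sup>2 * real (\<Sum>i<N - n. ((i + n) choose n) * ((N - 1 - i) choose n))"
    by (simp add: sum_distrib_left)
  also have "(\<Sum>i<N - n. ((i + n) choose n) * ((N - 1 - i) choose n)) = (\<Sum>j\<in>{n..<N}. (j choose n) * ((N + n - 1 - j) choose n))"
    by (rule sum.reindex_bij_witness[of _ "\<lambda>j. j - n" "\<lambda>i. i + n"]) auto
  \<comment> \<open>The additional terms vanish since one of their binomial coefficients has too
    small an upper index.\<close>
  also have "\<dots> = (\<Sum>j\<le>N + n - 1. (j choose n) * ((N + n - 1 - j) choose n))"
  proof (rule sum.mono_neutral_left)
    show "\<forall>j\<in>{..N + n - 1} - {n..<N}. (j choose n) * ((N + n - 1 - j) choose n) = 0"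
    proof
      fix j assume "j \<in> {..N + n - 1} - {n..<N}"
      then have "j < n \<or> N + n - 1 - j < n" using assms by auto
      then show "(j choose n) * ((N + n - 1 - j) choose n) = 0" by auto
    qed
  qed (use assms in auto)
  also have "\<dots> = (N + n) choose (2 * n + 1)"
    using sum_choose_mult_choose[of n "N + n - 1" n] assms by (simp add: mult_2)
  finally show ?thesis .
qed

definition cheb_norm :: "nat \<Rightarrow> nat \<Rightarrow> real" where
  "cheb_norm N n = 16 ^ n * fact (2 * n) * (fact n)\<^sup>2 * real ((N + n) choose (2 * n + 1))"

lemma cheb_norm_pos: "n < N \<Longrightarrow> 0 < cheb_norm N n"
  unfolding cheb_norm_def by simp

lemma sum_cheb_square:
  assumes "n < N"
  shows "(\<Sum>y\<in>{-int N..int N}. cheb N n y * cheb N n y) = cheb_norm N n"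
proof -
  have "(\<Sum>y\<in>{-int N..int N}. cheb N n y * cheb N n y) =
      (-1) ^ n * ((-4) ^ n * fact (2 * n) * (\<Sum>y\<in>{-int N..int N}. rodr N n y))"
    unfolding sum_cheb_mult[OF assms assms] mult_2[symmetric] cdiffs_rodr_poly_top
    by (simp add: sum_distrib_left sum_distrib_right mult_ac)
  also have "\<dots> = cheb_norm N n"
    unfolding sum_rodr[OF assms] cheb_norm_def
    by (simp add: power_mult_distrib[symmetric] mult.assoc[symmetric])
  finally show ?thesis .
qed

section \<open>Inverting the Kasteleyn matrix\<close>

lemma sum_cheb_nodes:
  "(\<Sum>y\<in>{-int N..int N}. cheb N n y * cheb N m y) = (\<Sum>i<N. cheb N n (int N - 1 - 2 * int i) * cheb N m (int N - 1 - 2 * int i))"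
proof -
  have z: "cheb N n y = 0" if "y \<notin> (\<lambda>i. int N - 1 - 2 * int i) ` {..<N}" for y
  proof (cases "\<bar>y\<bar> < int N \<and> odd (y + int N)")
    case True
    then have "even (int N - 1 - y)" "0 \<le> int N - 1 - y" "int N - 1 - y < 2 * int N" by auto
    moreover from this obtain j where "int N - 1 - y = 2 * j" by (elim evenE)
    ultimately have j: "int N - 1 - y = 2 * j" "0 \<le> j" "j < int N" by linarith+
    then have "y = int N - 1 - 2 * int (nat j)" "nat j < N" by auto
    then show ?thesis using that by blast
  next
    case False
    then show ?thesis using cdiffs_rodr_outside[of N n y n] cdiffs_rodr_parity[of y N n n] by (auto simp: add.assoc)
  qed
  have "(\<Sum>y\<in>{-int N..int N}. cheb N n y * cheb N m y) = (\<Sum>y\<in>(\<lambda>i. int N - 1 - 2 * int i) ` {..<N}. cheb N n y * cheb N m y)"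
    by (rule sum.mono_neutral_right) (use z in auto)
  also have "\<dots> = (\<Sum>i<N. cheb N n (int N - 1 - 2 * int i) * cheb N m (int N - 1 - 2 * int i))"
    by (subst sum.reindex) (auto simp: inj_on_def)
  finally show ?thesis .
qed

text \<open>There are N orthogonal functions on N nodes, so orthogonality says that a square matrix
  has a one-sided inverse; the other side of the inverse is completeness.\<close>

lemma cheb_complete_nodes:
  assumes "i < N" "j < N"
  shows "(\<Sum>n<N. cheb N n (int N - 1 - 2 * int i) * cheb N n (int N - 1 - 2 * int j) / cheb_norm N n) = (if i = j then 1 else 0)"
proof -
  let ?p = "\<lambda>i. int N - 1 - 2 * int i"
  define A where "A = Matrix.mat N N (\<lambda>(n, i). cheb N n (?p i))"
  define B where "B = Matrix.mat N N (\<lambda>(i, m). cheb N m (?p i) / cheb_norm N m)"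
  have AB: "A \<in> carrier_mat N N" "B \<in> carrier_mat N N" by (simp_all add: A_def B_def)
  have "A * B = 1\<^sub>m N"
  proof (rule Matrix.eq_matI, goal_cases)
    case (1 n m)
    then have nm: "n < N" "m < N" by simp_all
    have "(A * B) $$ (n, m) = (\<Sum>i<N. cheb N n (?p i) * cheb N m (?p i)) / cheb_norm N m"
      using nm by (simp add: A_def B_def scalar_prod_def atLeast0LessThan sum_divide_distrib)
    also have "\<dots> = (if n = m then 1 else 0)"
      unfolding sum_cheb_nodes[symmetric]
      using sum_cheb_square[OF nm(1)] cheb_orthogonal[OF nm] cheb_norm_pos[OF nm(1)] by auto
    finally show ?case using nm by simp
  qed (simp_all add: A_def B_def)
  then have "B * A = 1\<^sub>m N" using mat_mult_left_right_inverse[OF AB] by simp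
  then have "(B * A) $$ (i, j) = (if i = j then 1 else 0)" using assms by simp
  moreover have "(B * A) $$ (i, j) = (\<Sum>n<N. cheb N n (?p i) * cheb N n (?p j) / cheb_norm N n)"
    using assms by (simp add: A_def B_def scalar_prod_def atLeast0LessThan)
  ultimately show ?thesis by simp
qed

lemma cheb_complete:
  assumes "\<bar>y\<bar> < int N" "odd (y + int N)"
  shows "(\<Sum>n<N. cheb N n y * cheb N n z / cheb_norm N n) = (if y = z then 1 else 0)"
proof -
  have node: "\<exists>i<N. y = int N - 1 - 2 * int i" if "\<bar>y\<bar> < int N" "odd (y + int N)" for y
  proof -
    from that have "even (int N - 1 - y)" "0 \<le> int N - 1 - y" "int N - 1 - y < 2 * int N" by auto
    moreover from this obtain j where "int N - 1 - y = 2 * j" by (elim evenE)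
    ultimately have j: "int N - 1 - y = 2 * j" "0 \<le> j" "j < int N" by linarith+
    then show ?thesis by (intro exI[of _ "nat j"]) auto
  qed
  obtain i where i: "i < N" "y = int N - 1 - 2 * int i" using node assms by blast
  show ?thesis
  proof (cases "\<bar>z\<bar> < int N \<and> odd (z + int N)")
    case True
    then obtain j where j: "j < N" "z = int N - 1 - 2 * int j" using node by blast
    show ?thesis using cheb_complete_nodes[OF i(1) j(1)] unfolding i(2) j(2) by auto
  next
    case False
    then have "cheb N n z = 0" for n
      using cdiffs_rodr_outside[of N n z n] cdiffs_rodr_parity[of z N n n] by (auto simp: add.assoc)
    then show ?thesis using False assms by auto
  qed
qed

section \<open>Point masses and the condition on the left side\<close>

abbreviation point_mass :: "int \<Rightarrow> int \<Rightarrow> real" where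
  "point_mass z \<equiv> (\<lambda>y. if y = z then 1 else 0)"

lemma cdiffs_point_mass_shift: "cdiffs j (point_mass (z + 1)) y = cdiffs j (point_mass z) (y - 1)"
proof (induction j arbitrary: y)
  case (Suc j)
  show ?case by (simp only: cdiffs_Suc Suc) (simp add: algebra_simps)
qed auto

text \<open>The point mass depends on y - z only, so a difference in the source z is minus a
  difference in the argument y.\<close>

lemma cdiffs_point_mass_source:
  "cdiffs j (\<lambda>z. cdiffs i (point_mass z) y) z = (-1) ^ j * cdiffs (i + j) (point_mass z) y"
proof (induction j arbitrary: z)
  case (Suc j)
  have "cdiffs m (point_mass (z + 1)) y - cdiffs m (point_mass (z - 1)) y = - cdiffs (Suc m) (point_mass z) y" for m
    using cdiffs_point_mass_shift[of m z y] cdiffs_point_mass_shift[of m "z - 1" "y + 1"] by (simp add: cdiff_def)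
  note step = this[of "i + j"]
  have "cdiffs (Suc j) (\<lambda>z. cdiffs i (point_mass z) y) z =
      (-1) ^ j * (cdiffs (i + j) (point_mass (z + 1)) y - cdiffs (i + j) (point_mass (z - 1)) y)"
    by (simp only: cdiffs_Suc[of j] Suc right_diff_distrib)
  then show ?case unfolding step by (simp del: funpow.simps)
qed simp

lemma cdiffs_point_mass_outside: "int i < \<bar>y - z\<bar> \<Longrightarrow> cdiffs i (point_mass z) y = 0"
proof (induction i arbitrary: y)
  case (Suc i)
  have "cdiffs i (point_mass z) (y + 1) = 0" "cdiffs i (point_mass z) (y - 1) = 0"
    by (rule Suc.IH; use Suc.prems in linarith)+
  then show ?case by (simp only: cdiffs_Suc)
qed auto

text \<open>Completeness on the central line, differenced a times so that it lives on the line x =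
  -a. The modes with n < a drop out because n + a exceeds the degree 2n.\<close>

lemma cheb_complete_diff:
  assumes "a < N" "\<bar>y\<bar> + int a < int N" "odd (y + int N + int a)"
  shows "(\<Sum>n\<in>{a..<N}. cdiffs (n + a) (rodr N n) y / cheb_norm N n * cheb N n z) = cdiffs a (point_mass z) y"
proof -
  have "cdiffs a (point_mass z) y = cdiffs a (\<lambda>y. \<Sum>n\<in>{..<N}. cheb N n z / cheb_norm N n * cheb N n y) y"
  proof (rule cdiffs_cong_interval[of "int N - 1" "int N"])
    fix w assume "\<bar>w\<bar> \<le> int N - 1" "odd (w + int N)"
    then show "point_mass z w = (\<Sum>n\<in>{..<N}. cheb N n z / cheb_norm N n * cheb N n w)"
      using cheb_complete[of w N z] by (simp add: mult.commute)
  qed (use assms in auto)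
  also have "\<dots> = (\<Sum>n\<in>{..<N}. cheb N n z / cheb_norm N n * cdiffs (n + a) (rodr N n) y)"
    unfolding cdiffs_sum by (simp add: funpow_add[symmetric] add.commute flip: funpow_add[THEN fun_cong, unfolded comp_def])
  also have "\<dots> = (\<Sum>n\<in>{a..<N}. cheb N n z / cheb_norm N n * cdiffs (n + a) (rodr N n) y)"
  proof (rule sum.mono_neutral_right)
    show "\<forall>n\<in>{..<N} - {a..<N}. cheb N n z / cheb_norm N n * cdiffs (n + a) (rodr N n) y = 0"
    proof
      fix n assume "n \<in> {..<N} - {a..<N}"
      then have n: "n < a" "n < N" by auto
      have "cdiffs (n + a) (rodr N n) y = cdiffs (n + a) (rodr_poly N n) y"
        by (rule cdiffs_rodr_eq_poly) (use assms n in auto)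
      then show "cheb N n z / cheb_norm N n * cdiffs (n + a) (rodr N n) y = 0"
        using cdiffs_rodr_poly_above[of n "n + a"] n by simp
    qed
  qed auto
  finally show ?thesis by (simp add: mult.commute)
qed

text \<open>As functions of z, both sides have the k-th difference evaluated in
  \<open>cheb_complete_diff\<close>, and both have bounded support, on which differences are
  injective. The sign comes from exchanging source and argument k times.\<close>

lemma cheb_kernel_boundary:
  assumes "k \<le> a" "a < N" "\<bar>y\<bar> + int a < int N" "odd (y + int N + int a)"
  shows "(\<Sum>n\<in>{a..<N}. cdiffs (n + a) (rodr N n) y / cheb_norm N n * cdiffs (n - k) (rodr N n) z) =
    (-1) ^ k * cdiffs (a - k) (point_mass z) y"
proof -
  define G where "G = (\<lambda>z. \<Sum>n\<in>{a..<N}. cdiffs (n + a) (rodr N n) y / cheb_norm N n * cdiffs (n - k) (rodr N n) z)"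
  define H where "H = (\<lambda>z. (-1) ^ k * cdiffs (a - k) (point_mass z) y)"
  have "cdiffs k G z = cdiffs a (point_mass z) y" for z
  proof -
    have "cdiffs k G z = (\<Sum>n\<in>{a..<N}. cdiffs (n + a) (rodr N n) y / cheb_norm N n * cdiffs k (cdiffs (n - k) (rodr N n)) z)"
      unfolding G_def by (simp only: cdiffs_sum)
    also have "\<dots> = (\<Sum>n\<in>{a..<N}. cdiffs (n + a) (rodr N n) y / cheb_norm N n * cheb N n z)"
    proof (rule sum.cong, simp)
      fix n assume n: "n \<in> {a..<N}"
      then have "cdiffs k (cdiffs (n - k) (rodr N n)) = cheb N n"
        using cdiffs_cdiffs[of "n - k" n "rodr N n"] assms(1) by simp
      then show "cdiffs (n + a) (rodr N n) y / cheb_norm N n * cdiffs k (cdiffs (n - k) (rodr N n)) z =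
         cdiffs (n + a) (rodr N n) y / cheb_norm N n * cheb N n z" by simp
    qed
    finally show ?thesis using cheb_complete_diff[OF assms(2-4)] by simp
  qed
  moreover have "cdiffs k H z = cdiffs a (point_mass z) y" for z
    unfolding H_def cdiffs_cmult cdiffs_point_mass_source using assms(1)
    by (simp flip: power_add mult.assoc)
  ultimately have d: "cdiffs k (\<lambda>z. G z - H z) z = 0" for z by (simp only: cdiffs_diff)
  have "G z - H z = 0"
  proof (rule cdiffs_eq_0D[of "int N + \<bar>y\<bar> + int a + 1", OF _ d])
    fix z assume z: "int N + \<bar>y\<bar> + int a + 1 \<le> \<bar>z\<bar>"
    have "cdiffs (n - k) (rodr N n) z = 0" if "n \<in> {a..<N}" for n
      by (rule cdiffs_rodr_outside) (use that z in auto)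
    moreover have "cdiffs (a - k) (point_mass z) y = 0"
      by (rule cdiffs_point_mass_outside) (use z in linarith)
    ultimately show "G z - H z = 0" by (simp add: G_def H_def)
  qed
  then show ?thesis by (simp add: G_def H_def)
qed

text \<open>Up to the gauge factor \<open>half_sign\<close>, which turns the sum over the three neighbours of a right cell into
  the difference operator, \<open>green a N k z\<close> is a function on the left cells whose neighbour sums vanish
  at all right cells except \<open>(- k, z)\<close>.\<close>

definition half_sign :: "int \<Rightarrow> real" where
  "half_sign t = (if even (t div 2) then 1 else -1)"

text \<open>The second summand is the point mass at column -k, pushed to the left by differences; it
  produces the right-hand side. The sum over modes solves the homogeneous equation, vanishes beyond
  the right boundary and, with the sign \<open>(-1) ^ Suc k\<close>, cancels the second summand on
  the line x = -a. Since \<open>x \<le> a \<le> n\<close> on the hexagon, \<open>nat\<close>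
  truncates nothing there.\<close>

definition kernel_sum :: "nat \<Rightarrow> nat \<Rightarrow> nat \<Rightarrow> int \<Rightarrow> point \<Rightarrow> real" where
  "kernel_sum a N k z = (\<lambda>(x, y). (-1) ^ Suc k *
     (\<Sum>n\<in>{a..<N}. cdiffs (nat (int n - x)) (rodr N n) y / cheb_norm N n * cdiffs (n - k) (rodr N n) z) +
     (if x \<le> - int k then cdiffs (nat (- int k - x)) (point_mass z) y else 0))"

definition green :: "nat \<Rightarrow> nat \<Rightarrow> nat \<Rightarrow> int \<Rightarrow> point \<Rightarrow> real" where
  "green a N k z = (\<lambda>(x, y). half_sign (- int k + z + int N - 1) * half_sign (x + y + int N - 1) * kernel_sum a N k z (x, y))"

lemma half_sign_step: "half_sign (x + 2) = - half_sign x"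
  by (simp add: half_sign_def)

lemma half_sign_square: "half_sign x * half_sign x = 1"
  by (simp add: half_sign_def)

lemma kernel_sum_step:
  assumes "x < int a"
  shows "kernel_sum a N k z (x, y) = kernel_sum a N k z (x + 1, y + 1) - kernel_sum a N k z (x + 1, y - 1) +
    (if x = - int k \<and> y = z then 1 else 0)"
proof -
  have n: "cdiffs (nat (int n - x)) f y = cdiffs (nat (int n - (x + 1))) f (y + 1) - cdiffs (nat (int n - (x + 1))) f (y - 1)"
    if "n \<in> {a..<N}" for n and f
  proof -
    have "nat (int n - x) = Suc (nat (int n - (x + 1)))" using that assms by auto
    then show ?thesis by (simp only: cdiffs_Suc)
  qed
  have s: "(if x \<le> - int k then cdiffs (nat (- int k - x)) (point_mass z) y else 0) =
     (if x + 1 \<le> - int k then cdiffs (nat (- int k - (x + 1))) (point_mass z) (y + 1) else 0) -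
     (if x + 1 \<le> - int k then cdiffs (nat (- int k - (x + 1))) (point_mass z) (y - 1) else 0) +
     (if x = - int k \<and> y = z then 1 else 0)"
  proof (cases "x + 1 \<le> - int k")
    case True
    then have "nat (- int k - x) = Suc (nat (- int k - (x + 1)))" by auto
    then show ?thesis using True by (simp only: cdiffs_Suc) simp
  next
    case False
    then show ?thesis by auto
  qed
  have "(\<Sum>n\<in>{a..<N}. cdiffs (nat (int n - x)) (rodr N n) y / cheb_norm N n * cdiffs (n - k) (rodr N n) z) =
     (\<Sum>n\<in>{a..<N}. cdiffs (nat (int n - (x + 1))) (rodr N n) (y + 1) / cheb_norm N n * cdiffs (n - k) (rodr N n) z) -
     (\<Sum>n\<in>{a..<N}. cdiffs (nat (int n - (x + 1))) (rodr N n) (y - 1) / cheb_norm N n * cdiffs (n - k) (rodr N n) z)"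
    unfolding sum_subtractf[symmetric]
    by (rule sum.cong) (simp_all only: n, simp add: diff_divide_distrib left_diff_distrib)
  then show ?thesis unfolding kernel_sum_def prod.case s by (simp only:) (simp add: algebra_simps)
qed

lemma kernel_sum_right_boundary:
  assumes "0 < x" "x \<le> int a" "int N \<le> x + \<bar>y\<bar>"
  shows "kernel_sum a N k z (x, y) = 0"
proof -
  have "cdiffs (nat (int n - x)) (rodr N n) y = 0" if "n \<in> {a..<N}" for n
    by (rule cdiffs_rodr_outside) (use that assms in auto)
  then show ?thesis using assms unfolding kernel_sum_def by simp
qed

lemma kernel_sum_left_boundary:
  assumes "k \<le> a" "a < N" "\<bar>y\<bar> + int a < int N" "odd (y + int N + int a)"
  shows "kernel_sum a N k z (- int a, y) = 0"
proof -
  have n: "nat (int n - - int a) = n + a" for n by simp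
  have k: "nat (- int k - - int a) = a - k" using assms(1) by auto
  show ?thesis
    unfolding kernel_sum_def prod.case n k cheb_kernel_boundary[OF assms] using assms(1)
    by (simp flip: power_add mult.assoc)
qed

lemma sum_rhombic:
  "(\<Sum>l\<in>{l \<in> L. rhombic (x, y) l}. g l) =
    (if (x, y) \<in> L then g (x, y) else 0) + (if (x + 1, y + 1) \<in> L then g (x + 1, y + 1) else 0) +
    (if (x + 1, y - 1) \<in> L then g (x + 1, y - 1) else (0 :: real))"
proof -
  have "{l \<in> L. rhombic (x, y) l} = {l \<in> {(x, y), (x + 1, y + 1), (x + 1, y - 1)}. l \<in> L}"
    unfolding rhombic_def fst_conv snd_conv by blast
  then have "(\<Sum>l\<in>{l \<in> L. rhombic (x, y) l}. g l) = (\<Sum>l\<in>{(x, y), (x + 1, y + 1), (x + 1, y - 1)}. if l \<in> L then g l else 0)"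
    by (simp only: sum.inter_filter finite.intros)
  then show ?thesis by simp
qed

text \<open>Cells missing from the hexagon are harmless: \<open>kernel_sum\<close> vanishes wherever
  a neighbour lies outside. So the three-term equation of \<open>kernel_sum_step\<close> holds at
  every right cell, the gauge factors accounting for its signs.\<close>

lemma green_equation:
  assumes "k \<le> a" "0 < b" "r \<in> right_cells a b" "odd (- int k + z + int (a + b))"
  shows "(\<Sum>l\<in>{l \<in> left_cells a b. rhombic r l}. green a (a + b) k z l) = (if r = (- int k, z) then 1 else 0)"
proof -
  obtain x y where r: "r = (x, y)" by (cases r)
  let ?N = "a + b"
  let ?V = "kernel_sum a ?N k z"
  let ?src = "half_sign (- int k + z + int ?N - 1)" and ?s = "half_sign (x + y + int ?N - 1)"
  have xy: "- int a \<le> x" "x < int a" "\<bar>x\<bar> + \<bar>y\<bar> < int a + int b" "odd (x + y + int a + int b)"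
    using assms(3) unfolding r right_cells_def by auto
  have s: "half_sign ((x + 1) + (y + 1) + int ?N - 1) = - ?s" "half_sign ((x + 1) + (y - 1) + int ?N - 1) = ?s"
    using half_sign_step[of "x + y + int ?N - 1"] by (simp_all add: algebra_simps)
  have 1: "(if (x, y) \<in> left_cells a b then green a ?N k z (x, y) else 0) = ?src * ?s * ?V (x, y)"
  proof (cases "x = - int a")
    case True
    have "?V (- int a, y) = 0"
    proof (rule kernel_sum_left_boundary)
      show "\<bar>y\<bar> + int a < int ?N" using xy(3) True by simp
      have "odd (- int a + y + int a + int b)" using xy(4) True by simp
      then show "odd (y + int ?N + int a)" by simp
    qed (use assms in auto)
    then show ?thesis using True by (simp add: left_cells_def)
  next
    case False
    then have "(x, y) \<in> left_cells a b" using xy unfolding left_cells_def by auto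
    then show ?thesis by (simp add: green_def)
  qed
  have 2: "(if (x + 1, y') \<in> left_cells a b then green a ?N k z (x + 1, y') else 0) =
      ?src * half_sign ((x + 1) + y' + int ?N - 1) * ?V (x + 1, y')" if y': "y' = y + 1 \<or> y' = y - 1" for y'
  proof (cases "\<bar>x + 1\<bar> + \<bar>y'\<bar> < int a + int b")
    case True
    then have "(x + 1, y') \<in> left_cells a b" using xy y' unfolding left_cells_def by auto
    then show ?thesis by (simp add: green_def)
  next
    case False
    \<comment> \<open>Up to the central line a step to the right lowers \<open>\<bar>x\<bar>\<close>
      by one, so the neighbours remain inside; only the right half can lose one.\<close>
    have "\<bar>y'\<bar> \<le> \<bar>y\<bar> + 1" using y' by auto
    moreover have "\<bar>x + 1\<bar> = \<bar>x\<bar> - 1" if "x + 1 \<le> 0" using that by auto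
    ultimately have "0 < x + 1" using False xy(3) by linarith
    then have "?V (x + 1, y') = 0" by (intro kernel_sum_right_boundary) (use False xy in auto)
    moreover have "(x + 1, y') \<notin> left_cells a b" using False unfolding left_cells_def by auto
    ultimately show ?thesis by simp
  qed
  have "(\<Sum>l\<in>{l \<in> left_cells a b. rhombic r l}. green a ?N k z l) =
      ?src * ?s * (?V (x, y) - ?V (x + 1, y + 1) + ?V (x + 1, y - 1))"
    unfolding r sum_rhombic 1 2[OF disjI1[OF refl]] 2[OF disjI2[OF refl]] s by (simp add: algebra_simps)
  also have "\<dots> = (if r = (- int k, z) then ?src * ?s else 0)"
    unfolding kernel_sum_step[OF xy(2)] r by simp
  also have "\<dots> = (if r = (- int k, z) then 1 else 0)"
    using half_sign_square unfolding r by auto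
  finally show ?thesis .
qed

text \<open>On the line x = k the mode n is even or odd in y according to the parity of n - k. With
  E and O the two halves of the sum at height 1, equal and opposite heights give E + O and E - O;
  the minor is 4 E O, and each kernel takes one factor 2.\<close>

definition even_kernel :: "nat \<Rightarrow> nat \<Rightarrow> nat \<Rightarrow> real" where
  "even_kernel a N k = (\<Sum>n\<in>{n \<in> {a..<N}. even (n - k)}. 2 * (cdiffs (n - k) (rodr N n) 1)\<^sup>2 / cheb_norm N n)"

definition odd_kernel :: "nat \<Rightarrow> nat \<Rightarrow> nat \<Rightarrow> real" where
  "odd_kernel a N k = (\<Sum>n\<in>{n \<in> {a..<N}. odd (n - k)}. 2 * (cdiffs (n - k) (rodr N n) 1)\<^sup>2 / cheb_norm N n)"

lemma M_holey_hexagon: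
  assumes "2 \<le> a" "k \<le> a" "k + 2 \<le> a + b" "0 < b" "even (a + b + k)"
  shows "real (M (holey_hexagon a b k)) = real (M (hexagon a b)) *
    \<bar>(even_kernel a (a + b) k - of_bool (k = 0)) * (odd_kernel a (a + b) k - of_bool (k = 0))\<bar>"
proof -
  let ?N = "a + b"
  define q where "q = (\<lambda>n. cdiffs (n - k) (rodr ?N n) 1)"
  define E where "E = (\<Sum>n\<in>{n \<in> {a..<?N}. even (n - k)}. (q n)\<^sup>2 / cheb_norm ?N n)"
  define Od where "Od = (\<Sum>n\<in>{n \<in> {a..<?N}. odd (n - k)}. (q n)\<^sup>2 / cheb_norm ?N n)"
  have eo: "even_kernel a ?N k = 2 * E" "odd_kernel a ?N k = 2 * Od"
    unfolding even_kernel_def odd_kernel_def E_def Od_def q_def by (simp_all add: sum_distrib_left)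
  have q_one: "cdiffs (n - k) (rodr ?N n) 1 = q n" for n unfolding q_def ..
  have q': "cdiffs (n - k) (rodr ?N n) (-1) = (-1) ^ (n - k) * q n" for n
    unfolding q_def using cdiffs_rodr_minus[of "n - k" ?N n 1] by simp
  have split: "(\<Sum>n\<in>{a..<?N}. f n) = (\<Sum>n\<in>{n \<in> {a..<?N}. even (n - k)}. f n) + (\<Sum>n\<in>{n \<in> {a..<?N}. odd (n - k)}. f n)"
    for f :: "nat \<Rightarrow> real"
    by (subst sum.union_disjoint[symmetric]) (auto intro: sum.cong)
  have P: "(\<Sum>n\<in>{a..<?N}. cdiffs (nat (int n - int k)) (rodr ?N n) w / cheb_norm ?N n * cdiffs (n - k) (rodr ?N n) z) =
     (if w = z then E + Od else E - Od)" if "w = 1 \<or> w = -1" "z = 1 \<or> z = -1" for w z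
  proof -
    have n: "nat (int n - int k) = n - k" for n by simp
    have "(\<Sum>n\<in>{n \<in> {a..<?N}. even (n - k)}. cdiffs (nat (int n - int k)) (rodr ?N n) w / cheb_norm ?N n * cdiffs (n - k) (rodr ?N n) z) = E"
      unfolding E_def n by (rule sum.cong) (use that assms(2) in \<open>auto simp: q' q_one power2_eq_square\<close>)
    moreover have "(\<Sum>n\<in>{n \<in> {a..<?N}. odd (n - k)}. cdiffs (nat (int n - int k)) (rodr ?N n) w / cheb_norm ?N n * cdiffs (n - k) (rodr ?N n) z)
       = (\<Sum>n\<in>{n \<in> {a..<?N}. odd (n - k)}. (if w = z then 1 else -1) * ((q n)\<^sup>2 / cheb_norm ?N n))"
      unfolding n by (rule sum.cong) (use that assms(2) in \<open>auto simp: q' q_one power2_eq_square\<close>)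
    then have "(\<Sum>n\<in>{n \<in> {a..<?N}. odd (n - k)}. cdiffs (nat (int n - int k)) (rodr ?N n) w / cheb_norm ?N n * cdiffs (n - k) (rodr ?N n) z)
       = (if w = z then 1 else -1) * Od"
      unfolding Od_def sum_distrib_left .
    ultimately show ?thesis unfolding split[of "\<lambda>n. _ n * _ n"] by simp
  qed
  \<comment> \<open>The pushed point mass lives on columns up to -k and meets column k for k = 0
    only; this is the origin of the correction terms.\<close>
  have V: "kernel_sum a ?N k z (int k, w) = (-1) ^ Suc k * (if w = z then E + Od else E - Od) + of_bool (k = 0 \<and> w = z)"
    if "w = 1 \<or> w = -1" "z = 1 \<or> z = -1" for w z
    unfolding kernel_sum_def prod.case P[OF that] by auto
  have par: "odd (- int k + z + int ?N)" if "z = 1 \<or> z = -1" for z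
  proof -
    have "even (int k + int ?N)" using assms(5) by (metis add.commute even_of_nat of_nat_add)
    then show ?thesis using that by presburger
  qed
  have "real (M (holey_hexagon a b k)) = real (M (hexagon a b)) *
     \<bar>green a ?N k (-1) (int k, -1) * green a ?N k 1 (int k, 1) - green a ?N k (-1) (int k, 1) * green a ?N k 1 (int k, -1)\<bar>"
    by (rule M_holey_hexagon_eq[OF assms(1,2,3,5)]; rule green_equation) (use assms par in auto)
  moreover have "green a ?N k (-1) (int k, -1) * green a ?N k 1 (int k, 1) - green a ?N k (-1) (int k, 1) * green a ?N k 1 (int k, -1) =
     (even_kernel a ?N k - of_bool (k = 0)) * (odd_kernel a ?N k - of_bool (k = 0))"
  proof -
    let ?sl = "half_sign (- int k + int ?N - 2)" and ?sr = "half_sign (int k + int ?N - 2)"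
    have s: "half_sign (- int k + 1 + int ?N - 1) = - ?sl" "half_sign (int k + 1 + int ?N - 1) = - ?sr"
       "half_sign (- int k + -1 + int ?N - 1) = ?sl" "half_sign (int k + -1 + int ?N - 1) = ?sr"
      using half_sign_step[of "- int k + int ?N - 2"] half_sign_step[of "int k + int ?N - 2"] by (simp_all add: algebra_simps)
    have "green a ?N k (-1) (int k, -1) * green a ?N k 1 (int k, 1) - green a ?N k (-1) (int k, 1) * green a ?N k 1 (int k, -1) =
       (?sl * ?sl) * (?sr * ?sr) * (((-1) ^ Suc k * (E + Od) + of_bool (k = 0))\<^sup>2 - ((-1) ^ Suc k * (E - Od))\<^sup>2)"
      unfolding green_def prod.case s V[of 1 1, simplified] V[of 1 "-1", simplified] V[of "-1" 1, simplified] V[of "-1" "-1", simplified]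
      by (simp add: power2_eq_square algebra_simps)
    also have "\<dots> = ((-1) ^ Suc k * (E + Od) + of_bool (k = 0))\<^sup>2 - ((-1) ^ Suc k * (E - Od))\<^sup>2"
      unfolding half_sign_square by simp
    also have "\<dots> = (2 * E - of_bool (k = 0)) * (2 * Od - of_bool (k = 0))"
      by (cases "even k"; cases "k = 0") (auto simp: power2_eq_square algebra_simps)
    finally show ?thesis unfolding eo .
  qed
  ultimately show ?thesis by simp
qed

section \<open>Existence of a tiling of the hexagon\<close>

lemma finite_matchings: "finite R \<Longrightarrow> finite L \<Longrightarrow> finite (matchings R L A)"
proof (rule finite_subset[of _ "R \<rightarrow>\<^sub>E L"])
  show "matchings R L A \<subseteq> R \<rightarrow>\<^sub>E L" by (auto simp: matchings_def bij_betw_def PiE_def)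
qed (simp add: finite_PiE)

text \<open>The ratio is meaningful only if the hexagon can be tiled. In the tiling used, the b
  topmost cells of each column step along the upper sides, upwards in the left half and downwards in
  the right half, and all lower cells lie in horizontal rhombi. Injectivity suffices since both
  kinds of cells are equally many.\<close>

lemma M_hexagon_pos: "0 < M (hexagon a b)"
proof -
  define A B where "A = int a" and "B = int b"
  define f where "f = (\<lambda>(x, y). if A - B - 1 - \<bar>x\<bar> < y then (x + 1, if x < 0 then y + 1 else y - 1) else (x, y))"
  have AB: "0 \<le> A" "0 \<le> B" by (simp_all add: A_def B_def)
  have up: "(x + 1, y') \<in> left_cells a b \<and> A - B - 1 - \<bar>x + 1\<bar> < y'"
    if xy: "(x, y) \<in> right_cells a b" "A - B - 1 - \<bar>x\<bar> < y" and y': "y' = (if x < 0 then y + 1 else y - 1)" for x y y'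
  proof -
    have R: "- A \<le> x" "x < A" "\<bar>x\<bar> + \<bar>y\<bar> < A + B" "odd (x + y + A + B)"
      using xy(1) unfolding right_cells_def A_def B_def by auto
    show ?thesis
    proof (cases "x < 0")
      case True
      then have *: "\<bar>x\<bar> = - x" "\<bar>x + 1\<bar> = - x - 1" "\<bar>y + 1\<bar> \<le> \<bar>y\<bar> + 1" by auto
      then have "\<bar>x + 1\<bar> + \<bar>y + 1\<bar> < A + B" using R(3) by linarith
      then show ?thesis using R * True xy(2) y' unfolding left_cells_def A_def B_def by auto
    next
      case False
      then have *: "\<bar>x\<bar> = x" "\<bar>x + 1\<bar> = x + 1" by auto
      have "A - B + 1 - x \<le> y" using R(4) xy(2) * by presburger
      then have "\<bar>y - 1\<bar> < A + B - x - 1" using R * False by linarith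
      then have "\<bar>x + 1\<bar> + \<bar>y - 1\<bar> < A + B" using * by linarith
      then show ?thesis using R * False xy(2) y' unfolding left_cells_def A_def B_def by auto
    qed
  qed
  have stay: "(x, y) \<in> left_cells a b" if xy: "(x, y) \<in> right_cells a b" "\<not> A - B - 1 - \<bar>x\<bar> < y" for x y
  proof -
    have R: "- A \<le> x" "x < A" "\<bar>x\<bar> + \<bar>y\<bar> < A + B" "odd (x + y + A + B)"
      using xy(1) unfolding right_cells_def A_def B_def by auto
    have "x \<noteq> - A"
    proof
      assume "x = - A"
      then show False using R xy(2) AB by auto
    qed
    then show ?thesis using R unfolding left_cells_def A_def B_def by auto
  qed
  have inj: "inj_on f (right_cells a b)"
  proof (rule inj_onI, clarify)
    fix x y x' y' assume c: "(x, y) \<in> right_cells a b" "(x', y') \<in> right_cells a b" "f (x, y) = f (x', y')"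
    show "x = x' \<and> y = y'"
      using c(3) up[OF c(1) _ refl] up[OF c(2) _ refl]
      by (cases "A - B - 1 - \<bar>x\<bar> < y"; cases "A - B - 1 - \<bar>x'\<bar> < y'")
         (auto simp: f_def split: if_splits)
  qed
  have sub: "f ` right_cells a b \<subseteq> left_cells a b"
    using up stay by (auto simp: f_def split: if_splits)
  have "card (f ` right_cells a b) = card (left_cells a b)"
    using card_image[OF inj] bij_betw_same_card[OF bij_betw_mirror_cells] by metis
  then have "f ` right_cells a b = left_cells a b"
    using card_subset_eq[OF finite_left_cells sub] by simp
  then have b: "bij_betw f (right_cells a b) (left_cells a b)" using inj by (simp add: bij_betw_def)
  have "restrict f (right_cells a b) \<in> matchings (right_cells a b) (left_cells a b) rhombic"
    unfolding matchings_def
  proof (intro CollectI conjI ballI)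
    show "bij_betw (restrict f (right_cells a b)) (right_cells a b) (left_cells a b)"
      by (subst bij_betw_cong[where g = f]) (simp, rule b)
    show "rhombic r (restrict f (right_cells a b) r)" if "r \<in> right_cells a b" for r
      using that by (cases r) (auto simp: f_def rhombic_def)
  qed simp
  then show ?thesis
    unfolding hexagon_eq_cells M_cells
    using finite_matchings[OF finite_right_cells finite_left_cells] by (auto simp: card_gt_0_iff)
qed

section \<open>Closed forms of the kernel\<close>

text \<open>A discrete Pearson equation: the linear factors of the weight at y + 1 and y - 1 are the
  same up to a shift of the index, so the quotient of the two values telescopes to a quotient of two
  quadratics.\<close>

lemma rodr_poly_step:
  "((real N)\<^sup>2 - (real n)\<^sup>2 - (of_int y)\<^sup>2) * (rodr_poly N n (y + 1) - rodr_poly N n (y - 1)) +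
    2 * real n * of_int y * (rodr_poly N n (y + 1) + rodr_poly N n (y - 1)) = 0"
proof -
  define c where "c = real N - real n"
  define t where "t = real_of_int y"
  define p where "p = (\<lambda>i::nat. c + 2 * real i - t)"
  define q where "q = (\<lambda>i::nat. c + 2 * real i + t)"
  have tele: "(\<Prod>i<n. f i) * f n = f 0 * (\<Prod>i<n. f (Suc i))" for f :: "nat \<Rightarrow> real"
    using prod.lessThan_Suc_shift[of f n] by (simp add: mult.commute)
  have up: "rodr_poly N n (y + 1) = (\<Prod>i<n. p i) * (\<Prod>i<n. q (Suc i))"
    unfolding rodr_poly_def prod.distrib[symmetric]
    by (rule prod.cong) (simp_all add: p_def q_def c_def t_def power2_eq_square algebra_simps)
  have dn: "rodr_poly N n (y - 1) = (\<Prod>i<n. p (Suc i)) * (\<Prod>i<n. q i)"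
    unfolding rodr_poly_def prod.distrib[symmetric]
    by (rule prod.cong) (simp_all add: p_def q_def c_def t_def power2_eq_square algebra_simps)
  have "p n * q 0 * rodr_poly N n (y + 1) = ((\<Prod>i<n. p i) * p n) * (q 0 * (\<Prod>i<n. q (Suc i)))"
    unfolding up by (simp only: mult_ac)
  also have "\<dots> = (p 0 * (\<Prod>i<n. p (Suc i))) * ((\<Prod>i<n. q i) * q n)" by (simp only: tele[of p] tele[of q])
  also have "\<dots> = p 0 * q n * rodr_poly N n (y - 1)" unfolding dn by (simp only: mult_ac)
  finally have "p n * q 0 * rodr_poly N n (y + 1) = p 0 * q n * rodr_poly N n (y - 1)" .
  moreover have "p n * q 0 = (real N)\<^sup>2 - (real n - t)\<^sup>2" "p 0 * q n = (real N)\<^sup>2 - (real n + t)\<^sup>2"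
    by (simp_all add: p_def q_def c_def power2_eq_square algebra_simps)
  ultimately show ?thesis by (simp add: t_def power2_eq_square algebra_simps)
qed

text \<open>Subtracting the equations at y + 1 and y - 1 reproduces the form with n - m lowered by
  one, while a multiple of the undifferenced function is added; hence the accumulating coefficient
  of the order m - 1, which is absent for m = 0.\<close>

lemma rodr_poly_equation:
  "((real N)\<^sup>2 - (real n - real m)\<^sup>2 - (of_int y)\<^sup>2) * cdiffs (Suc m) (rodr_poly N n) y +
    2 * (real n - real m) * of_int y * (cdiffs m (rodr_poly N n) (y + 1) + cdiffs m (rodr_poly N n) (y - 1)) +
    4 * real m * (2 * real n - real m + 1) * (if m = 0 then 0 else cdiffs (m - 1) (rodr_poly N n) y) = 0"
proof (induction m arbitrary: y)
  case 0
  then show ?case using rodr_poly_step[of N n y] by (simp add: cdiff_def)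
next
  case (Suc m)
  let ?f = "\<lambda>m. cdiffs m (rodr_poly N n)"
  define Z where "Z = (\<lambda>y. if m = 0 then 0 else ?f (m - 1) y)"
  define \<mu> where "\<mu> = 4 * real m * (2 * real n - real m + 1)"
  define u v w where "u = ?f m (y + 2)" and "v = ?f m y" and "w = ?f m (y - 2)"
  have Z: "\<mu> * (Z (y + 1) - Z (y - 1)) = \<mu> * v"
  proof (cases m)
    case (Suc m')
    then show ?thesis by (simp only: Z_def v_def cdiffs_Suc[of m'] diff_Suc_1 if_False nat.distinct)
  qed (simp add: \<mu>_def)
  have f1: "?f (Suc m) (y + 1) = u - v" "?f (Suc m) (y - 1) = v - w"
    by (simp_all add: cdiff_def u_def v_def w_def add.commute)
  have f2: "?f (Suc (Suc m)) y = u - 2 * v + w" by (subst cdiffs_Suc) (simp only: f1)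
  have IH: "((real N)\<^sup>2 - (real n - real m)\<^sup>2 - (of_int y)\<^sup>2) * ?f (Suc m) y +
    2 * (real n - real m) * of_int y * (?f m (y + 1) + ?f m (y - 1)) + \<mu> * Z y = 0" for y
    using Suc.IH[of y] unfolding Z_def \<mu>_def .
  have sh: "?f m (y + 1 + 1) = u" "?f m (y + 1 - 1) = v" "?f m (y - 1 + 1) = v" "?f m (y - 1 - 1) = w"
    by (simp_all add: u_def v_def w_def add.commute)
  have a1: "((real N)\<^sup>2 - (real n - real m)\<^sup>2 - (of_int y + 1)\<^sup>2) * (u - v) +
    2 * (real n - real m) * (of_int y + 1) * (u + v) + \<mu> * Z (y + 1) = 0"
    using IH[of "y + 1"] unfolding f1 sh by simp
  have a2: "((real N)\<^sup>2 - (real n - real m)\<^sup>2 - (of_int y - 1)\<^sup>2) * (v - w) +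
    2 * (real n - real m) * (of_int y - 1) * (v + w) + \<mu> * Z (y - 1) = 0"
    using IH[of "y - 1"] unfolding f1 sh by simp
  have sum: "((real N)\<^sup>2 - (real n - real m - 1)\<^sup>2 - (of_int y)\<^sup>2) * (u - 2 * v + w) +
    2 * (real n - real m - 1) * of_int y * (u - w) + (\<mu> + 8 * (real n - real m)) * v = 0"
    using a1 a2 Z by (simp add: power2_eq_square algebra_simps)
  have \<mu>': "\<mu> + 8 * (real n - real m) = 4 * (real m + 1) * (2 * real n - real m)"
    by (simp add: \<mu>_def algebra_simps)
  have S: "real n - real (Suc m) = real n - real m - 1" "u - v + (v - w) = u - w"
    "4 * real (Suc m) * (2 * real n - real (Suc m) + 1) = 4 * (real m + 1) * (2 * real n - real m)"
    "(if Suc m = 0 then 0 else ?f (Suc m - 1) y) = v"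
    by (simp_all add: v_def)
  show ?case unfolding f2 f1 S using sum unfolding \<mu>' .
qed

lemma cdiffs_rodr_poly_minus: "cdiffs m (rodr_poly N n) (- y) = (-1) ^ m * cdiffs m (rodr_poly N n) y"
  by (rule cdiffs_minus) (simp add: rodr_poly_def)

lemma cdiffs_rodr_poly_odd_zero: "odd m \<Longrightarrow> cdiffs m (rodr_poly N n) 0 = 0"
  using cdiffs_rodr_poly_minus[of m N n 0] by simp

text \<open>At y = 1 and m = 2r + 1 the value at 0 vanishes by antisymmetry, and the one at 2 is
  then the next difference at 1. The equation retains only two terms, which is the source of the
  product formula.\<close>

lemma central_recurrence_even:
  "((real N)\<^sup>2 - (real n - 2 * real (Suc r))\<^sup>2) * cdiffs (2 * Suc r) (rodr_poly N n) 1 =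
    - 8 * (2 * real r + 1) * (real n - real r) * cdiffs (2 * r) (rodr_poly N n) 1"
proof -
  let ?f = "\<lambda>m. cdiffs m (rodr_poly N n)"
  have 0: "?f (Suc (2 * r)) 0 = 0" by (rule cdiffs_rodr_poly_odd_zero) simp
  have 2: "?f (Suc (2 * r)) 2 = ?f (Suc (Suc (2 * r))) 1"
    using 0 by (subst (2) cdiffs_Suc) (simp del: funpow.simps)
  show ?thesis
    using rodr_poly_equation[of N n "Suc (2 * r)" 1] 0 2
    by (simp add: power2_eq_square algebra_simps del: funpow.simps)
qed

text \<open>At y = 0 the middle term carries the factor y and disappears.\<close>

lemma central_recurrence_odd:
  "((real N)\<^sup>2 - (real n + 1 - 2 * real (Suc r))\<^sup>2) * cdiffs (2 * Suc r) (rodr_poly N n) 0 =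
    - 8 * (2 * real r + 1) * (real n - real r) * cdiffs (2 * r) (rodr_poly N n) 0"
  using rodr_poly_equation[of N n "Suc (2 * r)" 0]
  by (simp add: power2_eq_square algebra_simps del: funpow.simps)

lemma prod_shift_eq_fact: "(\<Prod>l<n. real i + 1 + real l) = fact (i + n) / fact i"
proof (induction n)
  case (Suc n)
  have "(\<Prod>l<Suc n. real i + 1 + real l) = fact (i + n) / fact i * (real i + 1 + real n)"
    by (simp only: prod.lessThan_Suc Suc)
  then show ?case by (simp add: algebra_simps)
qed simp

text \<open>The induction step of both product formulas, with factorials replaced by letters: B and
  d + 1 cancel against factors of Y, while A, r + 1 and the two factors of the double factorial
  enter X.\<close>

lemma central_recurrence_step:
  fixes X Y :: real
  assumes "4 * A * B * X = - 8 * (2 * r + 1) * (d + 1) * Y"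
    and "Y = S * F * C * (B * f1) / (f2 * ((d + 1) * f3) * f4 * f5)"
    and "A > 0" "B > 0" "r \<ge> 0" "d \<ge> 0" "f2 > 0" "f3 > 0" "f4 > 0" "f5 > 0"
  shows "X = - S * ((2 * r + 2) * (2 * r + 1) * F) * C * f1 / (((r + 1) * f2) * f3 * (A * f4) * f5)"
proof -
  have nz: "A \<noteq> 0" "B \<noteq> 0" "d + 1 \<noteq> 0" "r + 1 \<noteq> 0" "f2 \<noteq> 0" "f3 \<noteq> 0" "f4 \<noteq> 0" "f5 \<noteq> 0" using assms by auto
  have "X = - 8 * (2 * r + 1) * (d + 1) * Y / (4 * A * B)"
    unfolding assms(1)[symmetric] using nz by simp
  also have "\<dots> = - 2 * (2 * r + 1) * S * F * C * f1 / (f2 * f3 * (A * f4) * f5)"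
    unfolding assms(2) using nz by (simp add: divide_simps)
  also have "\<dots> = - S * ((2 * r + 2) * (2 * r + 1) * F) * C * f1 / (((r + 1) * f2) * f3 * (A * f4) * f5)"
    using nz by (simp add: divide_simps) (simp add: algebra_simps)
  finally show ?thesis .
qed

lemma fact_double_Suc: "fact (2 * Suc r) = (2 * real r + 2) * (2 * real r + 1) * fact (2 * r)"
  by (simp add: algebra_simps)

text \<open>The parameter j encodes N - n = 2 (j + 1), the parity for which 1 is a lattice point
  after an even number of differences. At r = 0 the factors of the weight split into consecutive
  integers.\<close>

lemma central_value_even:
  assumes "r \<le> n"
  shows "cdiffs (2 * r) (rodr_poly (n + 2 * Suc j) n) 1 =
    (-1) ^ r * fact (2 * r) * (4 ^ n * fact n * fact (n + j + 1)) * fact (n + j - r) /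
      (fact r * fact (n - r) * fact (j + 1 + r) * fact j)"
  using assms
proof (induction r)
  case 0
  have "rodr_poly (n + 2 * Suc j) n 1 = (\<Prod>l<n. 4 * ((real j + 1 + real l) * (real (Suc j) + 1 + real l)))"
    unfolding rodr_poly_def by (rule prod.cong) (simp_all add: power2_eq_square algebra_simps)
  also have "\<dots> = 4 ^ n * ((fact (j + n) / fact j) * (fact (Suc j + n) / fact (Suc j)))"
    by (simp only: prod.distrib prod_shift_eq_fact prod_constant card_lessThan)
  finally show ?case by (simp add: add.commute mult.commute del: fact_Suc)
next
  case (Suc r)
  obtain d where d: "n = Suc r + d" using Suc.prems by (metis le_Suc_ex)
  have sub: "n + j - r = Suc (d + j)" "n - r = Suc d" "n + j - Suc r = d + j" "n - Suc r = d" "j + 1 + Suc r = Suc (j + 1 + r)"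
    unfolding d by simp_all
  let ?N = "n + 2 * Suc j"
  have "(real ?N)\<^sup>2 - (real n - 2 * real (Suc r))\<^sup>2 = 4 * (real j + real r + 2) * (real d + real j + 1)" "real n - real r = real d + 1"
    by (simp_all add: d power2_eq_square algebra_simps)
  then have "4 * (real j + real r + 2) * (real d + real j + 1) * cdiffs (2 * Suc r) (rodr_poly ?N n) 1 =
      - 8 * (2 * real r + 1) * (real d + 1) * cdiffs (2 * r) (rodr_poly ?N n) 1"
    using central_recurrence_even[of ?N n r] by (simp only:)
  moreover have "cdiffs (2 * r) (rodr_poly ?N n) 1 = (-1) ^ r * fact (2 * r) * (4 ^ n * fact n * fact (n + j + 1)) *
      ((real d + real j + 1) * fact (d + j)) / (fact r * ((real d + 1) * fact d) * fact (j + 1 + r) * fact j)"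
    using Suc.IH Suc.prems unfolding sub by (simp add: algebra_simps del: funpow.simps)
  ultimately have "cdiffs (2 * Suc r) (rodr_poly ?N n) 1 = - ((-1) ^ r) * ((2 * real r + 2) * (2 * real r + 1) * fact (2 * r)) *
      (4 ^ n * fact n * fact (n + j + 1)) * fact (d + j) / (((real r + 1) * fact r) * fact d * ((real j + real r + 2) * fact (j + 1 + r)) * fact j)"
    by (rule central_recurrence_step) auto
  moreover have "fact (Suc (j + 1 + r)) = (real j + real r + 2) * fact (j + 1 + r)" "fact (Suc r) = (real r + 1) * fact r"
    by (simp_all add: algebra_simps)
  ultimately show ?case unfolding sub fact_double_Suc by (simp only: power_Suc mult_minus1)
qed

text \<open>Evaluated at 0 because a difference of odd order at 1 is half the next difference at
  0.\<close>

lemma central_value_odd: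
  assumes "r \<le> n"
  shows "cdiffs (2 * r) (rodr_poly (n + 1 + 2 * j) n) 0 =
    (-1) ^ r * fact (2 * r) * (4 ^ n * fact n * fact (n + j)) * fact (n + j - r) /
      (fact r * fact (n - r) * fact (j + r) * fact j)"
  using assms
proof (induction r)
  case 0
  have "rodr_poly (n + 1 + 2 * j) n 0 = (\<Prod>l<n. 4 * ((real j + 1 + real l) * (real j + 1 + real l)))"
    unfolding rodr_poly_def by (rule prod.cong) (simp_all add: power2_eq_square algebra_simps)
  also have "\<dots> = 4 ^ n * ((fact (j + n) / fact j) * (fact (j + n) / fact j))"
    by (simp only: prod.distrib prod_shift_eq_fact prod_constant card_lessThan)
  finally show ?case by (simp add: add.commute)
next
  case (Suc r)
  obtain d where d: "n = Suc r + d" using Suc.prems by (metis le_Suc_ex)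
  have sub: "n + j - r = Suc (d + j)" "n - r = Suc d" "n + j - Suc r = d + j" "n - Suc r = d" "j + Suc r = Suc (j + r)"
    unfolding d by simp_all
  let ?N = "n + 1 + 2 * j"
  have "(real ?N)\<^sup>2 - (real n + 1 - 2 * real (Suc r))\<^sup>2 = 4 * (real j + real r + 1) * (real d + real j + 1)" "real n - real r = real d + 1"
    by (simp_all add: d power2_eq_square algebra_simps)
  then have "4 * (real j + real r + 1) * (real d + real j + 1) * cdiffs (2 * Suc r) (rodr_poly ?N n) 0 =
      - 8 * (2 * real r + 1) * (real d + 1) * cdiffs (2 * r) (rodr_poly ?N n) 0"
    using central_recurrence_odd[of ?N n r] by (simp only:)
  moreover have "cdiffs (2 * r) (rodr_poly ?N n) 0 = (-1) ^ r * fact (2 * r) * (4 ^ n * fact n * fact (n + j)) *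
      ((real d + real j + 1) * fact (d + j)) / (fact r * ((real d + 1) * fact d) * fact (j + r) * fact j)"
    using Suc.IH Suc.prems unfolding sub by (simp add: algebra_simps del: funpow.simps)
  ultimately have "cdiffs (2 * Suc r) (rodr_poly ?N n) 0 = - ((-1) ^ r) * ((2 * real r + 2) * (2 * real r + 1) * fact (2 * r)) *
      (4 ^ n * fact n * fact (n + j)) * fact (d + j) / (((real r + 1) * fact r) * fact d * ((real j + real r + 1) * fact (j + r)) * fact j)"
    by (rule central_recurrence_step) auto
  moreover have "fact (Suc (j + r)) = (real j + real r + 1) * fact (j + r)" "fact (Suc r) = (real r + 1) * fact r"
    by (simp_all add: algebra_simps)
  ultimately show ?case unfolding sub fact_double_Suc by (simp only: power_Suc mult_minus1)
qed

text \<open>Central binomial coefficients, normalised to decay like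
  \<open>1 / sqrt (pi * j)\<close>. Replacing all factorials of even numbers by them lets nearly all
  powers of 4 cancel.\<close>

definition cbin :: "nat \<Rightarrow> real" where
  "cbin j = real ((2 * j) choose j) / 4 ^ j"

lemma cbin_pos: "0 < cbin j"
  by (simp add: cbin_def)

lemma fact_double: "fact (2 * j) = cbin j * 4 ^ j * (fact j)\<^sup>2"
proof -
  have "real ((2 * j) choose j) = fact (2 * j) / (fact j * fact j)"
    by (subst binomial_fact) simp_all
  then show ?thesis by (simp add: cbin_def power2_eq_square)
qed

section \<open>The single terms of the two kernels\<close>

definition even_term :: "nat \<Rightarrow> nat \<Rightarrow> nat \<Rightarrow> real" where
  "even_term k s r = (2 * real k + 4 * real r + 1) / 4 ^ k * real (s - r) * cbin (s - r) * (cbin r)\<^sup>2 / cbin (k + r + s) *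
     (fact r / fact (k + r))\<^sup>2 * (fact (k + s - 1) / fact s)\<^sup>2"

definition odd_term :: "nat \<Rightarrow> nat \<Rightarrow> nat \<Rightarrow> real" where
  "odd_term k s p = 2 * (2 * real k + 4 * real p + 3) / (2 * real k + 2 * real p + 2 * real s + 1) / 4 ^ k *
     cbin (s - 1 - p) * (cbin (p + 1))\<^sup>2 / cbin (k + p + s) *
     (fact (p + 1) / fact (k + p))\<^sup>2 * (fact (k + s - 1) / fact s)\<^sup>2"

lemma cheb_norm_even: "cheb_norm (n + 2 * Suc j) n = 16 ^ n * (fact n)\<^sup>2 * fact (2 * (n + Suc j)) * (2 * real (Suc j)) / ((2 * real n + 1) * fact (2 * Suc j))"
proof -
  have e: "n + 2 * Suc j + n = 2 * (n + Suc j)" "2 * (n + Suc j) - (2 * n + 1) = Suc (2 * j)" by simp_all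
  have "real ((n + 2 * Suc j + n) choose (2 * n + 1)) = fact (2 * (n + Suc j)) / (fact (2 * n + 1) * fact (Suc (2 * j)))"
    unfolding e(1) by (subst binomial_fact) (simp_all only: e, simp)
  moreover have f: "fact (2 * n + 1) = (2 * real n + 1) * fact (2 * n)" "fact (2 * Suc j) = 2 * real (Suc j) * fact (Suc (2 * j))"
    by (simp_all del: of_nat_Suc, simp add: algebra_simps)
  ultimately show ?thesis unfolding cheb_norm_def f by (simp only:) (simp del: fact_Suc of_nat_Suc)
qed

lemma cheb_norm_odd: "cheb_norm (n + 1 + 2 * j) n = 16 ^ n * (fact n)\<^sup>2 * fact (2 * (n + j)) * (2 * real n + 2 * real j + 1) / ((2 * real n + 1) * fact (2 * j))"
proof -
  have e: "n + 1 + 2 * j + n = Suc (2 * (n + j))" "Suc (2 * (n + j)) - (2 * n + 1) = 2 * j" by simp_all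
  have "real ((n + 1 + 2 * j + n) choose (2 * n + 1)) = fact (Suc (2 * (n + j))) / (fact (2 * n + 1) * fact (2 * j))"
    unfolding e(1) by (subst binomial_fact) (simp_all only: e, simp)
  moreover have f: "fact (2 * n + 1) = (2 * real n + 1) * fact (2 * n)" "fact (Suc (2 * (n + j))) = (2 * real n + 2 * real j + 1) * fact (2 * (n + j))"
    by (simp_all add: algebra_simps)
  ultimately show ?thesis unfolding cheb_norm_def f by (simp only:) (simp del: fact_Suc of_nat_Suc)
qed

text \<open>The cancellation stripped of factorials and powers, which are abstracted to nonzero
  letters so that a field identity remains.\<close>

lemma kernel_term_algebra_even:
  fixes \<sigma> p cr q fr fn fa fb fkr fs fj cN w u cj J t :: real
  assumes "\<sigma>\<^sup>2 = 1" "p > 0" "q > 0" "fr > 0" "fn > 0" "fb > 0" "fkr > 0" "fs > 0" "fj > 0" "cN > 0" "w > 0" "u > 0" "cj > 0" "J > 0" "t > 0"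
  shows "2 * (\<sigma> * (cr * q * fr\<^sup>2) * (p * fn * fb) * fa / (fr * fkr * fs * fj))\<^sup>2 /
      (p\<^sup>2 * fn\<^sup>2 * (cN * (w * q\<^sup>2 * u) * fb\<^sup>2) * (2 * J) / (t * (cj * u * (J * fj)\<^sup>2))) =
    t / w * J * cj * cr\<^sup>2 / cN * (fr / fkr)\<^sup>2 * (fa / fs)\<^sup>2"
proof -
  have nz: "p \<noteq> 0" "q \<noteq> 0" "fr \<noteq> 0" "fn \<noteq> 0" "fb \<noteq> 0" "fkr \<noteq> 0" "fs \<noteq> 0" "fj \<noteq> 0" "cN \<noteq> 0" "w \<noteq> 0" "u \<noteq> 0" "cj \<noteq> 0" "J \<noteq> 0" "t \<noteq> 0"
    using assms by auto
  have sq: "2 * (\<sigma> * (cr * q * fr\<^sup>2) * (p * fn * fb) * fa / (fr * fkr * fs * fj))\<^sup>2 =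
      2 * ((cr * q * fr\<^sup>2) * (p * fn * fb) * fa / (fr * fkr * fs * fj))\<^sup>2"
    using assms(1) by (simp add: power_mult_distrib power_divide)
  show ?thesis
    unfolding sq using nz by (simp add: divide_simps) (simp add: power2_eq_square mult_ac)
qed

lemma kernel_term_algebra_odd:
  fixes \<sigma> p cr q fr fn fa fb fkr fs fj cN w u cj T t :: real
  assumes "\<sigma>\<^sup>2 = 1" "4 * p = w * q\<^sup>2" "q > 0" "fr > 0" "fn > 0" "fb > 0" "fkr > 0" "fs > 0" "fj > 0" "cN > 0" "w > 0" "u > 0" "cj > 0" "T > 0" "t > 0"
  shows "2 * (\<sigma> * (cr * q * fr\<^sup>2) * (p * fn * fb) * fa / (fr * fkr * fs * fj) / 2)\<^sup>2 /
      (p\<^sup>2 * fn\<^sup>2 * (cN * (p * u) * fb\<^sup>2) * T / (t * (cj * u * fj\<^sup>2))) =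
    2 * t / T / w * cj * cr\<^sup>2 / cN * (fr / fkr)\<^sup>2 * (fa / fs)\<^sup>2"
proof -
  have p: "p = w * q\<^sup>2 / 4" using assms(2) by simp
  have nz: "q \<noteq> 0" "fr \<noteq> 0" "fn \<noteq> 0" "fb \<noteq> 0" "fkr \<noteq> 0" "fs \<noteq> 0" "fj \<noteq> 0" "cN \<noteq> 0" "w \<noteq> 0" "u \<noteq> 0" "cj \<noteq> 0" "T \<noteq> 0" "t \<noteq> 0"
    using assms by auto
  have sq: "2 * (\<sigma> * (cr * q * fr\<^sup>2) * (p * fn * fb) * fa / (fr * fkr * fs * fj) / 2)\<^sup>2 =
      2 * ((cr * q * fr\<^sup>2) * (p * fn * fb) * fa / (fr * fkr * fs * fj) / 2)\<^sup>2"
    using assms(1) by (simp add: power_mult_distrib power_divide)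
  show ?thesis
    unfolding sq using nz by (simp add: p divide_simps)
qed

text \<open>Here N = k + 2s and n = k + 2r. The squared central value and the norm share most of
  their factorials; what survives are shifted quotients and four central binomial factors.\<close>

lemma kernel_even_term:
  assumes "r < s"
  shows "2 * (cdiffs (2 * r) (rodr (k + 2 * s) (k + 2 * r)) 1)\<^sup>2 / cheb_norm (k + 2 * s) (k + 2 * r) = even_term k s r"
proof -
  obtain j where j: "s = r + Suc j" using assms by (metis less_imp_Suc_add add_Suc_right)
  define n where "n = k + 2 * r"
  have N: "k + 2 * s = n + 2 * Suc j" by (simp add: n_def j)
  have sub: "n + j - r = k + s - 1" "n + j + 1 = k + r + s" "n - r = k + r" "j + 1 + r = s" "n + Suc j = k + r + s" "s - r = Suc j"
    by (simp_all add: n_def j)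
  have "cdiffs (2 * r) (rodr (n + 2 * Suc j) n) 1 = cdiffs (2 * r) (rodr_poly (n + 2 * Suc j) n) 1"
    by (rule cdiffs_rodr_eq_poly) (auto simp: n_def)
  also have "\<dots> = (-1) ^ r * (cbin r * 4 ^ r * (fact r)\<^sup>2) * (4 ^ n * fact n * fact (k + r + s)) * fact (k + s - 1) /
      (fact r * fact (k + r) * fact s * fact j)"
    using central_value_even[of r n j] unfolding sub fact_double by (simp add: n_def)
  finally have v: "cdiffs (2 * r) (rodr (n + 2 * Suc j) n) 1 = \<dots>" .
  have "k + r + s = k + r * 2 + Suc j" by (simp add: j)
  then have p: "(16::real) ^ n = (4 ^ n)\<^sup>2" "(4::real) ^ (k + r + s) = 4 ^ k * (4 ^ r)\<^sup>2 * 4 ^ Suc j"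
    by (simp_all only: power_add power_mult) (simp_all add: power2_eq_square flip: power_mult_distrib)
  have h: "cheb_norm (n + 2 * Suc j) n = (4 ^ n)\<^sup>2 * (fact n)\<^sup>2 * (cbin (k + r + s) * (4 ^ k * (4 ^ r)\<^sup>2 * 4 ^ Suc j) * (fact (k + r + s))\<^sup>2) *
      (2 * real (Suc j)) / ((2 * real n + 1) * (cbin (Suc j) * 4 ^ Suc j * (real (Suc j) * fact j)\<^sup>2))"
    unfolding cheb_norm_even sub fact_double p by (simp only: fact_Suc)
  show ?thesis
    unfolding n_def[symmetric] N v h
    by (subst kernel_term_algebra_even) (simp_all add: even_term_def cbin_pos sub n_def algebra_simps flip: power_mult power_mult_distrib)
qed

lemma kernel_odd_term:
  assumes "p < s"
  shows "2 * (cdiffs (2 * p + 1) (rodr (k + 2 * s) (k + 2 * p + 1)) 1)\<^sup>2 / cheb_norm (k + 2 * s) (k + 2 * p + 1) = odd_term k s p"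
proof -
  obtain j where j: "s = p + Suc j" using assms by (metis less_imp_Suc_add add_Suc_right)
  define n r where "n = k + 2 * p + 1" and "r = p + 1"
  have N: "k + 2 * s = n + 1 + 2 * j" by (simp add: n_def j)
  have sub: "n + j - r = k + s - 1" "n + j = k + p + s" "n - r = k + p" "j + r = s" "s - 1 - p = j" "2 * r = Suc (2 * p + 1)"
    by (simp_all add: n_def j r_def)
  \<comment> \<open>A difference of odd order is antisymmetric in y, so the next one at 0 is twice
    its value at 1.\<close>
  have "cdiffs (Suc (2 * p + 1)) (rodr_poly (n + 1 + 2 * j) n) 0 =
      cdiffs (2 * p + 1) (rodr_poly (n + 1 + 2 * j) n) 1 - cdiffs (2 * p + 1) (rodr_poly (n + 1 + 2 * j) n) (-1)"
    by (subst cdiffs_Suc) simp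
  also have "\<dots> = 2 * cdiffs (2 * p + 1) (rodr_poly (n + 1 + 2 * j) n) 1"
    unfolding cdiffs_rodr_poly_minus by simp
  finally have "cdiffs (2 * p + 1) (rodr_poly (n + 1 + 2 * j) n) 1 = cdiffs (2 * r) (rodr_poly (n + 1 + 2 * j) n) 0 / 2"
    unfolding sub by simp
  moreover have "cdiffs (2 * p + 1) (rodr (n + 1 + 2 * j) n) 1 = cdiffs (2 * p + 1) (rodr_poly (n + 1 + 2 * j) n) 1"
    by (rule cdiffs_rodr_eq_poly) (auto simp: n_def)
  moreover have "cdiffs (2 * r) (rodr_poly (n + 1 + 2 * j) n) 0 =
      (-1) ^ r * (cbin r * 4 ^ r * (fact r)\<^sup>2) * (4 ^ n * fact n * fact (k + p + s)) * fact (k + s - 1) /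
      (fact r * fact (k + p) * fact s * fact j)"
    using central_value_odd[of r n j] unfolding sub(1-5) fact_double by (simp add: n_def r_def)
  ultimately have v: "cdiffs (2 * p + 1) (rodr (n + 1 + 2 * j) n) 1 =
      (-1) ^ r * (cbin r * 4 ^ r * (fact r)\<^sup>2) * (4 ^ n * fact n * fact (k + p + s)) * fact (k + s - 1) /
      (fact r * fact (k + p) * fact s * fact j) / 2" by simp
  have pw: "(16::real) ^ n = (4 ^ n)\<^sup>2" "(4::real) ^ (k + p + s) = 4 ^ n * 4 ^ j" "4 * (4::real) ^ n = 4 ^ k * (4 ^ r)\<^sup>2"
  proof -
    have e: "k + p + s = n + j" "Suc n = k + r * 2" by (simp_all add: j n_def r_def)
    show "(16::real) ^ n = (4 ^ n)\<^sup>2" by (simp add: power2_eq_square flip: power_mult_distrib)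
    show "(4::real) ^ (k + p + s) = 4 ^ n * 4 ^ j" by (simp only: e power_add)
    have "4 * (4::real) ^ n = 4 ^ Suc n" by (simp only: power_Suc)
    then show "4 * (4::real) ^ n = 4 ^ k * (4 ^ r)\<^sup>2" by (simp only: e power_add power_mult)
  qed
  have h: "cheb_norm (n + 1 + 2 * j) n = (4 ^ n)\<^sup>2 * (fact n)\<^sup>2 * (cbin (k + p + s) * (4 ^ n * 4 ^ j) * (fact (k + p + s))\<^sup>2) *
      (2 * real n + 2 * real j + 1) / ((2 * real n + 1) * (cbin j * 4 ^ j * (fact j)\<^sup>2))"
    unfolding cheb_norm_odd sub fact_double pw ..
  have n: "k + 2 * p + 1 = n" "2 * real n + 2 * real j + 1 = 2 * real k + 2 * real p + 2 * real s + 1" "2 * real n + 1 = 2 * real k + 4 * real p + 3"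
    by (simp_all add: n_def j)
  have sg: "((-1 :: real) ^ r)\<^sup>2 = 1" by (simp add: power2_eq_square flip: power_mult_distrib)
  have "2 * (cdiffs (2 * p + 1) (rodr (n + 1 + 2 * j) n) 1)\<^sup>2 / cheb_norm (n + 1 + 2 * j) n =
      2 * (2 * real n + 1) / (2 * real n + 2 * real j + 1) / 4 ^ k * cbin j * (cbin r)\<^sup>2 / cbin (k + p + s) *
      (fact r / fact (k + p))\<^sup>2 * (fact (k + s - 1) / fact s)\<^sup>2"
    unfolding v h by (rule kernel_term_algebra_odd[OF sg pw(3)]) (simp_all add: cbin_pos add_pos_nonneg add_nonneg_pos)
  then show ?thesis unfolding n N odd_term_def sub(5) r_def .
qed

section \<open>Asymptotics\<close>

lemma cbin_Suc: "cbin (Suc j) = cbin j * ((2 * real j + 1) / (2 * real j + 2))"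
proof -
  have "cbin (Suc j) * 4 ^ Suc j * (fact (Suc j))\<^sup>2 = (2 * real j + 2) * (2 * real j + 1) * (cbin j * 4 ^ j * (fact j)\<^sup>2)"
    unfolding fact_double[symmetric] by (rule fact_double_Suc)
  moreover have "fact (Suc j) = (real j + 1) * fact j" by (simp add: algebra_simps)
  ultimately have "(4 ^ j * (fact j)\<^sup>2 * (2 * real j + 2)) * (cbin (Suc j) * (2 * real j + 2) - cbin j * (2 * real j + 1)) = 0"
    by (simp only:) (simp add: power2_eq_square algebra_simps)
  then have "cbin (Suc j) * (2 * real j + 2) = cbin j * (2 * real j + 1)" by simp
  then show ?thesis by (simp add: field_simps)
qed

text \<open>The left side equals 1 at j = 0 and decreases. Together with \<open>cbin_lower\<close>,
  where the left linear factor is adjusted so that the product increases, this gives the uniform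
  bounds needed for domination.\<close>

lemma cbin_upper: "(cbin j)\<^sup>2 * (2 * real j + 1) \<le> 1"
proof (induction j)
  case (Suc j)
  define x where "x = real j"
  have x: "0 \<le> x" by (simp add: x_def)
  have "(cbin (Suc j))\<^sup>2 * (2 * real (Suc j) + 1) = ((cbin j)\<^sup>2 * (2 * x + 1)) * ((2 * x + 1) * (2 * x + 3) / (2 * x + 2)\<^sup>2)"
    unfolding cbin_Suc x_def[symmetric] by (simp add: x_def[symmetric] power_mult_distrib power_divide power2_eq_square algebra_simps)
  also have "\<dots> \<le> 1 * 1"
  proof (rule mult_mono)
    have "(2 * x + 1) * (2 * x + 3) \<le> (2 * x + 2)\<^sup>2" by (simp add: power2_eq_square algebra_simps)
    then show "(2 * x + 1) * (2 * x + 3) / (2 * x + 2)\<^sup>2 \<le> 1" using x by (simp add: divide_le_eq_1_pos)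
  qed (use Suc x in \<open>auto simp: x_def[symmetric]\<close>)
  finally show ?case by simp
qed (simp add: cbin_def)

lemma cbin_lower: "1 \<le> (cbin j)\<^sup>2 * (4 * real j + 1)"
proof (induction j)
  case (Suc j)
  define x where "x = real j"
  have x: "0 \<le> x" by (simp add: x_def)
  have "1 * 1 \<le> ((cbin j)\<^sup>2 * (4 * x + 1)) * ((2 * x + 1)\<^sup>2 * (4 * x + 5) / ((2 * x + 2)\<^sup>2 * (4 * x + 1)))"
  proof (rule mult_mono)
    show "1 \<le> (2 * x + 1)\<^sup>2 * (4 * x + 5) / ((2 * x + 2)\<^sup>2 * (4 * x + 1))"
    proof -
      have pos: "0 < (2 * x + 2)\<^sup>2 * (4 * x + 1)" using x by (intro mult_pos_pos) auto
      have "(2 * x + 2)\<^sup>2 * (4 * x + 1) \<le> (2 * x + 1)\<^sup>2 * (4 * x + 5)" by (simp add: power2_eq_square algebra_simps)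
      then show ?thesis by (simp only: le_divide_eq_1_pos[OF pos])
    qed
  qed (use Suc x in \<open>auto simp: x_def\<close>)
  also have "\<dots> = (cbin (Suc j))\<^sup>2 * (4 * real (Suc j) + 1)"
    unfolding cbin_Suc x_def[symmetric] using x by (simp add: x_def[symmetric] power_mult_distrib power_divide)
  finally show ?case by simp
qed (simp add: cbin_def)

text \<open>The partial products in Wallis' formula are central binomials in disguise; this is how
  \<open>pi\<close> enters.\<close>

lemma wallis_prod_eq: "(\<Prod>k=1..n. (4 * real k ^ 2) / (4 * real k ^ 2 - 1)) = 1 / ((cbin n)\<^sup>2 * (2 * real n + 1))"
proof (induction n)
  case (Suc n)
  define x where "x = real n"
  have x: "0 \<le> x" by (simp add: x_def)
  have "4 * (x + 1)\<^sup>2 - 1 = (2 * x + 1) * (2 * x + 3)" by (simp add: power2_eq_square algebra_simps)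
  then show ?case using Suc cbin_pos[of n] x unfolding prod.nat_ivl_Suc'[of 1 n, simplified] cbin_Suc
    by (simp add: x_def[symmetric] add.commute power_mult_distrib power_divide) (simp add: divide_simps power2_eq_square, simp add: algebra_simps)
qed (simp add: cbin_def)

lemma cbin_sqrt_limit: "(\<lambda>n. cbin n * sqrt (real n)) \<longlonglongrightarrow> 1 / sqrt pi"
proof -
  have "(\<lambda>n. (cbin n)\<^sup>2 * (2 * real n + 1)) \<longlonglongrightarrow> inverse (pi / 2)"
    using tendsto_inverse[OF wallis] unfolding wallis_prod_eq by simp
  moreover have "(\<lambda>n. real n / (2 * real n + 1)) \<longlonglongrightarrow> 1 / 2" by real_asymp
  ultimately have "(\<lambda>n. (cbin n)\<^sup>2 * (2 * real n + 1) * (real n / (2 * real n + 1))) \<longlonglongrightarrow> inverse (pi / 2) * (1 / 2)"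
    by (rule tendsto_mult)
  moreover have "(cbin n)\<^sup>2 * (2 * real n + 1) * (real n / (2 * real n + 1)) = (cbin n)\<^sup>2 * real n" for n
  proof -
    have "2 * real n + 1 \<noteq> 0" by linarith
    then show ?thesis by simp
  qed
  ultimately have "(\<lambda>n. (cbin n)\<^sup>2 * real n) \<longlonglongrightarrow> 1 / pi" by simp
  then have "(\<lambda>n. sqrt ((cbin n)\<^sup>2 * real n)) \<longlonglongrightarrow> sqrt (1 / pi)" by (rule tendsto_real_sqrt)
  moreover have "sqrt ((cbin n)\<^sup>2 * real n) = cbin n * sqrt (real n)" for n
    using cbin_pos[of n] by (simp add: real_sqrt_mult)
  ultimately show ?thesis by (simp add: real_sqrt_divide)
qed

lemma fact_shift_limit: "(\<lambda>r. fact (k + r) / (fact r * real r ^ k)) \<longlonglongrightarrow> 1"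
proof (induction k)
  case (Suc k)
  have "(\<lambda>r. (real k + real r + 1) / real r) \<longlonglongrightarrow> 1" by real_asymp
  from tendsto_mult[OF this Suc] have "(\<lambda>r. (real k + real r + 1) / real r * (fact (k + r) / (fact r * real r ^ k))) \<longlonglongrightarrow> 1" by simp
  then show ?case by (simp add: field_simps)
next
  case 0
  have "eventually (\<lambda>r::nat. fact (0 + r) / (fact r * real r ^ 0) = (1::real)) sequentially" by simp
  then show ?case by (simp add: tendsto_eventually)
qed

lemma fact_pred_shift_limit: "(\<lambda>s. fact (k + s - 1) * real s / (fact s * real s ^ k)) \<longlonglongrightarrow> 1"
proof (rule Lim_transform_eventually)
  show "(\<lambda>s. fact (k + s) / (fact s * real s ^ k) * (real s / (real k + real s))) \<longlonglongrightarrow> 1"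
  proof -
    have "(\<lambda>s. real s / (real k + real s)) \<longlonglongrightarrow> 1" by real_asymp
    from tendsto_mult[OF fact_shift_limit[of k] this] show ?thesis by simp
  qed
  show "\<forall>\<^sub>F s in sequentially. fact (k + s) / (fact s * real s ^ k) * (real s / (real k + real s)) = fact (k + s - 1) * real s / (fact s * real s ^ k)"
    using eventually_gt_at_top[of 0]
  proof eventually_elim
    case (elim s)
    then obtain s' where s: "s = Suc s'" using gr0_conv_Suc by blast
    have "fact (k + s) = (real k + real s) * fact (k + s - 1)" unfolding s by (simp add: algebra_simps)
    moreover have "real k + real s \<noteq> 0" using elim by simp
    ultimately show ?case by (simp add: divide_simps mult_ac)
  qed
qed

section \<open>Riemann sums with an integrable singularity\<close>

lemma nat_floor_bounds:
  assumes "0 \<le> (x::real)"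
  shows "real (nat \<lfloor>x\<rfloor>) \<le> x" "x < real (nat \<lfloor>x\<rfloor>) + 1" "x < real m \<Longrightarrow> nat \<lfloor>x\<rfloor> < m"
proof -
  have "real (nat \<lfloor>x\<rfloor>) = of_int \<lfloor>x\<rfloor>" using assms by simp
  then show "real (nat \<lfloor>x\<rfloor>) \<le> x" "x < real (nat \<lfloor>x\<rfloor>) + 1" by linarith+
  then show "x < real m \<Longrightarrow> nat \<lfloor>x\<rfloor> < m" by linarith
qed

lemma has_bochner_integral_step_function:
  fixes f :: "nat \<Rightarrow> real"
  assumes "0 < s"
  shows "has_bochner_integral lborel (\<lambda>\<sigma>. indicator {0..<1} \<sigma> * f (nat \<lfloor>real s * \<sigma>\<rfloor>)) ((\<Sum>r<s. f r) / real s)"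
proof -
  have 1: "indicator {0..<1} \<sigma> * f (nat \<lfloor>real s * \<sigma>\<rfloor>) = (\<Sum>r<s. f r * indicator {real r / real s..<(real r + 1) / real s} \<sigma>)" for \<sigma>
  proof (cases "0 \<le> \<sigma> \<and> \<sigma> < 1")
    case True
    define q where "q = nat \<lfloor>real s * \<sigma>\<rfloor>"
    have "real s * \<sigma> < real s" using True assms by simp
    then have q: "real q \<le> real s * \<sigma>" "real s * \<sigma> < real q + 1" "q < s"
      using True nat_floor_bounds[of "real s * \<sigma>"] by (auto simp: q_def)
    have "indicator {real r / real s..<(real r + 1) / real s} \<sigma> = (if r = q then 1 else 0 :: real)" for r
    proof -
      have "\<sigma> \<in> {real r / real s..<(real r + 1) / real s} \<longleftrightarrow> real r \<le> real s * \<sigma> \<and> real s * \<sigma> < real r + 1"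
        using assms by (auto simp: field_simps)
      also have "\<dots> \<longleftrightarrow> r = q" using q by auto
      finally show ?thesis by (simp add: indicator_def)
    qed
    then have "(\<Sum>r<s. f r * indicator {real r / real s..<(real r + 1) / real s} \<sigma>) = (\<Sum>r<s. if r = q then f r else 0)"
      by (intro sum.cong) auto
    then show ?thesis using q True by (simp add: q_def[symmetric])
  next
    case False
    have "indicator {real r / real s..<(real r + 1) / real s} \<sigma> = (0 :: real)" if "r < s" for r
    proof -
      have "0 \<le> real r / real s" "(real r + 1) / real s \<le> 1" using that assms by (auto simp: divide_simps)
      then have "\<sigma> \<notin> {real r / real s..<(real r + 1) / real s}" using False unfolding atLeastLessThan_iff by linarith
      then show ?thesis by simp
    qed
    then have "(\<Sum>r<s. f r * indicator {real r / real s..<(real r + 1) / real s} \<sigma>) = 0" by (intro sum.neutral) simp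
    then show ?thesis using False by simp
  qed
  have "has_bochner_integral lborel (\<lambda>\<sigma>. \<Sum>r<s. f r * indicator {real r / real s..<(real r + 1) / real s} \<sigma>)
     (\<Sum>r<s. f r * measure lborel {real r / real s..<(real r + 1) / real s})"
    by (intro has_bochner_integral_sum has_bochner_integral_mult_right has_bochner_integral_real_indicator) (auto simp: divide_right_mono)
  also have "(\<Sum>r<s. f r * measure lborel {real r / real s..<(real r + 1) / real s}) = (\<Sum>r<s. f r / real s)"
    using assms by (intro sum.cong) (auto simp: divide_right_mono diff_divide_distrib[symmetric])
  also have "\<dots> = (\<Sum>r<s. f r) / real s" by (simp add: sum_divide_distrib)
  finally show ?thesis unfolding 1 .
qed

text \<open>The integrand of the Beta function with parameters 1 and 1/2, up to the null set of the
  endpoints.\<close>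

lemma integrable_inverse_sqrt: "integrable lborel (\<lambda>\<sigma>::real. indicator {0..<1} \<sigma> * (1 / sqrt (1 - \<sigma>)))"
proof -
  have "set_integrable lborel {0..1} (\<lambda>t::real. t powr (1 - 1) * (1 - t) powr (1 / 2 - 1))"
    by (rule integrable_Beta) auto
  then have "integrable lborel (\<lambda>t::real. indicator {0..1} t * (t powr 0 * (1 - t) powr (- 1 / 2)))"
    by (simp add: set_integrable_def)
  then show ?thesis
  proof (rule integrable_cong_AE_imp)
    have "AE t in lborel. t \<noteq> (0::real)" "AE t in lborel. t \<noteq> (1::real)" by (rule AE_lborel_singleton)+
    then show "AE t in lborel. indicator {0..1} t * (t powr 0 * (1 - t) powr (- 1 / 2)) = indicator {0..<1} t * (1 / sqrt (1 - t :: real))"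
    proof eventually_elim
      case (elim t)
      show ?case
      proof (cases "0 \<le> t \<and> t \<le> 1")
        case True
        then have "0 < 1 - t" "0 < t" using elim by auto
        have "(1 - t) powr (- (1 / 2)) = inverse ((1 - t) powr (1 / 2))" by (rule powr_minus)
        also have "(1 - t) powr (1 / 2) = sqrt (1 - t)" using \<open>0 < 1 - t\<close> by (intro powr_half_sqrt) simp
        finally have p: "(1 - t) powr (- 1 / 2) = 1 / sqrt (1 - t)" by (simp only: minus_divide_left inverse_eq_divide)
        have "indicator {0..1} t = (1 :: real)" "indicator {0..<1} t = (1 :: real)" "t powr 0 = 1"
          using \<open>0 < 1 - t\<close> \<open>0 < t\<close> by simp_all
        then show ?thesis unfolding p by (simp only: mult_1)
      qed (auto simp: indicator_def)
    qed
  qed simp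
qed

text \<open>The sum is the integral of a step function, so dominated convergence applies. It is
  needed because the odd density is unbounded at 1, where uniform convergence of Riemann sums fails;
  the bound \<open>C / sqrt (1 - \<sigma>)\<close> is integrable.\<close>

lemma riemann_sum_dominated:
  fixes t :: "nat \<Rightarrow> nat \<Rightarrow> real" and \<phi> :: "real \<Rightarrow> real"
  assumes \<tau>: "0 < \<tau>" "\<tau> < 1"
    and s: "filterlim s at_top sequentially" "\<And>i. 0 < s i"
    and lo: "(\<lambda>i. real (lo i) / real (s i)) \<longlonglongrightarrow> \<tau>"
    and lim: "\<And>\<sigma>. \<tau> < \<sigma> \<Longrightarrow> \<sigma> < 1 \<Longrightarrow> (\<lambda>m. real m * t m (nat \<lfloor>real m * \<sigma>\<rfloor>)) \<longlonglongrightarrow> \<phi> \<sigma>"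
    and bd: "\<And>i r. lo i \<le> r \<Longrightarrow> r < s i \<Longrightarrow> \<bar>real (s i) * t (s i) r\<bar> \<le> C / sqrt (1 - real r / real (s i))"
    and C: "0 \<le> C"
    and meas: "(\<lambda>\<sigma>. indicator {\<tau><..<1} \<sigma> * \<phi> \<sigma>) \<in> borel_measurable lborel"
  shows "integrable lborel (\<lambda>\<sigma>. indicator {\<tau><..<1} \<sigma> * \<phi> \<sigma>)"
    and "(\<lambda>i. \<Sum>r\<in>{lo i..<s i}. t (s i) r) \<longlonglongrightarrow> (LINT \<sigma>|lborel. indicator {\<tau><..<1} \<sigma> * \<phi> \<sigma>)"
proof -
  define f where "f = (\<lambda>i r. if lo i \<le> r then real (s i) * t (s i) r else 0)"
  define F where "F = (\<lambda>i \<sigma>. indicator {0..<1} \<sigma> * f i (nat \<lfloor>real (s i) * \<sigma>\<rfloor>))"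
  define w where "w = (\<lambda>\<sigma>::real. C * (indicator {0..<1} \<sigma> * (1 / sqrt (1 - \<sigma>))))"
  have F: "has_bochner_integral lborel (F i) ((\<Sum>r<s i. f i r) / real (s i))" for i
    unfolding F_def by (rule has_bochner_integral_step_function) (rule s)
  have Fsum: "(\<Sum>r<s i. f i r) / real (s i) = (\<Sum>r\<in>{lo i..<s i}. t (s i) r)" for i
  proof -
    have "(\<Sum>r<s i. f i r) = (\<Sum>r\<in>{r \<in> {..<s i}. lo i \<le> r}. real (s i) * t (s i) r)"
      unfolding f_def by (rule sum.inter_filter[symmetric]) simp
    also have "{r \<in> {..<s i}. lo i \<le> r} = {lo i..<s i}" by auto
    finally show ?thesis using s(2)[of i] by (simp flip: sum_distrib_left)
  qed
  have w: "integrable lborel w" unfolding w_def by (intro integrable_mult_right integrable_inverse_sqrt)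
  have ptw: "(\<lambda>i. F i \<sigma>) \<longlonglongrightarrow> indicator {\<tau><..<1} \<sigma> * \<phi> \<sigma>" if "\<sigma> \<noteq> \<tau>" for \<sigma>
  proof -
    have "(\<sigma> < 0 \<or> 1 \<le> \<sigma>) \<or> (0 \<le> \<sigma> \<and> \<sigma> < \<tau>) \<or> (\<tau> < \<sigma> \<and> \<sigma> < 1)" using that by linarith
    then consider "\<sigma> < 0 \<or> 1 \<le> \<sigma>" | "0 \<le> \<sigma>" "\<sigma> < \<tau>" | "\<tau> < \<sigma>" "\<sigma> < 1" by blast
    then show ?thesis
    proof cases
      case 1
      then have "F i \<sigma> = 0" for i unfolding F_def by auto
      moreover have "indicator {\<tau><..<1} \<sigma> = (0::real)" using 1 \<tau> by auto
      ultimately show ?thesis by simp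
    next
      case 2
      have "eventually (\<lambda>i. \<sigma> < real (lo i) / real (s i)) sequentially" using order_tendstoD(1)[OF lo 2(2)] .
      then have "eventually (\<lambda>i. F i \<sigma> = 0) sequentially"
      proof eventually_elim
        case (elim i)
        then have "real (s i) * \<sigma> < real (lo i)" using s(2)[of i] by (simp add: field_simps)
        then have "\<not> lo i \<le> nat \<lfloor>real (s i) * \<sigma>\<rfloor>" using 2 by (auto simp: le_nat_iff le_floor_iff)
        then show ?case unfolding F_def f_def by simp
      qed
      then show ?thesis using 2 by (simp add: tendsto_eventually)
    next
      case 3
      \<comment> \<open>A number strictly between \<open>\<tau>\<close> and \<open>\<sigma>\<close>
        makes sure that eventually the index belonging to \<open>\<sigma>\<close> is not below the
        lower limit of summation.\<close>
      obtain \<rho> where \<rho>: "\<tau> < \<rho>" "\<rho> < \<sigma>" using dense 3 by blast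
      have "eventually (\<lambda>i. real (lo i) / real (s i) < \<rho>) sequentially" using order_tendstoD(2)[OF lo \<rho>(1)] .
      moreover have "filterlim (\<lambda>i. real (s i)) at_top sequentially"
        using filterlim_compose[OF filterlim_real_sequentially s(1)] .
      then have "eventually (\<lambda>i. 1 / (\<sigma> - \<rho>) \<le> real (s i)) sequentially" by (simp add: filterlim_at_top)
      ultimately have ev: "eventually (\<lambda>i. F i \<sigma> = real (s i) * t (s i) (nat \<lfloor>real (s i) * \<sigma>\<rfloor>)) sequentially"
      proof eventually_elim
        case (elim i)
        have "real (lo i) < \<rho> * real (s i)" using elim(1) s(2)[of i] by (simp add: field_simps)
        moreover have "1 \<le> real (s i) * (\<sigma> - \<rho>)" using elim(2) \<rho> by (simp add: field_simps)
        ultimately have "real (lo i) \<le> real (s i) * \<sigma>" by (simp add: algebra_simps)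
        then have "lo i \<le> nat \<lfloor>real (s i) * \<sigma>\<rfloor>" using 3 \<tau> by (auto simp: le_nat_iff le_floor_iff)
        then show ?case using 3 \<tau> unfolding F_def f_def by simp
      qed
      have "(\<lambda>i. real (s i) * t (s i) (nat \<lfloor>real (s i) * \<sigma>\<rfloor>)) \<longlonglongrightarrow> \<phi> \<sigma>"
        using filterlim_compose[OF lim[OF 3] s(1)] .
      then have "(\<lambda>i. F i \<sigma>) \<longlonglongrightarrow> \<phi> \<sigma>" by (rule Lim_transform_eventually) (use ev in \<open>auto elim: eventually_mono\<close>)
      then show ?thesis using 3 by simp
    qed
  qed
  have "AE \<sigma> in lborel. \<sigma> \<noteq> \<tau>" by (rule AE_lborel_singleton)
  then have ae: "AE \<sigma> in lborel. (\<lambda>i. F i \<sigma>) \<longlonglongrightarrow> indicator {\<tau><..<1} \<sigma> * \<phi> \<sigma>"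
    by eventually_elim (rule ptw)
  have bound: "norm (F i \<sigma>) \<le> w \<sigma>" for i \<sigma>
  proof (cases "0 \<le> \<sigma> \<and> \<sigma> < 1 \<and> lo i \<le> nat \<lfloor>real (s i) * \<sigma>\<rfloor>")
    case True
    define r where "r = nat \<lfloor>real (s i) * \<sigma>\<rfloor>"
    have "real (s i) * \<sigma> < real (s i)" using True s(2)[of i] by simp
    then have r: "real r \<le> real (s i) * \<sigma>" "r < s i" using True nat_floor_bounds[of "real (s i) * \<sigma>"] by (auto simp: r_def)
    \<comment> \<open>Rounding down moves away from the singularity at 1, so the bound at r / s is
      below the one at \<open>\<sigma>\<close>.\<close>
    have "real r / real (s i) \<le> \<sigma>" using r(1) s(2)[of i] by (simp add: field_simps)
    then have "C / sqrt (1 - real r / real (s i)) \<le> C / sqrt (1 - \<sigma>)"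
      using C True by (intro divide_left_mono mult_pos_pos) auto
    then have "\<bar>real (s i) * t (s i) r\<bar> \<le> C / sqrt (1 - \<sigma>)" using bd[of i r] True r by (simp add: r_def[symmetric])
    then show ?thesis using True unfolding F_def f_def w_def by (simp add: r_def[symmetric])
  next
    case False
    then have "F i \<sigma> = 0" unfolding F_def f_def by auto
    moreover have "0 \<le> w \<sigma>" unfolding w_def using C by (auto simp: indicator_def)
    ultimately show ?thesis by simp
  qed
  have Fm: "F i \<in> borel_measurable lborel" for i using F[of i] by (auto dest: has_bochner_integral_integrable borel_measurable_integrable)
  show "integrable lborel (\<lambda>\<sigma>. indicator {\<tau><..<1} \<sigma> * \<phi> \<sigma>)"
    by (rule integrable_dominated_convergence[OF meas Fm w ae]) (use bound in auto)
  have "(\<lambda>i. LINT \<sigma>|lborel. F i \<sigma>) \<longlonglongrightarrow> (LINT \<sigma>|lborel. indicator {\<tau><..<1} \<sigma> * \<phi> \<sigma>)"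
    by (rule integral_dominated_convergence[OF meas Fm w ae]) (use bound in auto)
  then show "(\<lambda>i. \<Sum>r\<in>{lo i..<s i}. t (s i) r) \<longlonglongrightarrow> (LINT \<sigma>|lborel. indicator {\<tau><..<1} \<sigma> * \<phi> \<sigma>)"
    unfolding has_bochner_integral_integral_eq[OF F] Fsum .
qed

section \<open>Limits and bounds of the terms, factor by factor\<close>

definition fact_ratio :: "nat \<Rightarrow> nat \<Rightarrow> real" where
  "fact_ratio k r = fact (k + r) / (fact r * real r ^ k)"

definition fact_pred_ratio :: "nat \<Rightarrow> nat \<Rightarrow> real" where
  "fact_pred_ratio k s = fact (k + s - 1) * real s / (fact s * real s ^ k)"

text \<open>Each factor is paired with its growth rate: central binomials with square roots,
  factorial quotients with powers. Every group then has its own limit, and its own bound, for r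
  proportional to s.\<close>

lemma even_term_factors:
  assumes "0 < r" "r < s"
  shows "real s * even_term k s r = 1 / 4 ^ k * ((2 * real k + 4 * real r + 1) / real r) * (cbin r * sqrt (real r))\<^sup>2 *
    (cbin (s - r) * sqrt (real (s - r))) * (1 / (cbin (k + r + s) * sqrt (real (k + r + s)))) *
    (sqrt (real (s - r)) * sqrt (real (k + r + s)) / real s) * (1 / fact_ratio k r)\<^sup>2 * (fact_pred_ratio k s)\<^sup>2 * ((real s / real r) ^ k)\<^sup>2"
proof -
  have alg: "y * (t / w * (sd * sd) * cb * ca\<^sup>2 / cc * (fr / fkr)\<^sup>2 * (fk / fs)\<^sup>2) =
      1 / w * (t / (sr * sr)) * (ca * sr)\<^sup>2 * (cb * sd) * (1 / (cc * sm)) * (sd * sm / y) * (1 / (fkr / (fr * xk)))\<^sup>2 * (fk * y / (fs * yk))\<^sup>2 * (yk / xk)\<^sup>2"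
    if "y > 0" "w > 0" "sr > 0" "sm > 0" "fkr > 0" "fr > 0" "fs > 0" "xk > 0" "yk > 0" "cc > 0"
    for y t w ca cb cc fr fkr fk fs sr sm sd xk yk :: real
    using that by (simp add: divide_simps) (simp add: power2_eq_square mult_ac)
  have sq: "sqrt (real (s - r)) * sqrt (real (s - r)) = real (s - r)" "sqrt (real r) * sqrt (real r) = real r" by simp_all
  note A = alg[where y = "real s" and t = "2 * real k + 4 * real r + 1" and w = "4 ^ k" and sd = "sqrt (real (s - r))" and
      sr = "sqrt (real r)" and sm = "sqrt (real (k + r + s))" and ca = "cbin r" and cb = "cbin (s - r)" and cc = "cbin (k + r + s)" and
      fr = "fact r" and fkr = "fact (k + r)" and fk = "fact (k + s - 1)" and fs = "fact s" and xk = "real r ^ k" and yk = "real s ^ k", unfolded sq]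
  show ?thesis
    unfolding even_term_def fact_ratio_def fact_pred_ratio_def power_divide[of "real s" "real r" k]
    by (rule A) (use assms in \<open>simp_all add: cbin_pos\<close>)
qed

lemma odd_term_factors:
  assumes "0 < p" "p < s"
  shows "real s * odd_term k s p = 2 / 4 ^ k * ((2 * real k + 4 * real p + 3) / real p) * (real s / (2 * real k + 2 * real p + 2 * real s + 1)) *
    (cbin (p + 1) * sqrt (real (p + 1)))\<^sup>2 * (cbin (s - 1 - p) / cbin (k + p + s)) * (real p * (real p + 1) / (real s)\<^sup>2) *
    (1 / fact_ratio k p)\<^sup>2 * (fact_pred_ratio k s)\<^sup>2 * ((real s / real p) ^ k)\<^sup>2"
proof -
  have alg: "y * (2 * t / T / w * c2 * c1\<^sup>2 / c3 * ((x + 1) * fp / fkp)\<^sup>2 * (fk / fs)\<^sup>2) =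
      2 / w * (t / x) * (y / T) * (c1\<^sup>2 * (x + 1)) * (c2 / c3) * (x * (x + 1) / y\<^sup>2) * (1 / (fkp / (fp * xk)))\<^sup>2 * (fk * y / (fs * yk))\<^sup>2 * (yk / xk)\<^sup>2"
    if "y > 0" "w > 0" "x > 0" "T > 0" "fkp > 0" "fp > 0" "fs > 0" "xk > 0" "yk > 0" "c3 > 0"
    for y t T w c1 c2 c3 x fp fkp fk fs xk yk :: real
    using that by (simp add: divide_simps) (simp add: power2_eq_square mult_ac)
  have f: "fact (p + 1) = (real p + 1) * fact p" by (simp add: algebra_simps)
  have sq: "(cbin (p + 1) * sqrt (real (p + 1)))\<^sup>2 = (cbin (p + 1))\<^sup>2 * (real p + 1)"
    by (simp add: power_mult_distrib)
  show ?thesis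
    unfolding odd_term_def fact_ratio_def fact_pred_ratio_def power_divide[of "real s" "real p" k] f sq
    by (rule alg) (use assms in \<open>simp_all add: cbin_pos add_pos_nonneg add_nonneg_pos\<close>)
qed

lemma fact_ratio_ge_1:
  assumes "0 < r" shows "1 \<le> fact_ratio k r"
proof -
  have "fact r * real r ^ k \<le> fact (k + r)"
  proof (induction k)
    case (Suc k)
    have "fact r * real r ^ Suc k = real r * (fact r * real r ^ k)" by simp
    also have "\<dots> \<le> (real k + real r + 1) * fact (k + r)" by (rule mult_mono) (use Suc in auto)
    also have "\<dots> = fact (Suc k + r)" by (simp add: algebra_simps)
    finally show ?case .
  qed simp
  then show ?thesis using assms by (simp add: fact_ratio_def le_divide_eq_1)
qed

lemma cbin_sqrt_le: "0 \<le> cbin j * sqrt (real j)" "cbin j * sqrt (real j) \<le> 1"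
proof -
  show "0 \<le> cbin j * sqrt (real j)" using cbin_pos[of j] by simp
  have "(cbin j)\<^sup>2 * real j \<le> (cbin j)\<^sup>2 * (2 * real j + 1)" by (rule mult_left_mono) auto
  then have "(cbin j * sqrt (real j))\<^sup>2 \<le> 1\<^sup>2" using cbin_upper[of j] by (simp add: power_mult_distrib)
  then show "cbin j * sqrt (real j) \<le> 1" by (rule power2_le_imp_le) simp
qed

lemma inverse_cbin_le: "1 / cbin m \<le> sqrt (4 * real m + 1)"
proof -
  have "1\<^sup>2 \<le> (cbin m * sqrt (4 * real m + 1))\<^sup>2" using cbin_lower[of m] by (simp add: power_mult_distrib)
  then have "1 \<le> cbin m * sqrt (4 * real m + 1)" by (rule power2_le_imp_le) (use cbin_pos[of m] in simp)
  then show ?thesis using cbin_pos[of m] by (simp add: divide_simps mult.commute)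
qed

lemma inverse_cbin_sqrt_le:
  assumes "0 < m" shows "1 / (cbin m * sqrt (real m)) \<le> 3"
proof -
  have "1 / (cbin m * sqrt (real m)) = (1 / cbin m) / sqrt (real m)" by simp
  also have "\<dots> \<le> sqrt (4 * real m + 1) / sqrt (real m)" by (rule divide_right_mono[OF inverse_cbin_le]) simp
  also have "\<dots> = sqrt ((4 * real m + 1) / real m)" by (simp add: real_sqrt_divide)
  also have "\<dots> \<le> sqrt (3\<^sup>2)" using assms by (intro real_sqrt_le_mono) (simp add: divide_simps)
  finally show ?thesis by simp
qed

lemma even_term_nonneg: "0 \<le> even_term k s r"
  unfolding even_term_def using cbin_pos by (intro mult_nonneg_nonneg divide_nonneg_nonneg) (auto simp: less_imp_le)

lemma odd_term_nonneg: "0 \<le> odd_term k s p"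
  unfolding odd_term_def using cbin_pos by (intro mult_nonneg_nonneg divide_nonneg_nonneg) (auto simp: less_imp_le)

lemma ratio_power_le:
  assumes "0 < r" "0 < \<theta>" "\<theta> * real s \<le> real r"
  shows "((real s / real r) ^ k)\<^sup>2 \<le> ((1 / \<theta>) ^ k)\<^sup>2"
proof -
  have "real s / real r \<le> 1 / \<theta>" using assms by (simp add: divide_simps mult.commute)
  then show ?thesis by (intro power_mono) auto
qed

text \<open>The constants are generous, since only their independence of r and s matters. The even
  terms are bounded outright; dividing by a root below 1 brings them into the form that
  \<open>riemann_sum_dominated\<close> expects.\<close>

lemma even_term_bound:
  assumes r: "0 < r" "r < s" and \<theta>: "0 < \<theta>" "\<theta> * real s \<le> real r" and B: "0 \<le> fact_pred_ratio k s" "fact_pred_ratio k s \<le> B"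
  shows "\<bar>real s * even_term k s r\<bar> \<le> (3 * (2 * real k + 5) * (real k + 2) * B\<^sup>2 * ((1 / \<theta>) ^ k)\<^sup>2) / sqrt (1 - real r / real s)"
proof -
  have b1: "1 / 4 ^ k \<le> (1::real)" by (simp add: divide_simps)
  have b2: "(2 * real k + 4 * real r + 1) / real r \<le> 2 * real k + 5"
  proof -
    have "2 * real k * 1 \<le> 2 * real k * real r" using r by (intro mult_left_mono) auto
    then have "2 * real k + 4 * real r + 1 \<le> (2 * real k + 5) * real r" using r by (simp add: algebra_simps)
    then show ?thesis using r by (simp add: divide_simps)
  qed
  have b3: "(cbin r * sqrt (real r))\<^sup>2 \<le> 1" using cbin_sqrt_le[of r] by (simp add: power_le_one)
  have b5: "1 / (cbin (k + r + s) * sqrt (real (k + r + s))) \<le> 3" by (rule inverse_cbin_sqrt_le) (use r in simp)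
  have b6: "sqrt (real (s - r)) * sqrt (real (k + r + s)) / real s \<le> real k + 2"
  proof -
    have "sqrt (real (s - r)) * sqrt (real (k + r + s)) \<le> sqrt (real s) * sqrt ((real k + 2) * real s)"
    proof (intro mult_mono real_sqrt_le_mono)
      have "real k * 1 \<le> real k * real s" using r by (intro mult_left_mono) auto
      then show "real (k + r + s) \<le> (real k + 2) * real s" using r by (simp add: algebra_simps)
    qed (use r in auto)
    also have "\<dots> = real s * sqrt (real k + 2)" by (simp add: real_sqrt_mult)
    also have "\<dots> \<le> real s * (real k + 2)"
      by (intro mult_left_mono real_le_lsqrt) (auto simp: power2_eq_square algebra_simps)
    finally show ?thesis using r by (simp add: divide_simps mult.commute)
  qed
  have b7: "(1 / fact_ratio k r)\<^sup>2 \<le> 1" using fact_ratio_ge_1[OF r(1), of k] by (intro power_le_one) auto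
  have b8: "(fact_pred_ratio k s)\<^sup>2 \<le> B\<^sup>2" using B by (intro power_mono)
  note b9 = ratio_power_le[OF r(1) \<theta>, of k]
  have cp: "0 \<le> cbin m" for m using cbin_pos[of m] by simp
  have "real s * even_term k s r \<le> 1 * (2 * real k + 5) * 1 * 1 * 3 * (real k + 2) * 1 * B\<^sup>2 * ((1 / \<theta>) ^ k)\<^sup>2"
    unfolding even_term_factors[OF r]
    by (intro mult_mono b1 b2 b3 cbin_sqrt_le b5 b6 b7 b8 b9) (use r cp in \<open>auto intro!: mult_nonneg_nonneg divide_nonneg_nonneg\<close>)
  also have "\<dots> = 3 * (2 * real k + 5) * (real k + 2) * B\<^sup>2 * ((1 / \<theta>) ^ k)\<^sup>2" (is "_ = ?C") by simp
  also have "\<dots> = ?C / 1" by simp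
  also have "\<dots> \<le> ?C / sqrt (1 - real r / real s)"
    using r by (intro divide_left_mono) (auto intro!: mult_nonneg_nonneg)
  finally show ?thesis using even_term_nonneg[of k s r] by simp
qed

lemma odd_term_bound:
  assumes p: "0 < p" "p < s" and \<theta>: "0 < \<theta>" "\<theta> * real s \<le> real p" and B: "0 \<le> fact_pred_ratio k s" "fact_pred_ratio k s \<le> B"
  shows "\<bar>real s * odd_term k s p\<bar> \<le> (2 * (2 * real k + 7) * sqrt (4 * real k + 9) * B\<^sup>2 * ((1 / \<theta>) ^ k)\<^sup>2) / sqrt (1 - real p / real s)"
proof -
  have b1: "2 / 4 ^ k \<le> (2::real)" by (simp add: divide_simps)
  have b2: "(2 * real k + 4 * real p + 3) / real p \<le> 2 * real k + 7"
  proof -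
    have "2 * real k * 1 \<le> 2 * real k * real p" using p by (intro mult_left_mono) auto
    then have "2 * real k + 4 * real p + 3 \<le> (2 * real k + 7) * real p" using p by (simp add: algebra_simps)
    then show ?thesis using p by (simp add: divide_simps)
  qed
  have b3: "real s / (2 * real k + 2 * real p + 2 * real s + 1) \<le> 1" by (simp add: divide_simps)
  have b4: "(cbin (p + 1) * sqrt (real (p + 1)))\<^sup>2 \<le> 1" using cbin_sqrt_le[of "p + 1"] by (simp only: power_le_one)
  \<comment> \<open>This factor causes the singularity of the odd density:
    \<open>cbin (s - 1 - p)\<close> is of order \<open>1 / sqrt (s - p)\<close>.\<close>
  have b5: "cbin (s - 1 - p) / cbin (k + p + s) \<le> sqrt (4 * real k + 9) / sqrt (1 - real p / real s)"
  proof -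
    let ?j = "s - 1 - p"
    have "(cbin ?j)\<^sup>2 * (real s - real p) \<le> (cbin ?j)\<^sup>2 * (2 * real ?j + 1)" using p by (intro mult_left_mono) auto
    then have "(cbin ?j * sqrt (real s - real p))\<^sup>2 \<le> 1\<^sup>2" using cbin_upper[of ?j] p by (simp add: power_mult_distrib)
    then have "cbin ?j * sqrt (real s - real p) \<le> 1" by (rule power2_le_imp_le) simp
    then have 1: "cbin ?j \<le> 1 / sqrt (real s - real p)" using p by (simp add: divide_simps)
    have "4 * real (k + p + s) + 1 \<le> (4 * real k + 9) * real s"
    proof -
      have "4 * real k * 1 \<le> 4 * real k * real s" using p by (intro mult_left_mono) auto
      then show ?thesis using p by (simp add: algebra_simps)
    qed
    then have 2: "1 / cbin (k + p + s) \<le> sqrt ((4 * real k + 9) * real s)"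
      using inverse_cbin_le[of "k + p + s"] by (meson order_trans real_sqrt_le_mono)
    have "cbin ?j * (1 / cbin (k + p + s)) \<le> 1 / sqrt (real s - real p) * sqrt ((4 * real k + 9) * real s)"
      by (intro mult_mono 1 2) (use p cbin_pos in \<open>auto simp: less_imp_le\<close>)
    also have "\<dots> = sqrt (4 * real k + 9) / sqrt (1 - real p / real s)"
    proof -
      have "real s - real p = real s * (1 - real p / real s)" using p by (simp add: algebra_simps)
      then have "sqrt (real s - real p) = sqrt (real s) * sqrt (1 - real p / real s)" by (metis real_sqrt_mult)
      then show ?thesis using p by (simp add: real_sqrt_mult)
    qed
    finally show ?thesis by simp
  qed
  have b6: "real p * (real p + 1) / (real s)\<^sup>2 \<le> 1"
  proof -
    have "real p * (real p + 1) \<le> real s * real s" using p by (intro mult_mono) auto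
    then show ?thesis using p by (simp add: divide_simps power2_eq_square)
  qed
  have b7: "(1 / fact_ratio k p)\<^sup>2 \<le> 1" using fact_ratio_ge_1[OF p(1), of k] by (intro power_le_one) auto
  have b8: "(fact_pred_ratio k s)\<^sup>2 \<le> B\<^sup>2" using B by (intro power_mono)
  note b9 = ratio_power_le[OF p(1) \<theta>, of k]
  have cp: "0 \<le> cbin m" for m using cbin_pos[of m] by simp
  have ps: "0 \<le> 1 - real p / real s" using p by simp
  have "real s * odd_term k s p \<le> 2 * (2 * real k + 7) * 1 * 1 * (sqrt (4 * real k + 9) / sqrt (1 - real p / real s)) * 1 * 1 * B\<^sup>2 * ((1 / \<theta>) ^ k)\<^sup>2"
    unfolding odd_term_factors[OF p]
    by (intro mult_mono b1 b2 b3 b4 b5 b6 b7 b8 b9) (use p cp ps in \<open>auto intro!: mult_nonneg_nonneg divide_nonneg_nonneg\<close>)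
  then show ?thesis using odd_term_nonneg[of k s p] by simp
qed

lemma eventually_pos_of_at_top:
  fixes f :: "'a \<Rightarrow> nat"
  assumes "filterlim f at_top F" shows "eventually (\<lambda>x. 0 < f x) F"
proof -
  have "eventually (\<lambda>x. 1 \<le> f x) F" using assms by (simp add: filterlim_at_top)
  then show ?thesis by (rule eventually_mono) simp
qed

text \<open>The 4 is the limit of (2k + 4r + 1) / r, and \<open>1 / pi\<close> is what remains of
  the four central binomial factors. The weight \<open>((1 / \<sigma>) ^ k)\<^sup>2 / 4 ^ k\<close>
  is kept apart from the factor that does not depend on k.\<close>

definition even_density :: "nat \<Rightarrow> real \<Rightarrow> real" where
  "even_density k \<sigma> = 4 / pi / 4 ^ k * ((1 / \<sigma>) ^ k)\<^sup>2 * sqrt ((1 - \<sigma>) * (1 + \<sigma>))"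

definition odd_density :: "nat \<Rightarrow> real \<Rightarrow> real" where
  "odd_density k \<sigma> = 4 / pi / 4 ^ k * ((1 / \<sigma>) ^ k)\<^sup>2 * (\<sigma>\<^sup>2 / sqrt ((1 - \<sigma>) * (1 + \<sigma>)))"

context
  fixes \<sigma> :: real
  assumes \<sigma>: "0 < \<sigma>" "\<sigma> < 1"
begin

lemma nat_floor_ratio: "(\<lambda>s. real (nat \<lfloor>real s * \<sigma>\<rfloor>) / real s) \<longlonglongrightarrow> \<sigma>"
proof (rule tendsto_sandwich)
  have *: "real (nat \<lfloor>real s * \<sigma>\<rfloor>) \<le> real s * \<sigma>" "real s * \<sigma> < real (nat \<lfloor>real s * \<sigma>\<rfloor>) + 1" for s
    using nat_floor_bounds(1,2)[of "real s * \<sigma>"] \<sigma> by auto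
  show "\<forall>\<^sub>F s in sequentially. \<sigma> - 1 / real s \<le> real (nat \<lfloor>real s * \<sigma>\<rfloor>) / real s"
    using eventually_gt_at_top[of 0]
  proof eventually_elim
    case (elim s)
    have "(real s * \<sigma> - 1) / real s \<le> real (nat \<lfloor>real s * \<sigma>\<rfloor>) / real s"
      by (rule divide_right_mono) (use *(2)[of s] in linarith, simp)
    then show ?case using elim by (simp add: diff_divide_distrib)
  qed
  show "\<forall>\<^sub>F s in sequentially. real (nat \<lfloor>real s * \<sigma>\<rfloor>) / real s \<le> \<sigma>"
    using eventually_gt_at_top[of 0]
  proof eventually_elim
    case (elim s)
    then show ?case using *(1)[of s] by (simp add: field_simps)
  qed
  show "(\<lambda>s. \<sigma> - 1 / real s) \<longlonglongrightarrow> \<sigma>" by real_asymp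
qed simp

lemma nat_floor_at_top: "filterlim (\<lambda>s. nat \<lfloor>real s * \<sigma>\<rfloor>) at_top sequentially"
  unfolding filterlim_at_top
proof
  fix Z :: nat
  have "eventually (\<lambda>s. real Z / \<sigma> \<le> real s) sequentially"
    using filterlim_real_sequentially by (simp add: filterlim_at_top)
  then show "eventually (\<lambda>s. Z \<le> nat \<lfloor>real s * \<sigma>\<rfloor>) sequentially"
  proof eventually_elim
    case (elim s)
    then have "real Z \<le> real s * \<sigma>" using \<sigma> by (simp add: field_simps)
    then show ?case using \<sigma> by (simp add: le_nat_iff le_floor_iff)
  qed
qed

lemma nat_floor_less_eventually: "eventually (\<lambda>s. nat \<lfloor>real s * \<sigma>\<rfloor> < s) sequentially"
  using eventually_gt_at_top[of 0]
proof eventually_elim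
  case (elim s)
  then show ?case using nat_floor_bounds(3)[of "real s * \<sigma>" s] \<sigma> by simp
qed

lemma diff_nat_floor_at_top: "filterlim (\<lambda>s. s - c - nat \<lfloor>real s * \<sigma>\<rfloor>) at_top sequentially"
  unfolding filterlim_at_top
proof
  fix Z :: nat
  have "eventually (\<lambda>s. (real Z + real c) / (1 - \<sigma>) \<le> real s) sequentially"
    using filterlim_real_sequentially by (simp add: filterlim_at_top)
  then show "eventually (\<lambda>s. Z \<le> s - c - nat \<lfloor>real s * \<sigma>\<rfloor>) sequentially"
  proof eventually_elim
    case (elim s)
    then have "real Z + real c \<le> real s * (1 - \<sigma>)" using \<sigma> by (simp add: field_simps)
    moreover have "real (nat \<lfloor>real s * \<sigma>\<rfloor>) \<le> real s * \<sigma>" by (rule nat_floor_bounds) (use \<sigma> in simp)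
    ultimately have "real Z + real c + real (nat \<lfloor>real s * \<sigma>\<rfloor>) \<le> real s" unfolding right_diff_distrib by linarith
    then show ?case by linarith
  qed
qed

lemma common_limits:
  assumes r: "r = (\<lambda>s. nat \<lfloor>real s * \<sigma>\<rfloor>)"
  shows "(\<lambda>s. (1 / fact_ratio k (r s))\<^sup>2 * (fact_pred_ratio k s)\<^sup>2 * ((real s / real (r s)) ^ k)\<^sup>2) \<longlonglongrightarrow> ((1 / \<sigma>) ^ k)\<^sup>2"
    and "(\<lambda>s. 1 / (cbin (k + r s + s) * sqrt (real (k + r s + s)))) \<longlonglongrightarrow> sqrt pi"
proof -
  have "(\<lambda>s. fact_ratio k (r s)) \<longlonglongrightarrow> 1"
    using filterlim_compose[OF fact_shift_limit nat_floor_at_top] unfolding fact_ratio_def r .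
  then have "(\<lambda>s. (1 / fact_ratio k (r s))\<^sup>2) \<longlonglongrightarrow> (1 / 1)\<^sup>2" by (intro tendsto_intros) auto
  moreover have "(\<lambda>s. (fact_pred_ratio k s)\<^sup>2) \<longlonglongrightarrow> 1\<^sup>2"
    using fact_pred_shift_limit[of k] unfolding fact_pred_ratio_def by (intro tendsto_intros)
  moreover have "(\<lambda>s. inverse (real (r s) / real s)) \<longlonglongrightarrow> inverse \<sigma>"
    using nat_floor_ratio \<sigma> unfolding r by (intro tendsto_inverse) auto
  then have "(\<lambda>s. real s / real (r s)) \<longlonglongrightarrow> 1 / \<sigma>" by (simp add: inverse_eq_divide)
  then have "(\<lambda>s. ((real s / real (r s)) ^ k)\<^sup>2) \<longlonglongrightarrow> ((1 / \<sigma>) ^ k)\<^sup>2" by (intro tendsto_power)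
  ultimately have "(\<lambda>s. (1 / fact_ratio k (r s))\<^sup>2 * (fact_pred_ratio k s)\<^sup>2 * ((real s / real (r s)) ^ k)\<^sup>2) \<longlonglongrightarrow> (1 / 1)\<^sup>2 * 1\<^sup>2 * ((1 / \<sigma>) ^ k)\<^sup>2"
    by (intro tendsto_mult)
  then show "(\<lambda>s. (1 / fact_ratio k (r s))\<^sup>2 * (fact_pred_ratio k s)\<^sup>2 * ((real s / real (r s)) ^ k)\<^sup>2) \<longlonglongrightarrow> ((1 / \<sigma>) ^ k)\<^sup>2" by simp
  have "filterlim (\<lambda>s. k + r s + s) at_top sequentially"
    by (rule filterlim_at_top_mono[OF filterlim_ident]) simp
  then have "(\<lambda>s. cbin (k + r s + s) * sqrt (real (k + r s + s))) \<longlonglongrightarrow> 1 / sqrt pi"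
    by (rule filterlim_compose[OF cbin_sqrt_limit])
  then have "(\<lambda>s. inverse (cbin (k + r s + s) * sqrt (real (k + r s + s)))) \<longlonglongrightarrow> inverse (1 / sqrt pi)"
    by (rule tendsto_inverse) simp
  then show "(\<lambda>s. 1 / (cbin (k + r s + s) * sqrt (real (k + r s + s)))) \<longlonglongrightarrow> sqrt pi"
    by (simp add: inverse_eq_divide)
qed

lemma even_term_limit: "(\<lambda>s. real s * even_term k s (nat \<lfloor>real s * \<sigma>\<rfloor>)) \<longlonglongrightarrow> even_density k \<sigma>"
proof -
  define r where "r = (\<lambda>s. nat \<lfloor>real s * \<sigma>\<rfloor>)"
  note com = common_limits[OF r_def, of k]
  have rtop: "filterlim r at_top sequentially" unfolding r_def by (rule nat_floor_at_top)
  have "(\<lambda>r. (2 * real k + 4 * real r + 1) / real r) \<longlonglongrightarrow> 4" by real_asymp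
  then have l1: "(\<lambda>s. (2 * real k + 4 * real (r s) + 1) / real (r s)) \<longlonglongrightarrow> 4" by (rule filterlim_compose[OF _ rtop])
  have l2: "(\<lambda>s. (cbin (r s) * sqrt (real (r s)))\<^sup>2) \<longlonglongrightarrow> (1 / sqrt pi)\<^sup>2"
    by (intro tendsto_power filterlim_compose[OF cbin_sqrt_limit rtop])
  have l3: "(\<lambda>s. cbin (s - r s) * sqrt (real (s - r s))) \<longlonglongrightarrow> 1 / sqrt pi"
    using filterlim_compose[OF cbin_sqrt_limit diff_nat_floor_at_top[of 0]] by (simp add: r_def)
  have l4: "(\<lambda>s. sqrt (real (s - r s)) * sqrt (real (k + r s + s)) / real s) \<longlonglongrightarrow> sqrt ((1 - \<sigma>) * (1 + \<sigma>))"
  proof (rule Lim_transform_eventually)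
    have "(\<lambda>s. real k / real s) \<longlonglongrightarrow> 0" by real_asymp
    then have "(\<lambda>s. sqrt ((1 - real (r s) / real s) * (real k / real s + real (r s) / real s + 1))) \<longlonglongrightarrow> sqrt ((1 - \<sigma>) * (0 + \<sigma> + 1))"
      using nat_floor_ratio unfolding r_def by (intro tendsto_intros)
    then show "(\<lambda>s. sqrt ((1 - real (r s) / real s) * (real k / real s + real (r s) / real s + 1))) \<longlonglongrightarrow> sqrt ((1 - \<sigma>) * (1 + \<sigma>))"
      by (simp add: add.commute)
    show "\<forall>\<^sub>F s in sequentially. sqrt ((1 - real (r s) / real s) * (real k / real s + real (r s) / real s + 1)) =
        sqrt (real (s - r s)) * sqrt (real (k + r s + s)) / real s"
      using nat_floor_less_eventually
    proof eventually_elim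
      case (elim s)
      then have rs: "r s < s" by (simp add: r_def)
      then have "(1 - real (r s) / real s) * (real k / real s + real (r s) / real s + 1) = (real (s - r s) * real (k + r s + s)) / (real s)\<^sup>2"
        by (simp add: of_nat_diff field_simps power2_eq_square)
      then show ?case using rs by (simp add: real_sqrt_mult real_sqrt_divide)
    qed
  qed
  have "(\<lambda>s. 1 / 4 ^ k * ((2 * real k + 4 * real (r s) + 1) / real (r s)) * (cbin (r s) * sqrt (real (r s)))\<^sup>2 *
    (cbin (s - r s) * sqrt (real (s - r s))) * (1 / (cbin (k + r s + s) * sqrt (real (k + r s + s)))) *
    (sqrt (real (s - r s)) * sqrt (real (k + r s + s)) / real s) *
    ((1 / fact_ratio k (r s))\<^sup>2 * (fact_pred_ratio k s)\<^sup>2 * ((real s / real (r s)) ^ k)\<^sup>2))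
    \<longlonglongrightarrow> 1 / 4 ^ k * 4 * (1 / sqrt pi)\<^sup>2 * (1 / sqrt pi) * sqrt pi * sqrt ((1 - \<sigma>) * (1 + \<sigma>)) * ((1 / \<sigma>) ^ k)\<^sup>2"
    by (intro tendsto_mult tendsto_const l1 l2 l3 l4 com)
  moreover have "1 / 4 ^ k * 4 * (1 / sqrt pi)\<^sup>2 * (1 / sqrt pi) * sqrt pi * sqrt ((1 - \<sigma>) * (1 + \<sigma>)) * ((1 / \<sigma>) ^ k)\<^sup>2 = even_density k \<sigma>"
    by (simp add: even_density_def power_divide)
  ultimately have lim: "(\<lambda>s. 1 / 4 ^ k * ((2 * real k + 4 * real (r s) + 1) / real (r s)) * (cbin (r s) * sqrt (real (r s)))\<^sup>2 *
    (cbin (s - r s) * sqrt (real (s - r s))) * (1 / (cbin (k + r s + s) * sqrt (real (k + r s + s)))) *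
    (sqrt (real (s - r s)) * sqrt (real (k + r s + s)) / real s) *
    ((1 / fact_ratio k (r s))\<^sup>2 * (fact_pred_ratio k s)\<^sup>2 * ((real s / real (r s)) ^ k)\<^sup>2)) \<longlonglongrightarrow> even_density k \<sigma>"
    by (simp only:)
  have ev: "\<forall>\<^sub>F s in sequentially. 0 < r s" using rtop by (rule eventually_pos_of_at_top)
  show ?thesis
    unfolding r_def[symmetric, THEN fun_cong]
  proof (rule Lim_transform_eventually[OF lim])
    show "\<forall>\<^sub>F s in sequentially. 1 / 4 ^ k * ((2 * real k + 4 * real (r s) + 1) / real (r s)) * (cbin (r s) * sqrt (real (r s)))\<^sup>2 *
      (cbin (s - r s) * sqrt (real (s - r s))) * (1 / (cbin (k + r s + s) * sqrt (real (k + r s + s)))) *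
      (sqrt (real (s - r s)) * sqrt (real (k + r s + s)) / real s) *
      ((1 / fact_ratio k (r s))\<^sup>2 * (fact_pred_ratio k s)\<^sup>2 * ((real s / real (r s)) ^ k)\<^sup>2) = real s * even_term k s (r s)"
      using ev nat_floor_less_eventually
    proof eventually_elim
      case (elim s)
      have "r s < s" using elim(2) by (simp add: r_def)
      then show ?case unfolding even_term_factors[OF elim(1) \<open>r s < s\<close>] by (simp only: mult.assoc)
    qed
  qed
qed

lemma odd_term_limit: "(\<lambda>s. real s * odd_term k s (nat \<lfloor>real s * \<sigma>\<rfloor>)) \<longlonglongrightarrow> odd_density k \<sigma>"
proof -
  define p where "p = (\<lambda>s. nat \<lfloor>real s * \<sigma>\<rfloor>)"
  note com = common_limits[OF p_def, of k]
  have ptop: "filterlim p at_top sequentially" unfolding p_def by (rule nat_floor_at_top)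
  have rat: "(\<lambda>s. real (p s) / real s) \<longlonglongrightarrow> \<sigma>" unfolding p_def by (rule nat_floor_ratio)
  have kz: "(\<lambda>s. c / real s) \<longlonglongrightarrow> 0" for c by real_asymp
  have "(\<lambda>r. (2 * real k + 4 * real r + 3) / real r) \<longlonglongrightarrow> 4" by real_asymp
  then have l1: "(\<lambda>s. (2 * real k + 4 * real (p s) + 3) / real (p s)) \<longlonglongrightarrow> 4" by (rule filterlim_compose[OF _ ptop])
  have l2: "(\<lambda>s. real s / (2 * real k + 2 * real (p s) + 2 * real s + 1)) \<longlonglongrightarrow> 1 / (2 * \<sigma> + 2)"
  proof (rule Lim_transform_eventually)
    have "(\<lambda>s. 1 / (2 * (real (p s) / real s) + 2 + (2 * real k + 1) / real s)) \<longlonglongrightarrow> 1 / (2 * \<sigma> + 2 + 0)"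
      using \<sigma> by (intro tendsto_intros rat kz) auto
    then show "(\<lambda>s. 1 / (2 * (real (p s) / real s) + 2 + (2 * real k + 1) / real s)) \<longlonglongrightarrow> 1 / (2 * \<sigma> + 2)" by simp
    show "\<forall>\<^sub>F s in sequentially. 1 / (2 * (real (p s) / real s) + 2 + (2 * real k + 1) / real s) = real s / (2 * real k + 2 * real (p s) + 2 * real s + 1)"
      using eventually_gt_at_top[of 0]
    proof eventually_elim
      case (elim s)
      have "2 * (real (p s) / real s) + 2 + (2 * real k + 1) / real s = (2 * real k + 2 * real (p s) + 2 * real s + 1) / real s"
        using elim by (simp add: field_simps)
      then show ?case by simp
    qed
  qed
  have "filterlim (\<lambda>s. p s + 1) at_top sequentially" by (rule filterlim_at_top_mono[OF ptop]) simp
  then have l3: "(\<lambda>s. (cbin (p s + 1) * sqrt (real (p s + 1)))\<^sup>2) \<longlonglongrightarrow> (1 / sqrt pi)\<^sup>2"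
    by (intro tendsto_power filterlim_compose[OF cbin_sqrt_limit])
  have l4a: "(\<lambda>s. cbin (s - 1 - p s) * sqrt (real (s - 1 - p s))) \<longlonglongrightarrow> 1 / sqrt pi"
    using filterlim_compose[OF cbin_sqrt_limit diff_nat_floor_at_top[of 1]] by (simp add: p_def)
  have big: "\<forall>\<^sub>F s in sequentially. 0 < s - 1 - p s"
    using diff_nat_floor_at_top[of 1] unfolding p_def by (rule eventually_pos_of_at_top)
  have l4b: "(\<lambda>s. sqrt (real (k + p s + s)) / sqrt (real (s - 1 - p s))) \<longlonglongrightarrow> sqrt ((1 + \<sigma>) / (1 - \<sigma>))"
  proof (rule Lim_transform_eventually)
    have "(\<lambda>s. sqrt ((1 + real (p s) / real s + real k / real s) / (1 - real (p s) / real s - 1 / real s))) \<longlonglongrightarrow> sqrt ((1 + \<sigma> + 0) / (1 - \<sigma> - 0))"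
      using \<sigma> by (intro tendsto_intros rat kz) auto
    then show "(\<lambda>s. sqrt ((1 + real (p s) / real s + real k / real s) / (1 - real (p s) / real s - 1 / real s))) \<longlonglongrightarrow> sqrt ((1 + \<sigma>) / (1 - \<sigma>))" by simp
    show "\<forall>\<^sub>F s in sequentially. sqrt ((1 + real (p s) / real s + real k / real s) / (1 - real (p s) / real s - 1 / real s)) =
        sqrt (real (k + p s + s)) / sqrt (real (s - 1 - p s))"
      using big
    proof eventually_elim
      case (elim s)
      have "1 + real (p s) / real s + real k / real s = real (k + p s + s) / real s"
        "1 - real (p s) / real s - 1 / real s = real (s - 1 - p s) / real s"
        using elim by (simp_all add: of_nat_diff field_simps)
      then show ?case using elim by (simp add: real_sqrt_divide)
    qed
  qed
  have l4: "(\<lambda>s. cbin (s - 1 - p s) / cbin (k + p s + s)) \<longlonglongrightarrow> 1 / sqrt pi * sqrt pi * sqrt ((1 + \<sigma>) / (1 - \<sigma>))"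
  proof (rule Lim_transform_eventually[OF tendsto_mult[OF tendsto_mult[OF l4a com(2)] l4b]])
    show "\<forall>\<^sub>F s in sequentially. cbin (s - 1 - p s) * sqrt (real (s - 1 - p s)) * (1 / (cbin (k + p s + s) * sqrt (real (k + p s + s)))) *
        (sqrt (real (k + p s + s)) / sqrt (real (s - 1 - p s))) = cbin (s - 1 - p s) / cbin (k + p s + s)"
      using big
    proof eventually_elim
      case (elim s)
      have "sqrt (real (s - 1 - p s)) \<noteq> 0" "sqrt (real (k + p s + s)) \<noteq> 0" using elim by auto
      then show ?case by simp
    qed
  qed
  have l5: "(\<lambda>s. real (p s) * (real (p s) + 1) / (real s)\<^sup>2) \<longlonglongrightarrow> \<sigma> * \<sigma>"
  proof -
    have "(\<lambda>s. real (p s) / real s * (real (p s) / real s + 1 / real s)) \<longlonglongrightarrow> \<sigma> * (\<sigma> + 0)"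
      by (intro tendsto_intros rat kz)
    moreover have "real (p s) / real s * (real (p s) / real s + 1 / real s) = real (p s) * (real (p s) + 1) / (real s)\<^sup>2" for s
      by (simp add: power2_eq_square flip: add_divide_distrib)
    ultimately show ?thesis by simp
  qed
  have lim0: "(\<lambda>s. 2 / 4 ^ k * ((2 * real k + 4 * real (p s) + 3) / real (p s)) * (real s / (2 * real k + 2 * real (p s) + 2 * real s + 1)) *
    (cbin (p s + 1) * sqrt (real (p s + 1)))\<^sup>2 * (cbin (s - 1 - p s) / cbin (k + p s + s)) * (real (p s) * (real (p s) + 1) / (real s)\<^sup>2) *
    ((1 / fact_ratio k (p s))\<^sup>2 * (fact_pred_ratio k s)\<^sup>2 * ((real s / real (p s)) ^ k)\<^sup>2))
    \<longlonglongrightarrow> 2 / 4 ^ k * 4 * (1 / (2 * \<sigma> + 2)) * (1 / sqrt pi)\<^sup>2 * (1 / sqrt pi * sqrt pi * sqrt ((1 + \<sigma>) / (1 - \<sigma>))) * (\<sigma> * \<sigma>) * ((1 / \<sigma>) ^ k)\<^sup>2"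
    by (intro tendsto_mult tendsto_const l1 l2 l3 l4 l5 com)
  \<comment> \<open>The quotient of roots over 1 + \<open>\<sigma>\<close> collapses to the inverse
    root of the density.\<close>
  have dens: "2 / 4 ^ k * 4 * (1 / (2 * \<sigma> + 2)) * (1 / sqrt pi)\<^sup>2 * (1 / sqrt pi * sqrt pi * sqrt ((1 + \<sigma>) / (1 - \<sigma>))) * (\<sigma> * \<sigma>) * ((1 / \<sigma>) ^ k)\<^sup>2 = odd_density k \<sigma>"
  proof -
    have "(1 + \<sigma>) = sqrt (1 + \<sigma>) * sqrt (1 + \<sigma>)" using \<sigma> by simp
    then have "1 / (1 + \<sigma>) * sqrt ((1 + \<sigma>) / (1 - \<sigma>)) = 1 / sqrt ((1 - \<sigma>) * (1 + \<sigma>))"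
      using \<sigma> by (simp add: real_sqrt_divide real_sqrt_mult divide_simps)
    moreover have "2 / 4 ^ k * 4 * (1 / (2 * \<sigma> + 2)) * (1 / sqrt pi)\<^sup>2 * (1 / sqrt pi * sqrt pi * sqrt ((1 + \<sigma>) / (1 - \<sigma>))) * (\<sigma> * \<sigma>) * ((1 / \<sigma>) ^ k)\<^sup>2 =
      4 / pi / 4 ^ k * ((1 / \<sigma>) ^ k)\<^sup>2 * (\<sigma>\<^sup>2 * (1 / (1 + \<sigma>) * sqrt ((1 + \<sigma>) / (1 - \<sigma>))))"
    proof -
      define v where "v = 1 / (1 + \<sigma>)"
      have e: "1 / (2 * \<sigma> + 2) = 1 / 2 * v" using \<sigma> by (simp add: v_def field_simps)
      show ?thesis unfolding e v_def[symmetric] by (simp add: power_divide power2_eq_square mult_ac)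
    qed
    ultimately show ?thesis by (simp add: odd_density_def)
  qed
  have ev: "\<forall>\<^sub>F s in sequentially. 0 < p s" using ptop by (rule eventually_pos_of_at_top)
  show ?thesis
    unfolding p_def[symmetric, THEN fun_cong]
  proof (rule Lim_transform_eventually[OF lim0[unfolded dens]])
    show "\<forall>\<^sub>F s in sequentially. 2 / 4 ^ k * ((2 * real k + 4 * real (p s) + 3) / real (p s)) * (real s / (2 * real k + 2 * real (p s) + 2 * real s + 1)) *
      (cbin (p s + 1) * sqrt (real (p s + 1)))\<^sup>2 * (cbin (s - 1 - p s) / cbin (k + p s + s)) * (real (p s) * (real (p s) + 1) / (real s)\<^sup>2) *
      ((1 / fact_ratio k (p s))\<^sup>2 * (fact_pred_ratio k s)\<^sup>2 * ((real s / real (p s)) ^ k)\<^sup>2) = real s * odd_term k s (p s)"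
      using ev nat_floor_less_eventually
    proof eventually_elim
      case (elim s)
      have "p s < s" using elim(2) by (simp add: p_def)
      then show ?case unfolding odd_term_factors[OF elim(1) \<open>p s < s\<close>] by (simp only: mult.assoc)
    qed
  qed
qed

end

section \<open>The correlation\<close>

text \<open>With n = k + 2r the condition n \<ge> a reads r \<ge> (a - k) / 2, rounded up. For odd n
  - k the extra 1 in n = k + 2p + 1 turns the rounding into one downwards.\<close>

lemma even_kernel_eq:
  assumes "k \<le> a"
  shows "even_kernel a (k + 2 * s) k = (\<Sum>r\<in>{(a - k + 1) div 2..<s}. even_term k s r)"
  unfolding even_kernel_def
proof -
  have h: "2 * ((n - k) div 2) = n - k" "k + 2 * ((n - k) div 2) = n" "(n - k) div 2 < s" "(a - k + 1) div 2 \<le> (n - k) div 2"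
    if "n \<in> {n \<in> {a..<k + 2 * s}. even (n - k)}" for n
  proof -
    have n: "a \<le> n" "n < k + 2 * s" "even (n - k)" using that by auto
    show 1: "2 * ((n - k) div 2) = n - k" using n(3) by (rule dvd_mult_div_cancel)
    show "k + 2 * ((n - k) div 2) = n" "(n - k) div 2 < s" using 1 n assms by linarith+
    have "2 * d = m \<Longrightarrow> j \<le> m \<Longrightarrow> j + 1 < 2 * (d + 1)" for d m j :: nat by simp
    then have "a - k + 1 < 2 * ((n - k) div 2 + 1)" using 1 diff_le_mono[OF n(1)] by blast
    then have "(a - k + 1) div 2 < (n - k) div 2 + 1" by (intro less_mult_imp_div_less) (simp only: mult.commute)
    then show "(a - k + 1) div 2 \<le> (n - k) div 2" by simp
  qed
  show "(\<Sum>n\<in>{n \<in> {a..<k + 2 * s}. even (n - k)}. 2 * (cdiffs (n - k) (rodr (k + 2 * s) n) 1)\<^sup>2 / cheb_norm (k + 2 * s) n) =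
      (\<Sum>r\<in>{(a - k + 1) div 2..<s}. even_term k s r)"
  proof (rule sum.reindex_bij_witness[of _ "\<lambda>r. k + 2 * r" "\<lambda>n. (n - k) div 2"], goal_cases)
    case (1 n)
    then show ?case by (rule h(2))
  next
    case (2 n)
    then show ?case using h(3,4)[of n] by simp
  next
    case (4 p)
    then show ?case using assms by auto
  next
    case (5 n)
    from kernel_even_term[OF h(3)[OF 5], of k, unfolded h(2)[OF 5], unfolded h(1)[OF 5]] show ?case by (rule sym)
  qed simp
qed

lemma odd_kernel_eq:
  assumes "k \<le> a"
  shows "odd_kernel a (k + 2 * s) k = (\<Sum>p\<in>{(a - k) div 2..<s}. odd_term k s p)"
  unfolding odd_kernel_def
proof -
  have h: "2 * ((n - k) div 2) + 1 = n - k" "k + 2 * ((n - k) div 2) + 1 = n" "(n - k) div 2 < s" "(a - k) div 2 \<le> (n - k) div 2"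
    if "n \<in> {n \<in> {a..<k + 2 * s}. odd (n - k)}" for n
  proof -
    have n: "a \<le> n" "n < k + 2 * s" "odd (n - k)" using that by auto
    show 1: "2 * ((n - k) div 2) + 1 = n - k" using n(3) by (rule odd_two_times_div_two_succ)
    show "k + 2 * ((n - k) div 2) + 1 = n" "(n - k) div 2 < s" using 1 n assms by linarith+
    show "(a - k) div 2 \<le> (n - k) div 2" using n by (intro div_le_mono) simp
  qed
  show "(\<Sum>n\<in>{n \<in> {a..<k + 2 * s}. odd (n - k)}. 2 * (cdiffs (n - k) (rodr (k + 2 * s) n) 1)\<^sup>2 / cheb_norm (k + 2 * s) n) =
      (\<Sum>p\<in>{(a - k) div 2..<s}. odd_term k s p)"
  proof (rule sum.reindex_bij_witness[of _ "\<lambda>p. k + 2 * p + 1" "\<lambda>n. (n - k) div 2"], goal_cases)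
    case (1 n)
    then show ?case by (rule h(2))
  next
    case (2 n)
    then show ?case using h(3,4)[of n] by simp
  next
    case (4 p)
    then show ?case using assms by auto
  next
    case (5 n)
    from kernel_odd_term[OF h(3)[OF 5], of k, unfolded h(2)[OF 5], unfolded h(1)[OF 5]] show ?case by (rule sym)
  qed simp
qed

section \<open>Limits of the two kernels and of the ratio\<close>

definition even_limit :: "real \<Rightarrow> nat \<Rightarrow> real" where
  "even_limit \<tau> k = (LINT \<sigma>|lborel. indicator {\<tau><..<1} \<sigma> * even_density k \<sigma>)"

definition odd_limit :: "real \<Rightarrow> nat \<Rightarrow> real" where
  "odd_limit \<tau> k = (LINT \<sigma>|lborel. indicator {\<tau><..<1} \<sigma> * odd_density k \<sigma>)"

lemma density_measurable:
  "(\<lambda>\<sigma>. indicator {\<tau><..<1} \<sigma> * even_density k \<sigma>) \<in> borel_measurable lborel"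
  "(\<lambda>\<sigma>. indicator {\<tau><..<1} \<sigma> * odd_density k \<sigma>) \<in> borel_measurable lborel"
  unfolding even_density_def odd_density_def by measurable

lemma fact_pred_ratio_bounded: "\<exists>B. \<forall>s. 0 \<le> fact_pred_ratio k s \<and> fact_pred_ratio k s \<le> B"
proof -
  have "convergent (fact_pred_ratio k)"
    using fact_pred_shift_limit[of k] unfolding fact_pred_ratio_def[abs_def] by (rule convergentI)
  then obtain B where "\<And>s. norm (fact_pred_ratio k s) \<le> B" using convergent_imp_Bseq BseqE by metis
  moreover have "0 \<le> fact_pred_ratio k s" for s unfolding fact_pred_ratio_def by simp
  ultimately show ?thesis by (metis abs_of_nonneg real_norm_def)
qed

text \<open>The integrability statements are recorded here too, as by-products of dominated
  convergence; they are used again for the asymptotics in k.\<close>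

lemma term_sum_limits:
  fixes s lo :: "nat \<Rightarrow> nat"
  assumes \<tau>: "0 < \<tau>" "\<tau> < 1" and s: "filterlim s at_top sequentially"
    and lo: "(\<lambda>i. real (lo i) / real (s i)) \<longlonglongrightarrow> \<tau>"
  shows "integrable lborel (\<lambda>\<sigma>. indicator {\<tau><..<1} \<sigma> * even_density k \<sigma>)"
    and "(\<lambda>i. \<Sum>r\<in>{lo i..<s i}. even_term k (s i) r) \<longlonglongrightarrow> even_limit \<tau> k"
    and "integrable lborel (\<lambda>\<sigma>. indicator {\<tau><..<1} \<sigma> * odd_density k \<sigma>)"
    and "(\<lambda>i. \<Sum>r\<in>{lo i..<s i}. odd_term k (s i) r) \<longlonglongrightarrow> odd_limit \<tau> k"
proof -
  obtain B where B: "\<And>s. 0 \<le> fact_pred_ratio k s" "\<And>s. fact_pred_ratio k s \<le> B" using fact_pred_ratio_bounded by metis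
  \<comment> \<open>Any number strictly between 0 and \<open>\<tau>\<close> would do; it keeps r / s
    away from 0 on the range of summation and thereby bounds the power
    \<open>(s / r) ^ k\<close>.\<close>
  define \<theta> where "\<theta> = \<tau> / 2"
  have \<theta>: "0 < \<theta>" "\<theta> < \<tau>" using \<tau> by (auto simp: \<theta>_def)
  have "eventually (\<lambda>i. \<theta> < real (lo i) / real (s i)) sequentially" using order_tendstoD(1)[OF lo \<theta>(2)] .
  then obtain i0 where i0: "\<And>i. i0 \<le> i \<Longrightarrow> \<theta> < real (lo i) / real (s i)" by (auto simp: eventually_sequentially)
  \<comment> \<open>The domination is required for every index, so the initial segment on which it
    may fail is shifted away.\<close>
  define s' lo' where "s' = (\<lambda>i. s (i + i0))" and "lo' = (\<lambda>i. lo (i + i0))"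
  have big: "\<theta> < real (lo' i) / real (s' i)" for i unfolding s'_def lo'_def by (rule i0) simp
  have spos: "0 < s' i" for i using big[of i] \<theta> by (cases "s' i = 0") auto
  have lopos: "0 < lo' i" for i using big[of i] \<theta> by (cases "lo' i = 0") auto
  have lb: "0 < r" "\<theta> * real (s' i) \<le> real r" if "lo' i \<le> r" for i r
  proof -
    show "0 < r" using lopos[of i] that by simp
    have "\<theta> * real (s' i) < real (lo' i)" using big[of i] spos[of i] by (simp add: field_simps)
    then show "\<theta> * real (s' i) \<le> real r" using that by linarith
  qed
  have s'top: "filterlim s' at_top sequentially"
    unfolding s'_def using filterlim_compose[OF s filterlim_add_const_nat_at_top[of i0]] .
  have lo': "(\<lambda>i. real (lo' i) / real (s' i)) \<longlonglongrightarrow> \<tau>" unfolding s'_def lo'_def by (rule LIMSEQ_ignore_initial_segment[OF lo])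
  have C: "0 \<le> 3 * (2 * real k + 5) * (real k + 2) * B\<^sup>2 * ((1 / \<theta>) ^ k)\<^sup>2" "0 \<le> 2 * (2 * real k + 7) * sqrt (4 * real k + 9) * B\<^sup>2 * ((1 / \<theta>) ^ k)\<^sup>2"
    by (auto intro!: mult_nonneg_nonneg)
  have \<sigma>: "0 < \<sigma>" if "\<tau> < \<sigma>" for \<sigma> using that \<tau> by simp
  note E = riemann_sum_dominated[OF \<tau> s'top spos lo' even_term_limit[OF \<sigma>] even_term_bound[OF lb(1) _ \<theta>(1) lb(2) B] C(1) density_measurable(1)]
  note Od = riemann_sum_dominated[OF \<tau> s'top spos lo' odd_term_limit[OF \<sigma>] odd_term_bound[OF lb(1) _ \<theta>(1) lb(2) B] C(2) density_measurable(2)]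
  show "integrable lborel (\<lambda>\<sigma>. indicator {\<tau><..<1} \<sigma> * even_density k \<sigma>)" using E(1) by simp
  show "integrable lborel (\<lambda>\<sigma>. indicator {\<tau><..<1} \<sigma> * odd_density k \<sigma>)" using Od(1) by simp
  show "(\<lambda>i. \<Sum>r\<in>{lo i..<s i}. even_term k (s i) r) \<longlonglongrightarrow> even_limit \<tau> k"
    by (rule LIMSEQ_offset[of _ i0]) (use E(2) in \<open>simp add: s'_def lo'_def even_limit_def\<close>)
  show "(\<lambda>i. \<Sum>r\<in>{lo i..<s i}. odd_term k (s i) r) \<longlonglongrightarrow> odd_limit \<tau> k"
    by (rule LIMSEQ_offset[of _ i0]) (use Od(2) in \<open>simp add: s'_def lo'_def odd_limit_def\<close>)
qed

text \<open>The corrections at k = 0 stem from the point mass, whose column then carries the sinks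
  as well.\<close>

definition correlation :: "real \<Rightarrow> nat \<Rightarrow> real" where
  "correlation \<xi> k = \<bar>(even_limit (1 / (1 + \<xi>)) k - of_bool (k = 0)) * (odd_limit (1 / (1 + \<xi>)) k - of_bool (k = 0))\<bar>"

lemma is_omega_H_correlation:
  assumes \<xi>: "0 < \<xi>"
  shows "is_omega_H k \<xi> (correlation \<xi> k)"
  unfolding is_omega_H_def
proof (intro allI impI)
  fix b assume adm: "admissible \<xi> k b"
  have b: "\<And>a. 0 < a \<Longrightarrow> 0 < b a \<and> even (a + b a + k)" and lim: "(\<lambda>a. real (b a) / real a) \<longlonglongrightarrow> \<xi>"
    using adm unfolding admissible_def by auto
  \<comment> \<open>The half height a + b = k + 2s gives s of order a (1 + \<open>\<xi>\<close>) /
    2, the lower limits of summation are of order a / 2, and \<open>\<tau>\<close> is the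
    quotient.\<close>
  define \<tau> where "\<tau> = 1 / (1 + \<xi>)"
  have \<tau>: "0 < \<tau>" "\<tau> < 1" using \<xi> by (auto simp: \<tau>_def)
  define s where "s = (\<lambda>a. (a + b a - k) div 2)"
  have s2: "a + b a = k + 2 * s a" if "0 < a" "k \<le> a" for a
    using b[OF that(1)] that(2) unfolding s_def by auto
  have kz: "(\<lambda>a. c / real a) \<longlonglongrightarrow> 0" for c by real_asymp
  have "(\<lambda>a. (1 + real (b a) / real a - real k / real a) / 2) \<longlonglongrightarrow> (1 + \<xi> - 0) / 2"
    by (intro tendsto_intros lim kz) simp
  moreover have sa: "eventually (\<lambda>a. (1 + real (b a) / real a - real k / real a) / 2 = real (s a) / real a) sequentially"
    using eventually_gt_at_top[of k]
  proof eventually_elim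
    case (elim a)
    then have "real a + real (b a) = real k + 2 * real (s a)" using s2[of a] by (metis gr0I less_imp_le not_less_zero of_nat_add of_nat_mult of_nat_numeral)
    then show ?case using elim by (simp add: field_simps)
  qed
  ultimately have srat: "(\<lambda>a. real (s a) / real a) \<longlonglongrightarrow> (1 + \<xi>) / 2" by (simp add: Lim_transform_eventually)
  have stop: "filterlim s at_top sequentially"
  proof (rule filterlim_at_top_mono)
    show "filterlim (\<lambda>a::nat. (a - k) div 2) at_top sequentially"
      unfolding filterlim_at_top
    proof
      fix Z :: nat
      show "eventually (\<lambda>a. Z \<le> (a - k) div 2) sequentially"
        using eventually_ge_at_top[of "k + 2 * Z"] by eventually_elim auto
    qed
  qed (auto simp: s_def intro: div_le_mono always_eventually)
  \<comment> \<open>The even sum uses c = 1 and the odd sum c = 0; the rounding is lost in the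
    limit.\<close>
  have lorat: "(\<lambda>a. real ((a - k + c) div 2) / real (s a)) \<longlonglongrightarrow> \<tau>" for c
  proof -
    have l: "(\<lambda>a. real ((a - k + c) div 2) / real a) \<longlonglongrightarrow> 1 / 2"
    proof (rule tendsto_sandwich)
      show "eventually (\<lambda>a. (1 - (real k + 1) / real a) / 2 \<le> real ((a - k + c) div 2) / real a) sequentially"
        using eventually_gt_at_top[of k]
      proof eventually_elim
        case (elim a)
        have "a - k + c \<le> 2 * ((a - k + c) div 2) + 1" by simp
        then have "real a - (real k + 1) \<le> 2 * real ((a - k + c) div 2)" using elim by linarith
        then have "(real a - (real k + 1)) / 2 / real a \<le> real ((a - k + c) div 2) / real a"
          by (intro divide_right_mono) auto
        moreover have "(1 - (real k + 1) / real a) / 2 = (real a - (real k + 1)) / 2 / real a"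
          using elim by (simp add: divide_simps)
        ultimately show ?case by (simp only:)
      qed
      show "eventually (\<lambda>a. real ((a - k + c) div 2) / real a \<le> (1 + real c / real a) / 2) sequentially"
        using eventually_gt_at_top[of k]
      proof eventually_elim
        case (elim a)
        have "2 * ((a - k + c) div 2) \<le> a - k + c" by simp
        then have "2 * real ((a - k + c) div 2) \<le> real a + real c" using elim by linarith
        then show ?case using elim by (simp add: field_simps)
      qed
      show "(\<lambda>a. (1 - (real k + 1) / real a) / 2) \<longlonglongrightarrow> 1 / 2" by real_asymp
      show "(\<lambda>a. (1 + real c / real a) / 2) \<longlonglongrightarrow> 1 / 2" by real_asymp
    qed
    have "(\<lambda>a. (real ((a - k + c) div 2) / real a) / (real (s a) / real a)) \<longlonglongrightarrow> (1 / 2) / ((1 + \<xi>) / 2)"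
      by (rule tendsto_divide[OF l srat]) (use \<xi> in simp)
    moreover have "eventually (\<lambda>a. (real ((a - k + c) div 2) / real a) / (real (s a) / real a) = real ((a - k + c) div 2) / real (s a)) sequentially"
      using eventually_gt_at_top[of 0] by eventually_elim simp
    ultimately have "(\<lambda>a. real ((a - k + c) div 2) / real (s a)) \<longlonglongrightarrow> (1 / 2) / ((1 + \<xi>) / 2)"
      by (rule Lim_transform_eventually)
    then show ?thesis by (simp add: \<tau>_def)
  qed
  have E: "(\<lambda>a. \<Sum>r\<in>{(a - k + 1) div 2..<s a}. even_term k (s a) r) \<longlonglongrightarrow> even_limit \<tau> k"
    by (rule term_sum_limits(2)[OF \<tau> stop lorat])
  have Od: "(\<lambda>a. \<Sum>r\<in>{(a - k) div 2..<s a}. odd_term k (s a) r) \<longlonglongrightarrow> odd_limit \<tau> k"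
    using term_sum_limits(4)[OF \<tau> stop lorat[of 0]] by simp
  have "(\<lambda>a. \<bar>((\<Sum>r\<in>{(a - k + 1) div 2..<s a}. even_term k (s a) r) - of_bool (k = 0)) *
      ((\<Sum>r\<in>{(a - k) div 2..<s a}. odd_term k (s a) r) - of_bool (k = 0))\<bar>) \<longlonglongrightarrow> correlation \<xi> k"
    unfolding correlation_def \<tau>_def[symmetric] by (intro tendsto_intros E Od)
  then show "(\<lambda>a. real (M (holey_hexagon a (b a) k)) / real (M (hexagon a (b a)))) \<longlonglongrightarrow> correlation \<xi> k"
  proof (rule Lim_transform_eventually)
    show "\<forall>\<^sub>F a in sequentially. \<bar>((\<Sum>r\<in>{(a - k + 1) div 2..<s a}. even_term k (s a) r) - of_bool (k = 0)) *
      ((\<Sum>r\<in>{(a - k) div 2..<s a}. odd_term k (s a) r) - of_bool (k = 0))\<bar> = real (M (holey_hexagon a (b a) k)) / real (M (hexagon a (b a)))"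
      using eventually_ge_at_top[of "k + 2"]
    proof eventually_elim
      case (elim a)
      have a: "2 \<le> a" "k \<le> a" "k + 2 \<le> a + b a" "0 < a" using elim by auto
      show ?case
        using M_holey_hexagon[OF a(1-3), of] b[OF a(4)] M_hexagon_pos[of a "b a"]
        unfolding s2[OF a(4,2)] even_kernel_eq[OF a(2)] odd_kernel_eq[OF a(2)] by simp
    qed
  qed
qed

lemma ex_admissible: "0 < \<xi> \<Longrightarrow> \<exists>b. admissible \<xi> k b"
proof
  assume \<xi>: "0 < \<xi>"
  \<comment> \<open>Adding 1 to the integer part keeps b positive, and the remainder modulo 2 added
    below repairs the parity; both are negligible against a.\<close>
  define c where "c = (\<lambda>a. nat \<lfloor>real a * \<xi>\<rfloor> + 1)"
  define b where "b = (\<lambda>a. c a + (a + c a + k) mod 2)"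
  have "(\<lambda>a. real (b a) / real a) \<longlonglongrightarrow> \<xi>"
  proof (rule tendsto_sandwich)
    have bd: "real a * \<xi> \<le> real (b a)" "real (b a) \<le> real a * \<xi> + 2" for a
    proof -
      have "(a + c a + k) mod 2 \<le> 1" by simp
      then have "real (c a) \<le> real (b a)" "real (b a) \<le> real (c a) + 1" unfolding b_def by linarith+
      moreover have "real a * \<xi> \<le> real (c a)" "real (c a) \<le> real a * \<xi> + 1"
      proof -
        have "0 \<le> real a * \<xi>" using \<xi> by simp
        from nat_floor_bounds(1,2)[OF this] show "real a * \<xi> \<le> real (c a)" "real (c a) \<le> real a * \<xi> + 1"
          unfolding c_def of_nat_add of_nat_1 by linarith+
      qed
      ultimately show "real a * \<xi> \<le> real (b a)" "real (b a) \<le> real a * \<xi> + 2" by linarith+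
    qed
    show "eventually (\<lambda>a. \<xi> \<le> real (b a) / real a) sequentially"
      using eventually_gt_at_top[of 0]
    proof eventually_elim
      case (elim a)
      then show ?case using bd(1)[of a] by (simp add: field_simps)
    qed
    show "eventually (\<lambda>a. real (b a) / real a \<le> \<xi> + 2 / real a) sequentially"
      using eventually_gt_at_top[of 0]
    proof eventually_elim
      case (elim a)
      then show ?case using bd(2)[of a] by (simp add: field_simps)
    qed
    show "(\<lambda>a. \<xi> + 2 / real a) \<longlonglongrightarrow> \<xi>" by real_asymp
  qed simp
  moreover have "0 < b a" "even (a + b a + k)" for a
  proof -
    show "0 < b a" by (simp add: b_def c_def)
    have eq: "a + b a + k = (a + c a + k) + (a + c a + k) mod 2" by (simp add: b_def)
    have "even (x + x mod 2)" for x :: nat by presburger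
    then show "even (a + b a + k)" unfolding eq .
  qed
  ultimately show "admissible \<xi> k b" unfolding admissible_def by simp
qed

lemma omega_H_eq_correlation:
  assumes "0 < \<xi>"
  shows "omega_H k \<xi> = correlation \<xi> k"
  unfolding omega_H_def
proof (rule the_equality)
  show "is_omega_H k \<xi> (correlation \<xi> k)" by (rule is_omega_H_correlation[OF assms])
  fix w assume "is_omega_H k \<xi> w"
  moreover obtain b where "admissible \<xi> k b" using ex_admissible[OF assms] by blast
  ultimately show "w = correlation \<xi> k"
    using is_omega_H_correlation[OF assms, of k] LIMSEQ_unique unfolding is_omega_H_def by blast
qed

section \<open>Asymptotics in k: concentration at the left endpoint\<close>

context
  fixes \<tau> :: real
  assumes \<tau>: "0 < \<tau>" "\<tau> < 1"
begin

lemma integrable_Ioo_power: "integrable lborel (\<lambda>\<sigma>. indicator {\<tau><..<1} \<sigma> * (\<tau> / \<sigma>) ^ m)"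
proof (rule Bochner_Integration.integrable_bound[where f = "\<lambda>\<sigma>::real. indicator {\<tau><..<1} \<sigma> :: real"])
  show "AE \<sigma> in lborel. norm (indicator {\<tau><..<1} \<sigma> * (\<tau> / \<sigma>) ^ m) \<le> norm (indicator {\<tau><..<1} \<sigma> :: real)"
    using \<tau> by (intro AE_I2) (auto simp: indicator_def abs_mult power_abs intro!: power_le_one)
  show "integrable lborel (indicator {\<tau><..<1} :: real \<Rightarrow> real)" using \<tau> by (intro integrable_real_indicator) auto
qed measurable

text \<open>The exponent is written as at least 2 so that the antiderivative is again a power and no
  logarithm occurs.\<close>

lemma integral_Ioo_power:
  "(LINT \<sigma>|lborel. indicator {\<tau><..<1} \<sigma> * (\<tau> / \<sigma>) ^ Suc (Suc n)) = (\<tau> - \<tau> ^ Suc (Suc n)) / real (Suc n)"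
proof -
  let ?F = "\<lambda>\<sigma>. - (\<tau> ^ Suc (Suc n)) / (real (Suc n) * \<sigma> ^ Suc n)"
  have "interval_lebesgue_integral lborel (ereal \<tau>) (ereal 1) (\<lambda>\<sigma>. (\<tau> / \<sigma>) ^ Suc (Suc n)) = ?F 1 - ?F \<tau>"
  proof (rule interval_integral_FTC_finite)
    show "continuous_on {min \<tau> 1..max \<tau> 1} (\<lambda>\<sigma>. (\<tau> / \<sigma>) ^ Suc (Suc n))"
      using \<tau> by (intro continuous_intros) auto
    fix \<sigma> assume "min \<tau> 1 \<le> \<sigma>" "\<sigma> \<le> max \<tau> 1"
    then have \<sigma>: "0 < \<sigma>" using \<tau> by auto
    have "(?F has_real_derivative (\<tau> / \<sigma>) ^ Suc (Suc n)) (at \<sigma>)"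
    proof -
      have "(?F has_real_derivative (\<tau> ^ Suc (Suc n) * (real (Suc n) * (real (Suc n) * \<sigma> ^ n))) / (real (Suc n) * \<sigma> ^ Suc n)\<^sup>2) (at \<sigma>)"
        using \<sigma> by (auto intro!: derivative_eq_intros simp: power2_eq_square simp del: of_nat_Suc power_Suc) 
      moreover have "(\<tau> ^ Suc (Suc n) * (real (Suc n) * (real (Suc n) * \<sigma> ^ n))) / (real (Suc n) * \<sigma> ^ Suc n)\<^sup>2 = (\<tau> / \<sigma>) ^ Suc (Suc n)"
        using \<sigma> by (simp add: power_divide power2_eq_square del: of_nat_Suc)
      ultimately show ?thesis by simp
    qed
    then have "(?F has_vector_derivative (\<tau> / \<sigma>) ^ Suc (Suc n)) (at \<sigma>)"
      by (simp only: has_real_derivative_iff_has_vector_derivative)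
    then show "(?F has_vector_derivative (\<tau> / \<sigma>) ^ Suc (Suc n)) (at \<sigma> within {min \<tau> 1..max \<tau> 1})"
      by (rule has_vector_derivative_at_within)
  qed
  moreover have "interval_lebesgue_integral lborel (ereal \<tau>) (ereal 1) (\<lambda>\<sigma>. (\<tau> / \<sigma>) ^ Suc (Suc n)) = (LINT \<sigma>|lborel. indicator {\<tau><..<1} \<sigma> * (\<tau> / \<sigma>) ^ Suc (Suc n))"
    using \<tau> by (simp add: interval_lebesgue_integral_def set_lebesgue_integral_def one_ereal_def)
  moreover have "?F 1 - ?F \<tau> = (\<tau> - \<tau> ^ Suc (Suc n)) / real (Suc n)"
    using \<tau> by (simp add: divide_simps del: of_nat_Suc)
  ultimately show ?thesis by simp
qed

text \<open>Near \<open>\<tau>\<close> the function h is small and the weight has mass of order 1 /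
  k; away from \<open>\<tau>\<close> the weight decays exponentially, which beats the factor k while
  h is merely integrable.\<close>

lemma power_weighted_remainder:
  fixes h :: "real \<Rightarrow> real"
  assumes int: "integrable lborel (\<lambda>\<sigma>. indicator {\<tau><..<1} \<sigma> * h \<sigma>)" and h: "\<And>\<sigma>. 0 \<le> h \<sigma>"
    and lim: "(h \<longlongrightarrow> 0) (at_right \<tau>)"
  shows "(\<lambda>k. real k * (LINT \<sigma>|lborel. indicator {\<tau><..<1} \<sigma> * ((\<tau> / \<sigma>) ^ (2 * k) * h \<sigma>))) \<longlonglongrightarrow> 0"
proof -
  define J where "J = (\<lambda>k. LINT \<sigma>|lborel. indicator {\<tau><..<1} \<sigma> * ((\<tau> / \<sigma>) ^ (2 * k) * h \<sigma>))"
  define H where "H = (LINT \<sigma>|lborel. indicator {\<tau><..<1} \<sigma> * h \<sigma>)"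
  have intJ: "integrable lborel (\<lambda>\<sigma>. indicator {\<tau><..<1} \<sigma> * ((\<tau> / \<sigma>) ^ m * h \<sigma>))" for m
  proof (rule Bochner_Integration.integrable_bound[OF int])
    have "(\<lambda>\<sigma>. (indicator {\<tau><..<1} \<sigma> * h \<sigma>) * (\<tau> / \<sigma>) ^ m) \<in> borel_measurable lborel"
      by (intro borel_measurable_times borel_measurable_integrable[OF int]) measurable
    then show "(\<lambda>\<sigma>. indicator {\<tau><..<1} \<sigma> * ((\<tau> / \<sigma>) ^ m * h \<sigma>)) \<in> borel_measurable lborel"
      by (simp add: mult_ac)
    show "AE \<sigma> in lborel. norm (indicator {\<tau><..<1} \<sigma> * ((\<tau> / \<sigma>) ^ m * h \<sigma>)) \<le> norm (indicator {\<tau><..<1} \<sigma> * h \<sigma>)"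
      using \<tau> h by (intro AE_I2) (auto simp: indicator_def abs_mult power_abs intro!: mult_left_le_one_le power_le_one)
  qed
  have J0: "0 \<le> J k" for k unfolding J_def
    using \<tau> h by (intro integral_nonneg_AE AE_I2) (auto simp: indicator_def)
  have "(\<lambda>k. real k * J k) \<longlonglongrightarrow> 0"
  proof (rule LIMSEQ_I)
    fix e :: real assume e: "0 < e"
    have "eventually (\<lambda>\<sigma>. h \<sigma> < e / 2) (at_right \<tau>)" using order_tendstoD(2)[OF lim, of "e / 2"] e by simp
    then obtain c where c: "\<tau> < c" "\<And>\<sigma>. \<tau> < \<sigma> \<Longrightarrow> \<sigma> < c \<Longrightarrow> h \<sigma> < e / 2"
      unfolding eventually_at_right_field by blast
    \<comment> \<open>The largest value of the base \<open>\<tau> / \<sigma>\<close> beyond the cut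
      c.\<close>
    define q where "q = \<tau> / c"
    have q: "0 < q" "q < 1" using c \<tau> by (auto simp: q_def)
    have bound: "J k \<le> e / 2 * (\<tau> / real (2 * k - 1)) + q ^ (2 * k) * H" if k: "0 < k" for k
    proof -
      have "J k \<le> (LINT \<sigma>|lborel. e / 2 * (indicator {\<tau><..<1} \<sigma> * (\<tau> / \<sigma>) ^ (2 * k)) + q ^ (2 * k) * (indicator {\<tau><..<1} \<sigma> * h \<sigma>))"
        unfolding J_def
      proof (rule integral_mono[OF intJ])
        show "integrable lborel (\<lambda>\<sigma>. e / 2 * (indicator {\<tau><..<1} \<sigma> * (\<tau> / \<sigma>) ^ (2 * k)) + q ^ (2 * k) * (indicator {\<tau><..<1} \<sigma> * h \<sigma>))"
          by (intro Bochner_Integration.integrable_add integrable_mult_right integrable_Ioo_power int)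
        fix \<sigma> :: real
        show "indicator {\<tau><..<1} \<sigma> * ((\<tau> / \<sigma>) ^ (2 * k) * h \<sigma>) \<le> e / 2 * (indicator {\<tau><..<1} \<sigma> * (\<tau> / \<sigma>) ^ (2 * k)) + q ^ (2 * k) * (indicator {\<tau><..<1} \<sigma> * h \<sigma>)"
        proof (cases "\<tau> < \<sigma> \<and> \<sigma> < 1")
          case True
          have p: "0 \<le> (\<tau> / \<sigma>) ^ (2 * k)" using True \<tau> by simp
          have qh: "0 \<le> q ^ (2 * k) * h \<sigma>" using q h by simp
          have "(\<tau> / \<sigma>) ^ (2 * k) * h \<sigma> \<le> e / 2 * (\<tau> / \<sigma>) ^ (2 * k) + q ^ (2 * k) * h \<sigma>"
          proof (cases "\<sigma> < c")
            case True
            then have "(\<tau> / \<sigma>) ^ (2 * k) * h \<sigma> \<le> (\<tau> / \<sigma>) ^ (2 * k) * (e / 2)"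
              using c(2)[of \<sigma>] \<open>\<tau> < \<sigma> \<and> \<sigma> < 1\<close> p by (intro mult_left_mono) auto
            then show ?thesis using qh by (simp add: mult.commute)
          next
            case False
            then have "\<tau> / \<sigma> \<le> q" unfolding q_def using c(1) \<tau> by (intro divide_left_mono) auto
            then have "(\<tau> / \<sigma>) ^ (2 * k) * h \<sigma> \<le> q ^ (2 * k) * h \<sigma>"
              using True \<tau> h by (intro mult_right_mono power_mono) auto
            moreover have "0 \<le> e / 2 * (\<tau> / \<sigma>) ^ (2 * k)" using e p by simp
            ultimately show ?thesis by linarith
          qed
          then show ?thesis using True by simp
        qed simp
      qed
      also have "\<dots> = e / 2 * (LINT \<sigma>|lborel. indicator {\<tau><..<1} \<sigma> * (\<tau> / \<sigma>) ^ (2 * k)) + q ^ (2 * k) * H"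
        unfolding H_def
        by (subst Bochner_Integration.integral_add) (auto intro!: integrable_mult_right integrable_Ioo_power int)
      also have "(LINT \<sigma>|lborel. indicator {\<tau><..<1} \<sigma> * (\<tau> / \<sigma>) ^ (2 * k)) \<le> \<tau> / real (2 * k - 1)"
      proof -
        have "2 * k = Suc (Suc (2 * k - 2))" "2 * k - 1 = Suc (2 * k - 2)" using k by auto
        then have "(LINT \<sigma>|lborel. indicator {\<tau><..<1} \<sigma> * (\<tau> / \<sigma>) ^ (2 * k)) = (\<tau> - \<tau> ^ (2 * k)) / real (2 * k - 1)"
          using integral_Ioo_power[of "2 * k - 2"] by (simp only:)
        also have "\<dots> \<le> \<tau> / real (2 * k - 1)" using \<tau> by (intro divide_right_mono) auto
        finally show ?thesis .
      qed
      finally show ?thesis using e by simp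
    qed
    have "(\<lambda>k. real k * (q\<^sup>2) ^ k) \<longlonglongrightarrow> 0"
      using q by (intro powser_times_n_limit_0) (simp add: power_less_one_iff abs_square_less_1)
    then have "(\<lambda>k. real k * (q\<^sup>2) ^ k * H) \<longlonglongrightarrow> 0 * H" by (rule tendsto_mult_right)
    then have "eventually (\<lambda>k. real k * (q\<^sup>2) ^ k * H < e / 2) sequentially" using e by (intro order_tendstoD(2)) auto
    then obtain k0 where k0: "\<And>k. k0 \<le> k \<Longrightarrow> real k * (q\<^sup>2) ^ k * H < e / 2" by (auto simp: eventually_sequentially)
    show "\<exists>no. \<forall>k\<ge>no. norm (real k * J k - 0) < e"
    proof (intro exI allI impI)
      fix k assume k: "Suc k0 \<le> k"
      have "real k * J k \<le> real k * (e / 2 * (\<tau> / real (2 * k - 1)) + q ^ (2 * k) * H)"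
        using bound[of k] k by (intro mult_left_mono) auto
      also have "\<dots> = e / 2 * (\<tau> * (real k / real (2 * k - 1))) + real k * (q\<^sup>2) ^ k * H"
        by (simp add: distrib_left power_mult)
      also have "\<tau> * (real k / real (2 * k - 1)) \<le> 1 * 1"
        using k \<tau> by (intro mult_mono) (auto simp: divide_simps of_nat_diff)
      also have "real k * (q\<^sup>2) ^ k * H < e / 2" using k0[of k] k by simp
      finally have "real k * J k < e" using e by simp
      moreover have "0 \<le> real k * J k" using J0 by simp
      ultimately show "norm (real k * J k - 0) < e" by simp
    qed
  qed
  then show ?thesis unfolding J_def .
qed

text \<open>Laplace's method: the weight \<open>(\<tau> / \<sigma>) ^ (2 * k)\<close> has mass
  \<open>\<tau> / (2 * k)\<close> to leading order, so \<open>\<phi>\<close> may be replaced by its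
  limit L at the endpoint with an error controlled by
  \<open>power_weighted_remainder\<close>.\<close>

lemma endpoint_asymptotics:
  fixes \<phi> :: "real \<Rightarrow> real"
  assumes int: "integrable lborel (\<lambda>\<sigma>. indicator {\<tau><..<1} \<sigma> * \<phi> \<sigma>)"
    and lim: "(\<phi> \<longlongrightarrow> L) (at_right \<tau>)"
  shows "(\<lambda>k. real k * (LINT \<sigma>|lborel. indicator {\<tau><..<1} \<sigma> * ((\<tau> / \<sigma>) ^ (2 * k) * \<phi> \<sigma>))) \<longlonglongrightarrow> \<tau> * L / 2"
proof -
  have int1: "integrable lborel (\<lambda>\<sigma>. indicator {\<tau><..<1} \<sigma> * (\<phi> \<sigma> - L))"
  proof -
    have "integrable lborel (\<lambda>\<sigma>. indicator {\<tau><..<1} \<sigma> * \<phi> \<sigma> - L * (indicator {\<tau><..<1} \<sigma> * (\<tau> / \<sigma>) ^ 0))"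
      by (intro Bochner_Integration.integrable_diff integrable_mult_right integrable_Ioo_power int)
    then show ?thesis by (simp add: algebra_simps)
  qed
  then have inth: "integrable lborel (\<lambda>\<sigma>. indicator {\<tau><..<1} \<sigma> * \<bar>\<phi> \<sigma> - L\<bar>)"
    using integrable_abs[OF int1] by (simp add: abs_mult)
  have "((\<lambda>\<sigma>. \<bar>\<phi> \<sigma> - L\<bar>) \<longlongrightarrow> \<bar>L - L\<bar>) (at_right \<tau>)" by (intro tendsto_intros lim)
  then have rem: "(\<lambda>k. real k * (LINT \<sigma>|lborel. indicator {\<tau><..<1} \<sigma> * ((\<tau> / \<sigma>) ^ (2 * k) * \<bar>\<phi> \<sigma> - L\<bar>))) \<longlonglongrightarrow> 0"
    by (intro power_weighted_remainder inth) auto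
  have intw: "integrable lborel (\<lambda>\<sigma>. indicator {\<tau><..<1} \<sigma> * ((\<tau> / \<sigma>) ^ m * (\<phi> \<sigma> - L)))" for m
  proof (rule Bochner_Integration.integrable_bound[OF int1])
    have "(\<lambda>\<sigma>. (indicator {\<tau><..<1} \<sigma> * (\<phi> \<sigma> - L)) * (\<tau> / \<sigma>) ^ m) \<in> borel_measurable lborel"
      by (intro borel_measurable_times borel_measurable_integrable[OF int1]) measurable
    then show "(\<lambda>\<sigma>. indicator {\<tau><..<1} \<sigma> * ((\<tau> / \<sigma>) ^ m * (\<phi> \<sigma> - L))) \<in> borel_measurable lborel"
      by (simp add: mult_ac)
    show "AE \<sigma> in lborel. norm (indicator {\<tau><..<1} \<sigma> * ((\<tau> / \<sigma>) ^ m * (\<phi> \<sigma> - L))) \<le> norm (indicator {\<tau><..<1} \<sigma> * (\<phi> \<sigma> - L))"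
      using \<tau> by (intro AE_I2) (auto simp: indicator_def abs_mult power_abs intro!: mult_left_le_one_le power_le_one)
  qed
  have dev: "(\<lambda>k. real k * (LINT \<sigma>|lborel. indicator {\<tau><..<1} \<sigma> * ((\<tau> / \<sigma>) ^ (2 * k) * (\<phi> \<sigma> - L)))) \<longlonglongrightarrow> 0"
  proof (rule Lim_null_comparison[OF _ rem], rule always_eventually, rule allI)
    fix k
    have "\<bar>LINT \<sigma>|lborel. indicator {\<tau><..<1} \<sigma> * ((\<tau> / \<sigma>) ^ (2 * k) * (\<phi> \<sigma> - L))\<bar> \<le>
        (LINT \<sigma>|lborel. \<bar>indicator {\<tau><..<1} \<sigma> * ((\<tau> / \<sigma>) ^ (2 * k) * (\<phi> \<sigma> - L))\<bar>)"
      using integral_norm_bound[of lborel "\<lambda>\<sigma>. indicator {\<tau><..<1} \<sigma> * ((\<tau> / \<sigma>) ^ (2 * k) * (\<phi> \<sigma> - L))"] by simp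
    also have "\<dots> = (LINT \<sigma>|lborel. indicator {\<tau><..<1} \<sigma> * ((\<tau> / \<sigma>) ^ (2 * k) * \<bar>\<phi> \<sigma> - L\<bar>))"
      by (simp add: abs_mult power_even_abs)
    finally show "norm (real k * (LINT \<sigma>|lborel. indicator {\<tau><..<1} \<sigma> * ((\<tau> / \<sigma>) ^ (2 * k) * (\<phi> \<sigma> - L)))) \<le>
        real k * (LINT \<sigma>|lborel. indicator {\<tau><..<1} \<sigma> * ((\<tau> / \<sigma>) ^ (2 * k) * \<bar>\<phi> \<sigma> - L\<bar>))"
      by (simp add: abs_mult mult_left_mono)
  qed
  have main: "(\<lambda>k. L * (real k * ((\<tau> - \<tau> ^ (2 * k)) / real (2 * k - 1)))) \<longlonglongrightarrow> L * (\<tau> / 2)"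
  proof (rule tendsto_mult_left, rule Lim_transform_eventually)
    have "(\<lambda>k. (\<tau>\<^sup>2) ^ k) \<longlonglongrightarrow> 0" using \<tau> by (intro LIMSEQ_power_zero) (simp add: abs_square_less_1)
    then have "(\<lambda>k. \<tau> - (\<tau>\<^sup>2) ^ k) \<longlonglongrightarrow> \<tau> - 0" by (rule tendsto_diff[OF tendsto_const])
    moreover have "(\<lambda>k. real k / (2 * real k - 1)) \<longlonglongrightarrow> 1 / 2" by real_asymp
    ultimately have "(\<lambda>k. real k / (2 * real k - 1) * (\<tau> - (\<tau>\<^sup>2) ^ k)) \<longlonglongrightarrow> 1 / 2 * (\<tau> - 0)" by (intro tendsto_mult)
    then show "(\<lambda>k. real k / (2 * real k - 1) * (\<tau> - (\<tau>\<^sup>2) ^ k)) \<longlonglongrightarrow> \<tau> / 2" by simp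
    show "\<forall>\<^sub>F k in sequentially. real k / (2 * real k - 1) * (\<tau> - (\<tau>\<^sup>2) ^ k) = real k * ((\<tau> - \<tau> ^ (2 * k)) / real (2 * k - 1))"
      using eventually_gt_at_top[of 0] by eventually_elim (simp add: of_nat_diff power_mult)
  qed
  have "(\<lambda>k. real k * (LINT \<sigma>|lborel. indicator {\<tau><..<1} \<sigma> * ((\<tau> / \<sigma>) ^ (2 * k) * (\<phi> \<sigma> - L))) +
      L * (real k * ((\<tau> - \<tau> ^ (2 * k)) / real (2 * k - 1)))) \<longlonglongrightarrow> 0 + L * (\<tau> / 2)"
    by (rule tendsto_add[OF dev main])
  then have "(\<lambda>k. real k * (LINT \<sigma>|lborel. indicator {\<tau><..<1} \<sigma> * ((\<tau> / \<sigma>) ^ (2 * k) * (\<phi> \<sigma> - L))) +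
      L * (real k * ((\<tau> - \<tau> ^ (2 * k)) / real (2 * k - 1)))) \<longlonglongrightarrow> \<tau> * L / 2" by (simp add: mult.commute)
  then show ?thesis
  proof (rule Lim_transform_eventually)
    show "\<forall>\<^sub>F k in sequentially. real k * (LINT \<sigma>|lborel. indicator {\<tau><..<1} \<sigma> * ((\<tau> / \<sigma>) ^ (2 * k) * (\<phi> \<sigma> - L))) +
      L * (real k * ((\<tau> - \<tau> ^ (2 * k)) / real (2 * k - 1))) =
      real k * (LINT \<sigma>|lborel. indicator {\<tau><..<1} \<sigma> * ((\<tau> / \<sigma>) ^ (2 * k) * \<phi> \<sigma>))"
      using eventually_gt_at_top[of 0]
    proof eventually_elim
      case (elim k)
      have "2 * k = Suc (Suc (2 * k - 2))" "2 * k - 1 = Suc (2 * k - 2)" using elim by auto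
      then have I: "(LINT \<sigma>|lborel. indicator {\<tau><..<1} \<sigma> * (\<tau> / \<sigma>) ^ (2 * k)) = (\<tau> - \<tau> ^ (2 * k)) / real (2 * k - 1)"
        using integral_Ioo_power[of "2 * k - 2"] by (simp only:)
      have "(LINT \<sigma>|lborel. indicator {\<tau><..<1} \<sigma> * ((\<tau> / \<sigma>) ^ (2 * k) * \<phi> \<sigma>)) =
         (LINT \<sigma>|lborel. indicator {\<tau><..<1} \<sigma> * ((\<tau> / \<sigma>) ^ (2 * k) * (\<phi> \<sigma> - L)) + L * (indicator {\<tau><..<1} \<sigma> * (\<tau> / \<sigma>) ^ (2 * k)))"
        by (rule Bochner_Integration.integral_cong) (auto simp: algebra_simps)
      also have "\<dots> = (LINT \<sigma>|lborel. indicator {\<tau><..<1} \<sigma> * ((\<tau> / \<sigma>) ^ (2 * k) * (\<phi> \<sigma> - L))) + L * ((\<tau> - \<tau> ^ (2 * k)) / real (2 * k - 1))"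
        unfolding I[symmetric] by (subst Bochner_Integration.integral_add) (auto intro!: integrable_mult_right integrable_Ioo_power intw)
      finally show ?case by (simp add: algebra_simps)
    qed
  qed
qed

lemma density_power:
  assumes "0 < \<sigma>"
  shows "4 / pi / 4 ^ k * ((1 / \<sigma>) ^ k)\<^sup>2 * c = 4 / pi / (4 * \<tau>\<^sup>2) ^ k * ((\<tau> / \<sigma>) ^ (2 * k) * c)"
  using \<tau> assms by (simp add: power_divide power_mult_distrib power_mult[symmetric] mult.commute)

lemma even_limit_asymptotics:
  "(\<lambda>k. even_limit \<tau> k * (real k * (4 * \<tau>\<^sup>2) ^ k * pi / 4)) \<longlonglongrightarrow> \<tau> * sqrt ((1 - \<tau>) * (1 + \<tau>)) / 2"
proof -
  let ?\<phi> = "\<lambda>\<sigma>. sqrt ((1 - \<sigma>) * (1 + \<sigma>))"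
  \<comment> \<open>At k = 0 the density is a multiple of the factor that does not depend on k. Any
    sequences with quotient tending to \<open>\<tau>\<close> give its integrability; the identity
    and the integer parts of its multiples by \<open>\<tau>\<close> serve.\<close>
  have "integrable lborel (\<lambda>\<sigma>. indicator {\<tau><..<1} \<sigma> * even_density 0 \<sigma>)"
    by (rule term_sum_limits(1)[OF \<tau> filterlim_ident nat_floor_ratio[OF \<tau>]])
  then have "integrable lborel (\<lambda>\<sigma>. pi / 4 * (indicator {\<tau><..<1} \<sigma> * even_density 0 \<sigma>))" by (rule integrable_mult_right)
  then have int: "integrable lborel (\<lambda>\<sigma>. indicator {\<tau><..<1} \<sigma> * ?\<phi> \<sigma>)" by (simp add: even_density_def)
  have "(?\<phi> \<longlongrightarrow> ?\<phi> \<tau>) (at_right \<tau>)" by (intro tendsto_intros)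
  from endpoint_asymptotics[OF int this]
  have lim: "(\<lambda>k. real k * (LINT \<sigma>|lborel. indicator {\<tau><..<1} \<sigma> * ((\<tau> / \<sigma>) ^ (2 * k) * ?\<phi> \<sigma>))) \<longlonglongrightarrow> \<tau> * ?\<phi> \<tau> / 2" .
  have eq: "even_limit \<tau> k = 4 / pi / (4 * \<tau>\<^sup>2) ^ k * (LINT \<sigma>|lborel. indicator {\<tau><..<1} \<sigma> * ((\<tau> / \<sigma>) ^ (2 * k) * ?\<phi> \<sigma>))" for k
  proof -
    have "even_limit \<tau> k = (LINT \<sigma>|lborel. 4 / pi / (4 * \<tau>\<^sup>2) ^ k * (indicator {\<tau><..<1} \<sigma> * ((\<tau> / \<sigma>) ^ (2 * k) * ?\<phi> \<sigma>)))"
      unfolding even_limit_def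
    proof (rule Bochner_Integration.integral_cong)
      fix \<sigma> :: real
      show "indicator {\<tau><..<1} \<sigma> * even_density k \<sigma> = 4 / pi / (4 * \<tau>\<^sup>2) ^ k * (indicator {\<tau><..<1} \<sigma> * ((\<tau> / \<sigma>) ^ (2 * k) * ?\<phi> \<sigma>))"
        using density_power[of \<sigma> k "?\<phi> \<sigma>"] \<tau> by (cases "\<tau> < \<sigma>") (auto simp: even_density_def indicator_def)
    qed simp
    then show ?thesis by (simp only: integral_mult_right_zero)
  qed
  have "even_limit \<tau> k * (real k * (4 * \<tau>\<^sup>2) ^ k * pi / 4) =
      real k * (LINT \<sigma>|lborel. indicator {\<tau><..<1} \<sigma> * ((\<tau> / \<sigma>) ^ (2 * k) * ?\<phi> \<sigma>))" for k
    unfolding eq using \<tau> by simp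
  then show ?thesis using lim by (simp only:)
qed

lemma odd_limit_asymptotics:
  "(\<lambda>k. odd_limit \<tau> k * (real k * (4 * \<tau>\<^sup>2) ^ k * pi / 4)) \<longlonglongrightarrow> \<tau> * (\<tau>\<^sup>2 / sqrt ((1 - \<tau>) * (1 + \<tau>))) / 2"
proof -
  let ?\<phi> = "\<lambda>\<sigma>. \<sigma>\<^sup>2 / sqrt ((1 - \<sigma>) * (1 + \<sigma>))"
  have "integrable lborel (\<lambda>\<sigma>. indicator {\<tau><..<1} \<sigma> * odd_density 0 \<sigma>)"
    by (rule term_sum_limits(3)[OF \<tau> filterlim_ident nat_floor_ratio[OF \<tau>]])
  then have "integrable lborel (\<lambda>\<sigma>. pi / 4 * (indicator {\<tau><..<1} \<sigma> * odd_density 0 \<sigma>))" by (rule integrable_mult_right)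
  then have int: "integrable lborel (\<lambda>\<sigma>. indicator {\<tau><..<1} \<sigma> * ?\<phi> \<sigma>)" by (simp add: odd_density_def)
  have "(?\<phi> \<longlongrightarrow> ?\<phi> \<tau>) (at_right \<tau>)" using \<tau> by (intro tendsto_intros) auto
  from endpoint_asymptotics[OF int this]
  have lim: "(\<lambda>k. real k * (LINT \<sigma>|lborel. indicator {\<tau><..<1} \<sigma> * ((\<tau> / \<sigma>) ^ (2 * k) * ?\<phi> \<sigma>))) \<longlonglongrightarrow> \<tau> * ?\<phi> \<tau> / 2" .
  have eq: "odd_limit \<tau> k = 4 / pi / (4 * \<tau>\<^sup>2) ^ k * (LINT \<sigma>|lborel. indicator {\<tau><..<1} \<sigma> * ((\<tau> / \<sigma>) ^ (2 * k) * ?\<phi> \<sigma>))" for k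
  proof -
    have "odd_limit \<tau> k = (LINT \<sigma>|lborel. 4 / pi / (4 * \<tau>\<^sup>2) ^ k * (indicator {\<tau><..<1} \<sigma> * ((\<tau> / \<sigma>) ^ (2 * k) * ?\<phi> \<sigma>)))"
      unfolding odd_limit_def
    proof (rule Bochner_Integration.integral_cong)
      fix \<sigma> :: real
      show "indicator {\<tau><..<1} \<sigma> * odd_density k \<sigma> = 4 / pi / (4 * \<tau>\<^sup>2) ^ k * (indicator {\<tau><..<1} \<sigma> * ((\<tau> / \<sigma>) ^ (2 * k) * ?\<phi> \<sigma>))"
        using density_power[of \<sigma> k "?\<phi> \<sigma>"] \<tau> by (cases "\<tau> < \<sigma>") (auto simp: odd_density_def indicator_def)
    qed simp
    then show ?thesis by (simp only: integral_mult_right_zero)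
  qed
  have "odd_limit \<tau> k * (real k * (4 * \<tau>\<^sup>2) ^ k * pi / 4) =
      real k * (LINT \<sigma>|lborel. indicator {\<tau><..<1} \<sigma> * ((\<tau> / \<sigma>) ^ (2 * k) * ?\<phi> \<sigma>))" for k
    unfolding eq using \<tau> by simp
  then show ?thesis using lim by (simp only:)
qed

end

text \<open>The first conjunct ensures that the definite description \<open>omega_H\<close> denotes
  an actual limit. The exponent 2k - 2 is an integer one since it is negative at k = 0.\<close>

theorem theorem2p1:
  fixes \<xi> :: real
  assumes "\<xi> > 0"
  shows "(\<forall>k. is_omega_H k \<xi> (omega_H k \<xi>)) \<and>
    (\<lambda>k. omega_H k \<xi>) \<sim>[at_top]
      (\<lambda>k. (1 / (2 * real k * pi) * ((\<xi> + 1) / 2) powi (2 * int k - 2)) ^ 2)"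
proof
  show "\<forall>k. is_omega_H k \<xi> (omega_H k \<xi>)"
    using is_omega_H_correlation[OF assms] omega_H_eq_correlation[OF assms] by simp
  define \<tau> where "\<tau> = 1 / (1 + \<xi>)"
  have \<tau>: "0 < \<tau>" "\<tau> < 1" using assms by (auto simp: \<tau>_def)
  define E where "E = (\<lambda>k. even_limit \<tau> k * (real k * (4 * \<tau>\<^sup>2) ^ k * pi / 4))"
  define Od where "Od = (\<lambda>k. odd_limit \<tau> k * (real k * (4 * \<tau>\<^sup>2) ^ k * pi / 4))"
  show "(\<lambda>k. omega_H k \<xi>) \<sim>[at_top] (\<lambda>k. (1 / (2 * real k * pi) * ((\<xi> + 1) / 2) powi (2 * int k - 2)) ^ 2)"
  proof (rule asymp_equivI', rule Lim_transform_eventually)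
    let ?w = "sqrt ((1 - \<tau>) * (1 + \<tau>))"
    have w: "?w \<noteq> 0" using \<tau> by auto
    \<comment> \<open>The root in the even limit cancels the inverse root in the odd one, and the
      product of the two limits is \<open>\<tau> ^ 4 / 4\<close>.\<close>
    have "(\<lambda>k. 4 / \<tau> ^ 4 * \<bar>E k * Od k\<bar>) \<longlonglongrightarrow> 4 / \<tau> ^ 4 * \<bar>(\<tau> * ?w / 2) * (\<tau> * (\<tau>\<^sup>2 / ?w) / 2)\<bar>"
      unfolding E_def Od_def by (intro tendsto_intros even_limit_asymptotics odd_limit_asymptotics \<tau>)
    moreover have "(\<tau> * ?w / 2) * (\<tau> * (\<tau>\<^sup>2 / ?w) / 2) = \<tau> ^ 4 / 4"
      using w by (simp add: power2_eq_square power4_eq_xxxx)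
    ultimately show "(\<lambda>k. 4 / \<tau> ^ 4 * \<bar>E k * Od k\<bar>) \<longlonglongrightarrow> 1" using \<tau> by simp
    show "\<forall>\<^sub>F k in sequentially. 4 / \<tau> ^ 4 * \<bar>E k * Od k\<bar> =
        omega_H k \<xi> / (1 / (2 * real k * pi) * ((\<xi> + 1) / 2) powi (2 * int k - 2))\<^sup>2"
      using eventually_gt_at_top[of 0]
    proof eventually_elim
      case (elim k)
      \<comment> \<open>The exponent 2k - 2 = 2j leaves over one factor v =
        \<open>4 * \<tau>\<^sup>2\<close> in each of E and Od; the two of them cancel
        \<open>\<tau> ^ 4 = v\<^sup>2 / 16\<close>.\<close>
      then obtain j where k: "k = Suc j" using gr0_conv_Suc by blast
      define v where "v = 4 * \<tau>\<^sup>2"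
      have v: "0 < v" using \<tau> by (simp add: v_def)
      have x: "(\<xi> + 1) / 2 = 1 / (2 * \<tau>)" using assms by (simp add: \<tau>_def)
      have "2 * int k - 2 = int (2 * j)" by (simp add: k)
      then have "((\<xi> + 1) / 2) powi (2 * int k - 2) = ((1 / (2 * \<tau>))\<^sup>2) ^ j"
        unfolding x by (simp only: power_int_of_nat power_mult)
      also have "(1 / (2 * \<tau>))\<^sup>2 = 1 / v" by (simp add: v_def power2_eq_square)
      finally have p: "((\<xi> + 1) / 2) powi (2 * int k - 2) = 1 / v ^ j" by (simp add: power_divide)
      have om: "omega_H k \<xi> = \<bar>even_limit \<tau> k * odd_limit \<tau> k\<bar>"
        unfolding omega_H_eq_correlation[OF assms] correlation_def \<tau>_def[symmetric] using elim by simp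
      have EO: "\<bar>E k * Od k\<bar> = \<bar>even_limit \<tau> k * odd_limit \<tau> k\<bar> * (real k * v ^ k * pi / 4)\<^sup>2"
        unfolding E_def Od_def v_def[symmetric] using v by (simp add: abs_mult power2_eq_square)
      have t4: "\<tau> ^ 4 = v\<^sup>2 / 16" by (simp add: v_def power2_eq_square power4_eq_xxxx)
      have alg: "4 / (v\<^sup>2 / 16) * (c * (K * (v * V) * P / 4)\<^sup>2) = c / (1 / (2 * K * P) * (1 / V))\<^sup>2"
        if "K > 0" "P > 0" "V > 0" for c K P V :: real
        using that v by (simp add: divide_simps power2_eq_square)
      show ?case
        unfolding p om EO t4 using alg[of "real k" pi "v ^ j" "\<bar>even_limit \<tau> k * odd_limit \<tau> k\<bar>"] v elim
        by (simp add: k)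
    qed
  qed
qed

end
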